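(* Let $X=\{X^{(i)}_j\}_{i\in[n],j\in[m]}$ with $X^{(i)}_j\in\mathbb R$, and let $r>0$. For all $\epsilon>0$ and $\delta\in[0,1)$, $\mathrm{RangeEstimator}(X;\epsilon,\delta,r,R)$ satisfies person-level $(\epsilon,\delta)$-DP. In addition, let $P$ be a distribution over $\mathbb R$ with mean $\mu\in[-R,R]$ and $k$-th moment bounded by $1$, and suppose each $X^{(i)}_j\sim P$ i.i.d. Then: (i) for all $\epsilon>0$, $\beta\in(0,1)$ and $16^{1/k}/\sqrt m<r<R$, there exists $n_0=O\big(\frac{\log(1/\beta)}{\log(\sqrt m r)}+\frac{\log(R/(r\beta))}{\epsilon}\big)$ such that for all $n\ge n_0$, $\mu_{\mathrm{coarse}}=\mathrm{RangeEstimator}(X;\epsilon,0,r,R)$ satisfies $|\mu-\mu_{\mathrm{coarse}}|<2r$ with probability at least $1-\beta$; (ii) for all $\epsilon>0$, $\delta\in(0,1)$, $\beta\in(0,1)$ and $16^{1/k}/\sqrt m<r<R$, there exists $n_1=O\big(\frac{\log(1/\beta)}{\log(\sqrt m r)}+\frac{\log(1/(\delta\beta))}{\epsilon}\big)$ such that for all $n\ge n_1$, $\mu_{\mathrm{coarse}}=\mathrm{RangeEstimator}(X;\epsilon,\delta,r,R)$ satisfies $|\mu-\mu_{\mathrm{coarse}}|<2r$ with probability at least $1-\beta$.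
   Context: $k$-th moment bounded by $1$: $\mathbb E[|X-\mu|^k]\le1$. Person-level $(\epsilon,\delta)$-DP: neighboring datasets differ in all $m$ samples of at most one person $i$, and $\Pr[A(X)\in Y]\le e^\epsilon\Pr[A(X')\in Y]+\delta$. $\mathrm{RangeEstimator}(X;\epsilon,\delta,r,R)$: compute $S_i=\frac1m\sum_{j}X^{(i)}_j$ for each $i$; divide $[-R-2r,R+2r)$ into consecutive buckets of width $r$; if $\delta=0$ run a person-level $\epsilon$-DP histogram, and if $\delta>0$ a person-level $(\epsilon,\delta)$-DP histogram, on $(S_1,\dots,S_n)$ over these buckets; return the midpoint $(a+b)/2$ of the bucket $[a,b]$ with largest noisy count. The histograms used have, with probability at least $1-\beta$, $\ell_\infty$ error $O(\log(|U|/\beta)/\epsilon)$ in the $\epsilon$-DP case and $O(\log(1/(\delta\beta))/\epsilon)$ in the $(\epsilon,\delta)$-DP case, where $|U|$ is the number of buckets.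
   Formalization: The moment order is taken to be a real k ≥ 2 (for k < 2 the person means need not concentrate at rate 1/√m and the claim fails), and in (i) log(R/(rβ)) is read as max(1, log(R/(rβ))), since the literal bound fails as R/r and β tend to 1. *)

theory Defs
  imports "HOL-Probability.Probability"
begin

text \<open>A data set of \<open>n\<close> people with \<open>m\<close> samples each is a function \<open>X\<close> such that \<open>X i j\<close>, for
  \<open>i < n\<close> and \<open>j < m\<close>, is the \<open>j\<close>-th sample of person \<open>i\<close>; values at other indices are irrelevant.\<close>

type_synonym dataset = "nat \<Rightarrow> nat \<Rightarrow> real"

definition person_neighbours :: "nat \<Rightarrow> nat \<Rightarrow> dataset \<Rightarrow> dataset \<Rightarrow> bool" where
  "person_neighbours n m X X' \<longleftrightarrow> card {i. i < n \<and> (\<exists>j<m. X i j \<noteq> X' i j)} \<le> 1"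

text \<open>Randomised algorithms are maps into the probability measures on the output space \<open>N\<close>.\<close>

definition person_level_dp ::
    "nat \<Rightarrow> nat \<Rightarrow> real \<Rightarrow> real \<Rightarrow> 'o measure \<Rightarrow> (dataset \<Rightarrow> 'o measure) \<Rightarrow> bool" where
  "person_level_dp n m \<epsilon> \<delta> N A \<longleftrightarrow>
     (\<forall>X. A X \<in> space (prob_algebra N)) \<and>
     (\<forall>X X'. person_neighbours n m X X' \<longrightarrow>
        (\<forall>Y\<in>sets N. measure (A X) Y \<le> exp \<epsilon> * measure (A X') Y + \<delta>))"

text \<open>A histogram algorithm receives one real number per person, \<open>S \<in> {..<n} \<rightarrow>\<^sub>E UNIV\<close>, and a
  list of buckets \<open>[a, b)\<close>, and outputs a random vector of noisy counts indexed by the positions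
  in that list.\<close>

type_synonym bucket = "real \<times> real"
type_synonym histogram = "(nat \<Rightarrow> real) \<Rightarrow> (nat \<Rightarrow> real) measure"

abbreviation real_vectors :: "nat \<Rightarrow> (nat \<Rightarrow> real) measure" where
  "real_vectors d \<equiv> \<Pi>\<^sub>M i\<in>{..<d}. borel"

definition bucket_count :: "nat \<Rightarrow> (nat \<Rightarrow> real) \<Rightarrow> bucket \<Rightarrow> nat" where
  "bucket_count n S b = card {i. i < n \<and> S i \<in> {fst b..<snd b}}"

text \<open>As each person contributes a single number, privacy of a histogram algorithm is
  person-level privacy for data sets with one sample per person. Measurability in the data
  is what it means for a randomised algorithm to be a Markov kernel.\<close>

definition dp_histogram ::
    "real \<Rightarrow> real \<Rightarrow> nat \<Rightarrow> bucket list \<Rightarrow> histogram \<Rightarrow> bool" where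
  "dp_histogram \<epsilon> \<delta> n B H \<longleftrightarrow>
     H \<in> real_vectors n \<rightarrow>\<^sub>M prob_algebra (real_vectors (length B)) \<and>
     person_level_dp n 1 \<epsilon> \<delta> (real_vectors (length B)) (\<lambda>X. H (\<lambda>i\<in>{..<n}. X i 0))"

definition histogram_error_at_most ::
    "real \<Rightarrow> real \<Rightarrow> nat \<Rightarrow> bucket list \<Rightarrow> histogram \<Rightarrow> bool" where
  "histogram_error_at_most \<alpha> \<beta> n B H \<longleftrightarrow>
     (\<forall>S\<in>space (real_vectors n).
        measure (H S) {c \<in> space (real_vectors (length B)).
          \<forall>b<length B. \<bar>c b - real (bucket_count n S (B ! b))\<bar> \<le> \<alpha>} \<ge> 1 - \<beta>)"

text \<open>The accuracy guarantees of the two kinds of histograms; \<open>c\<close> is the constant hidden in the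
  \<open>O\<close>-notation. They are stated for fixed \<open>\<epsilon>\<close>, \<open>\<delta>\<close>, \<open>n\<close> and buckets: for approximate privacy, no
  family of algorithms can meet such a bound for all parameters simultaneously (consider
  \<open>\<epsilon>\<close> large compared with \<open>ln (1/(\<delta>\<beta>))\<close> and exponentially many people and buckets).\<close>

definition accurate_pure_histogram ::
    "real \<Rightarrow> real \<Rightarrow> nat \<Rightarrow> bucket list \<Rightarrow> histogram \<Rightarrow> bool" where
  "accurate_pure_histogram c \<epsilon> n B H \<longleftrightarrow>
     dp_histogram \<epsilon> 0 n B H \<and>
     (\<forall>\<beta>. 0 < \<beta> \<and> \<beta> < 1 \<longrightarrow> histogram_error_at_most (c * (ln (real (length B) / \<beta>) / \<epsilon>)) \<beta> n B H)"

definition accurate_approx_histogram ::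
    "real \<Rightarrow> real \<Rightarrow> real \<Rightarrow> nat \<Rightarrow> bucket list \<Rightarrow> histogram \<Rightarrow> bool" where
  "accurate_approx_histogram c \<epsilon> \<delta> n B H \<longleftrightarrow>
     dp_histogram \<epsilon> \<delta> n B H \<and>
     (\<forall>\<beta>. 0 < \<beta> \<and> \<beta> < 1 \<longrightarrow> histogram_error_at_most (c * (ln (1 / (\<delta> * \<beta>)) / \<epsilon>)) \<beta> n B H)"

text \<open>If \<open>2 * R + 4 * r\<close> is not a multiple of \<open>r\<close>, the last bucket extends beyond \<open>R + 2 * r\<close>, so
  that all buckets have width exactly \<open>r\<close>.\<close>

definition range_buckets :: "real \<Rightarrow> real \<Rightarrow> bucket list" where
  "range_buckets r R =
     map (\<lambda>b. (- R - 2 * r + real b * r, - R - 2 * r + real (Suc b) * r))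
       [0..<nat \<lceil>((R + 2 * r) - (- R - 2 * r)) / r\<rceil>]"

definition person_means :: "nat \<Rightarrow> nat \<Rightarrow> dataset \<Rightarrow> (nat \<Rightarrow> real)" where
  "person_means n m X = (\<lambda>i\<in>{..<n}. (\<Sum>j<m. X i j) / real m)"

definition midpoint_of_largest :: "bucket list \<Rightarrow> (nat \<Rightarrow> real) \<Rightarrow> real" where
  "midpoint_of_largest B c = (let (a, b) = B ! arg_max_on c {..<length B} in (a + b) / 2)"

text \<open>The two histogram algorithms used as subroutines are parameters, \<open>hp \<epsilon> n B\<close> for pure and
  \<open>ha \<epsilon> \<delta> n B\<close> for approximate privacy. Ties between largest noisy counts are broken by the fixed
  but unspecified choice made by \<^const>\<open>arg_max_on\<close>.\<close>

definition range_estimator ::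
    "(real \<Rightarrow> nat \<Rightarrow> bucket list \<Rightarrow> histogram) \<Rightarrow>
     (real \<Rightarrow> real \<Rightarrow> nat \<Rightarrow> bucket list \<Rightarrow> histogram) \<Rightarrow>
     nat \<Rightarrow> nat \<Rightarrow> real \<Rightarrow> real \<Rightarrow> real \<Rightarrow> real \<Rightarrow> dataset \<Rightarrow> real measure" where
  "range_estimator hp ha n m \<epsilon> \<delta> r R X =
     (let B = range_buckets r R;
          S = person_means n m X;
          noisy_counts = (if \<delta> = 0 then hp \<epsilon> n B S else ha \<epsilon> \<delta> n B S)
      in distr noisy_counts borel (midpoint_of_largest B))"

definition moment_bounded_by_one :: "real \<Rightarrow> real measure \<Rightarrow> real \<Rightarrow> bool" where
  "moment_bounded_by_one k P \<mu> \<longleftrightarrow>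
     integrable P (\<lambda>x. \<bar>x - \<mu>\<bar> powr k) \<and> (\<integral>x. \<bar>x - \<mu>\<bar> powr k \<partial>P) \<le> 1"

definition real_distribution_with_mean :: "real measure \<Rightarrow> real \<Rightarrow> bool" where
  "real_distribution_with_mean P \<mu> \<longleftrightarrow>
     prob_space P \<and> sets P = sets borel \<and> integrable P (\<lambda>x. x) \<and> (\<integral>x. x \<partial>P) = \<mu>"

definition iid_dataset :: "nat \<Rightarrow> nat \<Rightarrow> real measure \<Rightarrow> dataset measure" where
  "iid_dataset n m P = (\<Pi>\<^sub>M i\<in>{..<n}. \<Pi>\<^sub>M j\<in>{..<m}. P)"

text \<open>The probability, over both the data and the internal randomness of \<open>A\<close>, that the output of
  \<open>A\<close> lies in \<open>Y\<close>.\<close>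

definition iid_prob ::
    "nat \<Rightarrow> nat \<Rightarrow> real measure \<Rightarrow> (dataset \<Rightarrow> real measure) \<Rightarrow> real set \<Rightarrow> real" where
  "iid_prob n m P A Y = measure (iid_dataset n m P \<bind> A) Y"

end

theory Submission
  imports Defs
begin

text \<open>Privacy is post-processing. For accuracy, let \<open>s = sqrt m * r\<close>. As \<open>k\<close> grows, \<open>s\<close> may be
  arbitrarily close to \<open>1\<close>, where Chebyshev's inequality no longer shows that a bucket near \<open>\<mu>\<close> is more
  likely than every far one. Instead, for a convex \<open>g\<close> with bounded curvature, the expectation of \<open>g\<close> at the
  normalised sum of centred samples is at most its average over random signs, up to an error of order
  \<open>1 / k\<close>, because a centred variable in \<open>[-1, 1]\<close> is dominated by a random sign in the convex order and
  the moment bound makes larger values rare. For \<open>g x = pi\<^sup>2 * x\<^sup>2 / 2 - 1 + cos (pi * x)\<close>, cut off at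
  \<open>x \<le> 0\<close>, the sign average is explicit, and Markov's inequality bounds each one-sided tail beyond
  \<open>3 * r / 2\<close> by a constant below \<open>1/5\<close>. So some good bucket always has an absolute lead over both far tails,
  and exponential moment bounds transfer this to the counts. For large \<open>s\<close> the tails have mass at most \<open>1 / s\<^sup>2\<close>, which gives the
  factor \<open>1 / ln s\<close> in the number of people.\<close>

subsection \<open>Replacing summands by random signs\<close>

text \<open>Two uniformity requirements shape the argument. The final constant may depend only on
  the histogram constant, so limit theorems in \<open>m\<close> or \<open>k\<close> are of no help
  and each numerical margin must hold for all laws \<open>P\<close> at once. For approximate privacy
  the number of people must not depend on \<open>R / r\<close>, which excludes a union bound over
  the buckets; a bad bucket is therefore compared with the whole tail on its side, so that only two
  events remain to be controlled. The winner is not known in advance either: only the joint mass of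
  three or four good buckets is bounded below, and the fullest of them is picked after seeing the
  data. As the best of \<open>c\<close> buckets is only sure of a share \<open>1 / c\<close>, the
  budget is \<open>c\<close> times one tail plus the mass outside the window. With three buckets
  this forces one-sided tails just below 1/5, and the numerical bounds leave a margin of 0.004, from
  which all later rates descend. Finally, for \<beta> near 1 the term
  \<open>ln (1 / \<beta>)\<close> tends to 0, so no constant factor in front of a failure
  probability may be lost.\<close>

definition chord_bound :: "real \<Rightarrow> (real \<Rightarrow> real) \<Rightarrow> bool" where
  "chord_bound K g \<longleftrightarrow> (\<forall>w a x. 0 \<le> a \<longrightarrow>
     g (w + a * x) \<le> (g (w + a) + g (w - a)) / 2 + x * ((g (w + a) - g (w - a)) / 2) + K * a\<^sup>2 * max 0 (x\<^sup>2 - 1))"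

definition avg_step :: "real \<Rightarrow> (real \<Rightarrow> real) \<Rightarrow> real \<Rightarrow> real" where
  "avg_step a g x = (g (x + a) + g (x - a)) / 2"

text \<open>The right-hand side of \<open>chord_bound\<close> is the secant of \<open>g\<close>
  through \<open>w - a\<close> and \<open>w + a\<close>, plus a quadratic penalty outside [-1, 1].
  Demanding it for every centre \<open>w\<close> makes the property stable under averaging of
  translates, so that samples can be replaced one at a time with the same \<open>K\<close>.\<close>

lemma chord_bound_avg_step:
  assumes "chord_bound K g"
  shows "chord_bound K (avg_step b g)"
  unfolding chord_bound_def
proof (intro allI impI)
  fix w a x :: real
  assume a: "0 \<le> a"
  let ?E = "K * a\<^sup>2 * max 0 (x\<^sup>2 - 1)"
  have "g (w + b + a * x) \<le> (g (w + b + a) + g (w + b - a)) / 2 + x * ((g (w + b + a) - g (w + b - a)) / 2) + ?E"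
    and "g (w - b + a * x) \<le> (g (w - b + a) + g (w - b - a)) / 2 + x * ((g (w - b + a) - g (w - b - a)) / 2) + ?E"
    using assms a unfolding chord_bound_def by blast+
  then show "avg_step b g (w + a * x) \<le> (avg_step b g (w + a) + avg_step b g (w - a)) / 2
      + x * ((avg_step b g (w + a) - avg_step b g (w - a)) / 2) + ?E"
    unfolding avg_step_def by (simp add: algebra_simps add_divide_distrib diff_divide_distrib)
qed

text \<open>Inside [-1, 1] this is convexity of \<open>g\<close>. Outside, a convex function lies
  above the extension of its secant; for \<open>K * x\<^sup>2 - g x\<close> this bounds
  \<open>g\<close> from above, and the square itself leaves its secant by exactly
  \<open>a\<^sup>2 * (x\<^sup>2 - 1)\<close>.\<close>

lemma chord_bound_of_convex:
  assumes g: "convex_on UNIV g" and k: "convex_on UNIV (\<lambda>x. K * x\<^sup>2 - g x)"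
  shows "chord_bound K g"
  unfolding chord_bound_def
proof (intro allI impI)
  fix w a x :: real
  assume a: "0 \<le> a"
  define k where "k = (\<lambda>x. K * x\<^sup>2 - g x)"
  have k: "convex_on UNIV k" using k by (simp add: k_def)
  show "g (w + a * x) \<le> (g (w + a) + g (w - a)) / 2 + x * ((g (w + a) - g (w - a)) / 2) + K * a\<^sup>2 * max 0 (x\<^sup>2 - 1)"
  proof -
    consider "\<bar>x\<bar> \<le> 1" | "x > 1" | "x < -1" by linarith
    then show ?thesis
    proof cases
      case 1
      define t where "t = (1 - x) / 2"
      have x: "x = 1 - 2 * t" by (simp add: t_def field_simps)
      have "g ((1 - t) *\<^sub>R (w + a) + t *\<^sub>R (w - a)) \<le> (1 - t) * g (w + a) + t * g (w - a)"
        using 1 by (intro convex_onD[OF g]) (auto simp: t_def)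
      moreover have "(1 - t) *\<^sub>R (w + a) + t *\<^sub>R (w - a) = w + a * x"
        by (simp add: x algebra_simps)
      moreover have "(1 - t) * g (w + a) + t * g (w - a) = (g (w + a) + g (w - a)) / 2 + x * ((g (w + a) - g (w - a)) / 2)"
        by (simp add: x field_simps)
      moreover have "max 0 (x\<^sup>2 - 1) = 0"
        using 1 abs_square_le_1[of x] by (intro max_absorb1) simp
      ultimately show ?thesis by simp
    next
      case 2
      have pos: "0 < 1 + x" using 2 by simp
      \<comment> \<open>For \<open>x > 1\<close> the inner point is \<open>w + a\<close>, between
        \<open>w - a\<close> and \<open>w + a * x\<close>, with barycentric weight
        \<open>2 / (1 + x)\<close>.\<close>
      have "k ((1 - 2 / (1 + x)) *\<^sub>R (w - a) + (2 / (1 + x)) *\<^sub>R (w + a * x)) \<le> (1 - 2 / (1 + x)) * k (w - a) + (2 / (1 + x)) * k (w + a * x)"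
        using 2 by (intro convex_onD[OF k]) (auto simp: field_simps)
      moreover have "(1 - 2 / (1 + x)) *\<^sub>R (w - a) + (2 / (1 + x)) *\<^sub>R (w + a * x) = w + a"
      proof -
        have "(1 - t) * (w - a) + t * (w + a * x) = w - a + t * (a * (1 + x))" for t
          by (simp add: algebra_simps)
        then have "(1 - 2 / (1 + x)) * (w - a) + (2 / (1 + x)) * (w + a * x) = w - a + 2 / (1 + x) * (a * (1 + x))" .
        also have "\<dots> = w + a" using pos by simp
        finally show ?thesis by simp
      qed
      ultimately have "(1 + x) * k (w + a) \<le> (1 + x) * ((1 - 2 / (1 + x)) * k (w - a) + (2 / (1 + x)) * k (w + a * x))"
        using pos by (intro mult_left_mono) auto
      also have "\<dots> = (1 + x) * k (w - a) + (1 + x) * (2 / (1 + x)) * (k (w + a * x) - k (w - a))"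
        by (simp only: right_diff_distrib left_diff_distrib distrib_left mult_1_left mult.assoc)
      also have "(1 + x) * (2 / (1 + x)) = 2"
        using pos by (subst times_divide_eq_right, subst nonzero_mult_div_cancel_left) auto
      also have "(1 + x) * k (w - a) + 2 * (k (w + a * x) - k (w - a)) = (x - 1) * k (w - a) + 2 * k (w + a * x)"
        by (simp add: algebra_simps)
      finally have "(1 + x) * k (w + a) \<le> (x - 1) * k (w - a) + 2 * k (w + a * x)" .
      moreover have "max 0 (x\<^sup>2 - 1) = x\<^sup>2 - 1" using 2 by (simp add: max_def)
      ultimately show ?thesis unfolding k_def
        by (simp add: field_simps power2_eq_square)
    next
      case 3
      have pos: "0 < 1 - x" using 3 by simp
      have "k ((1 - 2 / (1 - x)) *\<^sub>R (w + a) + (2 / (1 - x)) *\<^sub>R (w + a * x)) \<le> (1 - 2 / (1 - x)) * k (w + a) + (2 / (1 - x)) * k (w + a * x)"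
        using 3 by (intro convex_onD[OF k]) (auto simp: field_simps)
      moreover have "(1 - 2 / (1 - x)) *\<^sub>R (w + a) + (2 / (1 - x)) *\<^sub>R (w + a * x) = w - a"
      proof -
        have "(1 - t) * (w + a) + t * (w + a * x) = w + a - t * (a * (1 - x))" for t
          by (simp add: algebra_simps)
        then have "(1 - 2 / (1 - x)) * (w + a) + (2 / (1 - x)) * (w + a * x) = w + a - 2 / (1 - x) * (a * (1 - x))" .
        also have "\<dots> = w - a" using pos by simp
        finally show ?thesis by simp
      qed
      ultimately have "(1 - x) * k (w - a) \<le> (1 - x) * ((1 - 2 / (1 - x)) * k (w + a) + (2 / (1 - x)) * k (w + a * x))"
        using pos by (intro mult_left_mono) auto
      also have "\<dots> = (1 - x) * k (w + a) + (1 - x) * (2 / (1 - x)) * (k (w + a * x) - k (w + a))"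
        by (simp only: right_diff_distrib left_diff_distrib distrib_left mult_1_left mult.assoc)
      also have "(1 - x) * (2 / (1 - x)) = 2"
        using pos by (subst times_divide_eq_right, subst nonzero_mult_div_cancel_left) auto
      also have "(1 - x) * k (w + a) + 2 * (k (w + a * x) - k (w + a)) = (- x - 1) * k (w + a) + 2 * k (w + a * x)"
        by (simp add: algebra_simps)
      finally have "(1 - x) * k (w - a) \<le> (- x - 1) * k (w + a) + 2 * k (w + a * x)" .
      moreover have "max 0 (x\<^sup>2 - 1) = x\<^sup>2 - 1"
        using 3 one_le_power[of "-x" 2] by (simp add: max_def)
      ultimately show ?thesis unfolding k_def
        by (simp add: field_simps power2_eq_square)
    qed
  qed
qed

text \<open>On integrating the chord inequality the slope term vanishes because \<open>Y\<close> is
  centred, which leaves a fair sign in place of \<open>Y\<close>. The nonnegative integral spares a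
  proof that \<open>g (w + a * Y x)\<close> is integrable.\<close>

lemma (in prob_space) nn_integral_le_avg_step:
  fixes Y :: "'a \<Rightarrow> real"
  assumes g: "chord_bound K g" "\<And>x. 0 \<le> g x" "g \<in> borel_measurable borel"
    and Y: "integrable M Y" "expectation Y = 0"
    and Q: "integrable M (\<lambda>x. max 0 ((Y x)\<^sup>2 - 1))" "expectation (\<lambda>x. max 0 ((Y x)\<^sup>2 - 1)) \<le> q"
    and "0 \<le> a" "0 \<le> K"
  shows "(\<integral>\<^sup>+x. g (w + a * Y x) \<partial>M) \<le> ennreal (avg_step a g w + K * a\<^sup>2 * q)"
proof -
  define B where "B x = avg_step a g w + Y x * ((g (w + a) - g (w - a)) / 2) + K * a\<^sup>2 * max 0 ((Y x)\<^sup>2 - 1)" for x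
  have gB: "g (w + a * Y x) \<le> B x" for x
    using g(1) \<open>0 \<le> a\<close> unfolding chord_bound_def B_def avg_step_def by blast
  have "(\<integral>\<^sup>+x. g (w + a * Y x) \<partial>M) \<le> (\<integral>\<^sup>+x. B x \<partial>M)"
    by (intro nn_integral_mono ennreal_leI gB)
  also have "\<dots> = ennreal (\<integral>x. B x \<partial>M)"
  proof (rule nn_integral_eq_integral)
    show "integrable M B" unfolding B_def using Y Q by auto
    show "AE x in M. 0 \<le> B x" using gB g(2) order_trans by blast
  qed
  also have "(\<integral>x. B x \<partial>M) = avg_step a g w + K * a\<^sup>2 * expectation (\<lambda>x. max 0 ((Y x)\<^sup>2 - 1))"
    unfolding B_def using Y Q by (simp add: prob_space)
  also have "\<dots> \<le> avg_step a g w + K * a\<^sup>2 * q"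
    using Q \<open>0 \<le> K\<close> by (intro add_left_mono mult_left_mono) auto
  finally show ?thesis by (simp add: ennreal_leI)
qed

lemma avg_step_funpow_shift: "(avg_step a ^^ n) (avg_step a g) w = (avg_step a ^^ Suc n) g w"
  by (simp only: funpow_Suc_right comp_def)

lemma avg_step_nonneg: "(\<And>x. 0 \<le> g x) \<Longrightarrow> 0 \<le> avg_step a g x"
  by (simp add: avg_step_def)

text \<open>The induction generalises over \<open>g\<close>: integrating out the last sample turns
  \<open>g\<close> into \<open>avg_step a g\<close> and costs \<open>K * a\<^sup>2 * q\<close>. With
  \<open>a = 1 / sqrt n\<close> the \<open>n\<close> costs add up to \<open>K * q\<close>, whatever
  \<open>n\<close> is.\<close>

lemma (in prob_space) nn_integral_sum_le_avg_step:
  fixes Y :: "'a \<Rightarrow> real"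
  assumes "chord_bound K g" "\<And>x. 0 \<le> g x" "g \<in> borel_measurable borel"
    and Y: "integrable M Y" "expectation Y = 0"
    and Q: "integrable M (\<lambda>x. max 0 ((Y x)\<^sup>2 - 1))" "expectation (\<lambda>x. max 0 ((Y x)\<^sup>2 - 1)) \<le> q"
    and a: "0 \<le> a" "0 \<le> K"
  shows "(\<integral>\<^sup>+x. g (w + a * (\<Sum>j<n. Y (x j))) \<partial>(\<Pi>\<^sub>M j\<in>{..<n}. M))
     \<le> ennreal ((avg_step a ^^ n) g w + n * (K * a\<^sup>2 * q))"
  using assms(1-3)
proof (induction n arbitrary: g)
  case 0
  interpret E: prob_space "\<Pi>\<^sub>M j\<in>{}::nat set. M"
    by (intro prob_space_PiM prob_space_axioms)
  show ?case by (simp add: E.emeasure_space_1)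
next
  case (Suc n)
  interpret PS: product_sigma_finite "\<lambda>_::nat. M"
    by (simp add: product_sigma_finite_def prob_space_axioms prob_space_imp_sigma_finite)
  interpret PP: prob_space "\<Pi>\<^sub>M j\<in>{..<n}. M"
    by (intro prob_space_PiM prob_space_axioms)
  have q: "0 \<le> q" using Q(2) by (rule order_trans[rotated]) simp
  have Ym [measurable]: "Y \<in> borel_measurable M" using Y by auto
  have gm [measurable]: "g \<in> borel_measurable borel" by fact
  have avm [measurable]: "avg_step a g \<in> borel_measurable borel" unfolding avg_step_def[abs_def] by measurable
  have ins: "{..<Suc n} = insert n {..<n}" by auto
  have "(\<integral>\<^sup>+x. g (w + a * (\<Sum>j<Suc n. Y (x j))) \<partial>(\<Pi>\<^sub>M j\<in>{..<Suc n}. M)) =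
     (\<integral>\<^sup>+x. \<integral>\<^sup>+y. g (w + a * (\<Sum>j<Suc n. Y ((x(n := y)) j))) \<partial>M \<partial>(\<Pi>\<^sub>M j\<in>{..<n}. M))"
    unfolding ins by (rule PS.product_nn_integral_insert) (auto simp: lessThan_Suc[symmetric])
  also have "\<dots> = (\<integral>\<^sup>+x. \<integral>\<^sup>+y. g ((w + a * (\<Sum>j<n. Y (x j))) + a * Y y) \<partial>M \<partial>(\<Pi>\<^sub>M j\<in>{..<n}. M))"
    by (intro nn_integral_cong) (simp add: algebra_simps)
  also have "\<dots> \<le> (\<integral>\<^sup>+x. ennreal (avg_step a g (w + a * (\<Sum>j<n. Y (x j))) + K * a\<^sup>2 * q) \<partial>(\<Pi>\<^sub>M j\<in>{..<n}. M))"
    by (intro nn_integral_mono nn_integral_le_avg_step[OF Suc.prems Y Q a])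
  also have "\<dots> = (\<integral>\<^sup>+x. ennreal (avg_step a g (w + a * (\<Sum>j<n. Y (x j)))) + ennreal (K * a\<^sup>2 * q) \<partial>(\<Pi>\<^sub>M j\<in>{..<n}. M))"
    using a q Suc.prems by (intro nn_integral_cong ennreal_plus) (auto intro: avg_step_nonneg)
  also have "\<dots> = (\<integral>\<^sup>+x. ennreal (avg_step a g (w + a * (\<Sum>j<n. Y (x j)))) \<partial>(\<Pi>\<^sub>M j\<in>{..<n}. M)) + ennreal (K * a\<^sup>2 * q)"
    by (subst nn_integral_add) (auto simp: PP.emeasure_space_1)
  also have "\<dots> \<le> ennreal ((avg_step a ^^ n) (avg_step a g) w + n * (K * a\<^sup>2 * q)) + ennreal (K * a\<^sup>2 * q)"
    using Suc.prems by (intro add_right_mono Suc.IH chord_bound_avg_step avg_step_nonneg) auto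
  also have "\<dots> = ennreal ((avg_step a ^^ n) (avg_step a g) w + n * (K * a\<^sup>2 * q) + K * a\<^sup>2 * q)"
  proof -
    have "0 \<le> (avg_step a ^^ i) g x" for i x
      by (induction i arbitrary: x) (auto intro: avg_step_nonneg Suc.prems(2))
    from this[of "Suc n"] have "0 \<le> (avg_step a ^^ n) (avg_step a g) w" 
      by (simp only: avg_step_funpow_shift)
    then show ?thesis using a q by (intro ennreal_plus[symmetric]) auto
  qed
  also have "\<dots> = ennreal ((avg_step a ^^ Suc n) g w + Suc n * (K * a\<^sup>2 * q))"
    unfolding avg_step_funpow_shift by (simp add: algebra_simps)
  finally show ?case .
qed

subsection \<open>A convex barrier with an explicit binary average\<close>

text \<open>The frequency \<^term>\<open>pi\<close> makes the cosine vanish at \<open>3/2\<close>, the distance (in bucket widths) at which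
  a bucket may stop being acceptable, and keeps the average over \<open>m \<ge> 3\<close> signs, which involves
  \<^term>\<open>cos (pi / sqrt m) ^ m\<close>, small.\<close>

definition even_barrier :: "real \<Rightarrow> real" where
  "even_barrier x = pi\<^sup>2 * x\<^sup>2 / 2 - 1 + cos (pi * x)"

text \<open>The second derivative of \<open>even_barrier\<close> is
  \<open>pi\<^sup>2 * (1 - cos (pi * x))\<close>. It stays between 0 and
  \<open>2 * pi\<^sup>2\<close> and vanishes at 0, so the cut-off costs no curvature, while symmetry
  halves the sign average.\<close>

definition barrier :: "real \<Rightarrow> real" where
  "barrier x = (if 0 < x then even_barrier x else 0)"

lemma even_barrier_nonneg: "0 \<le> even_barrier x"
  and even_barrier_le: "even_barrier x \<le> pi\<^sup>2 * x\<^sup>2 / 2"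
proof -
  have "cos (pi * x) = 1 - 2 * (sin (pi * x / 2))\<^sup>2"
    using cos_double_sin[of "pi * x / 2"] by simp
  moreover have "(sin (pi * x / 2))\<^sup>2 \<le> (pi * x / 2)\<^sup>2"
    using abs_sin_x_le_abs_x[of "pi * x / 2"] by (rule abs_le_square_iff[THEN iffD1])
  ultimately show "0 \<le> even_barrier x" by (simp add: even_barrier_def power_mult_distrib power_divide)
  show "even_barrier x \<le> pi\<^sup>2 * x\<^sup>2 / 2" by (simp add: even_barrier_def)
qed

lemma even_barrier_minus: "even_barrier (- x) = even_barrier x"
  by (simp add: even_barrier_def)

lemma barrier_add_reflect: "barrier x + barrier (- x) = even_barrier x"
  by (auto simp: barrier_def even_barrier_minus) (simp add: even_barrier_def)

lemma barrier_nonneg: "0 \<le> barrier x"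
  by (simp add: barrier_def even_barrier_nonneg)

lemma even_barrier_deriv: "(even_barrier has_real_derivative pi\<^sup>2 * x - pi * sin (pi * x)) (at x)"
  unfolding even_barrier_def[abs_def] by (auto intro!: derivative_eq_intros simp: power2_eq_square)

lemma barrier_deriv: "(barrier has_real_derivative (if 0 < x then pi\<^sup>2 * x - pi * sin (pi * x) else 0)) (at x)"
proof -
  consider "0 < x" | "x < 0" | "x = 0" by linarith
  then show ?thesis
  proof cases
    case 1
    have "(barrier has_real_derivative pi\<^sup>2 * x - pi * sin (pi * x)) (at x)"
      by (rule has_field_derivative_transform_within_open[OF even_barrier_deriv, where S = "{0<..}"]) (use 1 in \<open>auto simp: barrier_def\<close>)
    then show ?thesis using 1 by simp
  next
    case 2
    have "(barrier has_real_derivative 0) (at x)"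
      by (rule has_field_derivative_transform_within_open[where f = "\<lambda>_. 0" and S = "{..<0}"]) (use 2 in \<open>auto simp: barrier_def\<close>)
    then show ?thesis using 2 by simp
  next
    case 3
    have "((\<lambda>y. barrier y / y) \<longlongrightarrow> 0) (at 0)"
    proof (rule Lim_null_comparison)
      show "\<forall>\<^sub>F y in at 0. norm (barrier y / y) \<le> pi\<^sup>2 / 2 * \<bar>y\<bar>"
      proof (rule always_eventually, rule allI)
        fix y :: real
        show "norm (barrier y / y) \<le> pi\<^sup>2 / 2 * \<bar>y\<bar>"
        proof (cases "0 < y")
          case True
          then show ?thesis
            using even_barrier_le[of y] even_barrier_nonneg[of y] by (simp add: barrier_def field_simps power2_eq_square)
        next
          case False
          then have "barrier y = 0" by (simp add: barrier_def)
          then show ?thesis by simp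
        qed
      qed
      show "((\<lambda>y. pi\<^sup>2 / 2 * \<bar>y\<bar>) \<longlongrightarrow> 0) (at (0::real))"
        by (auto intro!: tendsto_eq_intros)
    qed
    then show ?thesis using 3 by (simp add: has_field_derivative_iff barrier_def)
  qed
qed

lemma sin_diff_le:
  fixes x y :: real
  assumes "x \<le> y"
  shows "\<bar>sin y - sin x\<bar> \<le> y - x"
proof -
  have "\<bar>sin y - sin x\<bar> = 2 * (\<bar>sin ((y - x) / 2)\<bar> * \<bar>cos ((y + x) / 2)\<bar>)"
    by (simp add: sin_diff_sin abs_mult)
  also have "\<dots> \<le> 2 * (\<bar>(y - x) / 2\<bar> * 1)"
    by (intro mult_left_mono mult_mono abs_sin_x_le_abs_x) auto
  finally show ?thesis using assms by simp
qed

text \<open>The two expressions are the derivatives of \<open>even_barrier x\<close> and of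
  \<open>pi\<^sup>2 * x\<^sup>2 - even_barrier x\<close>. That both increase is the 1-Lipschitz
  property of the sine.\<close>

lemma barrier_deriv_mono:
  fixes x y :: real
  assumes "x \<le> y"
  shows "pi\<^sup>2 * x - pi * sin (pi * x) \<le> pi\<^sup>2 * y - pi * sin (pi * y)"
    and "pi\<^sup>2 * x + pi * sin (pi * x) \<le> pi\<^sup>2 * y + pi * sin (pi * y)"
proof -
  have "\<bar>sin (pi * y) - sin (pi * x)\<bar> \<le> pi * y - pi * x"
    using assms by (intro sin_diff_le) simp
  then have "sin (pi * y) - sin (pi * x) \<le> pi * y - pi * x" "sin (pi * x) - sin (pi * y) \<le> pi * y - pi * x"
    by linarith+
  then have "pi * (sin (pi * y) - sin (pi * x)) \<le> pi * (pi * y - pi * x)" "pi * (sin (pi * x) - sin (pi * y)) \<le> pi * (pi * y - pi * x)"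
    by (intro mult_left_mono; simp)+
  then show "pi\<^sup>2 * x - pi * sin (pi * x) \<le> pi\<^sup>2 * y - pi * sin (pi * y)"
    and "pi\<^sup>2 * x + pi * sin (pi * x) \<le> pi\<^sup>2 * y + pi * sin (pi * y)"
    by (simp_all add: algebra_simps power2_eq_square)
qed

lemma barrier_convex: "convex_on UNIV barrier"
proof (rule convex_on_realI[OF _ barrier_deriv])
  fix x y :: real assume "x \<le> y"
  then show "(if 0 < x then pi\<^sup>2 * x - pi * sin (pi * x) else 0) \<le> (if 0 < y then pi\<^sup>2 * y - pi * sin (pi * y) else 0)"
    using barrier_deriv_mono(1)[of x y] barrier_deriv_mono(1)[of 0 y] by auto
qed auto

lemma barrier_coconvex: "convex_on UNIV (\<lambda>x. pi\<^sup>2 * x\<^sup>2 - barrier x)"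
proof (rule convex_on_realI)
  fix x :: real
  show "((\<lambda>x. pi\<^sup>2 * x\<^sup>2 - barrier x) has_real_derivative
      2 * pi\<^sup>2 * x - (if 0 < x then pi\<^sup>2 * x - pi * sin (pi * x) else 0)) (at x)"
    by (rule derivative_eq_intros barrier_deriv refl)+ simp
next
  fix x y :: real assume "x \<le> y"
  then show "2 * pi\<^sup>2 * x - (if 0 < x then pi\<^sup>2 * x - pi * sin (pi * x) else 0)
     \<le> 2 * pi\<^sup>2 * y - (if 0 < y then pi\<^sup>2 * y - pi * sin (pi * y) else 0)"
    using barrier_deriv_mono(2)[of x y] barrier_deriv_mono(2)[of 0 y] mult_left_mono[of x 0 "pi\<^sup>2"] mult_left_mono[of x y "pi\<^sup>2"]
    by (auto simp: algebra_simps split: if_splits)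
qed auto

lemma barrier_chord_bound: "chord_bound (pi\<^sup>2) barrier"
  by (rule chord_bound_of_convex[OF barrier_convex barrier_coconvex])

lemma square_chord_bound: "chord_bound 1 (\<lambda>x. x\<^sup>2)"
proof (rule chord_bound_of_convex)
  show "convex_on UNIV (\<lambda>x::real. x\<^sup>2)" by (rule convex_power2)
  show "convex_on UNIV (\<lambda>x::real. 1 * x\<^sup>2 - x\<^sup>2)" by (simp add: convex_on_const)
qed

lemma barrier_mono: assumes "x \<le> y" shows "barrier x \<le> barrier y"
proof (rule DERIV_nonneg_imp_nondecreasing[OF assms])
  fix z :: real
  show "\<exists>d. (barrier has_real_derivative d) (at z) \<and> 0 \<le> d"
    using barrier_deriv[of z] barrier_deriv_mono(1)[of 0 z] by (intro exI conjI[OF barrier_deriv]) auto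
qed

text \<open>Beyond \<open>y\<close> the barrier grows at least linearly in \<open>b - 1\<close>.
  This growth pays for the replacement error of order \<open>1 / k\<close> as soon as
  \<open>b\<close> exceeds 1 by a suitable multiple of \<open>1 / k\<close>.\<close>

lemma barrier_tangent: "0 < y \<Longrightarrow> 1 \<le> b \<Longrightarrow> even_barrier y + (pi\<^sup>2 * y - pi * sin (pi * y)) * (y * (b - 1)) \<le> barrier (y * b)"
proof -
  assume y: "0 < y" and b: "1 \<le> b"
  have "barrier (y * b) - barrier y \<ge> (pi\<^sup>2 * y - pi * sin (pi * y)) * (y * b - y)"
    using barrier_deriv[of y] y by (intro convex_on_imp_above_tangent[OF barrier_convex]) auto
  then show ?thesis using y by (simp add: barrier_def algebra_simps)
qed

lemma barrier_measurable: "barrier \<in> borel_measurable borel"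
  unfolding barrier_def[abs_def] even_barrier_def[abs_def] by measurable

lemma avg_step_funpow_Suc: "(avg_step a ^^ Suc n) g x = ((avg_step a ^^ n) g (x + a) + (avg_step a ^^ n) g (x - a)) / 2"
  by (simp add: avg_step_def)

text \<open>The cosine is an eigenfunction of \<open>avg_step a\<close> with eigenvalue
  \<open>cos (pi * a)\<close>, and each step adds \<open>a\<^sup>2\<close> to the square.\<close>

lemma avg_step_iter_even_barrier:
  "(avg_step a ^^ n) even_barrier x = pi\<^sup>2 / 2 * (x\<^sup>2 + n * a\<^sup>2) - 1 + cos (pi * a) ^ n * cos (pi * x)"
proof (induction n arbitrary: x)
  case 0
  then show ?case by (simp add: even_barrier_def)
next
  case (Suc n)
  have "cos (pi * (x + a)) + cos (pi * (x - a)) = 2 * (cos (pi * a) * cos (pi * x))"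
    by (simp add: distrib_left right_diff_distrib cos_add cos_diff)
  then have "cos (pi * a) ^ n * (cos (pi * (x + a)) + cos (pi * (x - a))) = cos (pi * a) ^ n * (2 * (cos (pi * a) * cos (pi * x)))"
    by simp
  then show ?case
    unfolding avg_step_funpow_Suc Suc.IH by (simp add: field_simps power2_eq_square)
qed

text \<open>Averaging over symmetric steps commutes with reflection, so the decomposition of
  \<open>even_barrier\<close> into two reflected halves persists. At 0 both halves agree, which
  makes the one-sided average explicit.\<close>

lemma avg_step_iter_barrier_reflect: "(avg_step a ^^ n) barrier x + (avg_step a ^^ n) barrier (- x) = (avg_step a ^^ n) even_barrier x"
proof (induction n arbitrary: x)
  case 0
  then show ?case by (simp add: barrier_add_reflect)
next
  case (Suc n)
  have e: "- x + a = - (x - a)" "- x - a = - (x + a)" by auto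
  show ?case
    unfolding avg_step_funpow_Suc e Suc.IH[symmetric] by (simp add: add_divide_distrib)
qed

lemma avg_step_iter_barrier_zero:
  fixes a :: real and n :: nat
  shows "(avg_step a ^^ n) barrier 0 = (pi\<^sup>2 / 2 * (real n * a\<^sup>2) - 1 + cos (pi * a) ^ n) / 2"
  using avg_step_iter_barrier_reflect[of n a 0] by (simp add: avg_step_iter_even_barrier)

lemma avg_step_iter_square:
  fixes a x :: real and n :: nat
  shows "(avg_step a ^^ n) (\<lambda>x::real. x\<^sup>2) x = x\<^sup>2 + real n * a\<^sup>2"
proof (induction n arbitrary: x)
  case (Suc n)
  then show ?case
    unfolding avg_step_funpow_Suc Suc.IH by (simp add: field_simps power2_eq_square)
qed simp

section \<open>Numerical bounds for the sign average\<close>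

lemma pi_square_bounds: "9.869 \<le> pi\<^sup>2" "pi\<^sup>2 \<le> 9.87"
proof -
  have "3.1415\<^sup>2 \<le> pi\<^sup>2" using pi_approx by (intro power_mono) auto
  then show "9.869 \<le> pi\<^sup>2" by (simp add: power2_eq_square)
  have "pi\<^sup>2 \<le> 3.1416\<^sup>2" using pi_approx by (intro power_mono) auto
  then show "pi\<^sup>2 \<le> 9.87" by (simp add: power2_eq_square)
qed

lemma exp_minus_le: "exp (- 3.9) \<le> (0.0204 :: real)"
proof -
  have e: "2.718 \<le> exp (1::real)" using e_approx_32 unfolding abs_le_iff by (simp add: field_simps)
  have "(2.718::real) ^ 4 \<le> exp 1 ^ 4" using e by (intro power_mono) auto
  also have "\<dots> = exp 4" by (simp add: exp_of_nat_mult[symmetric])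
  finally have e4: "54.5 \<le> exp (4::real)" by (simp add: power4_eq_xxxx)
  have "54.5 * 0.9 \<le> exp 4 * exp (-0.1::real)"
    using exp_ge_add_one_self[of "-0.1::real"] by (intro mult_mono e4) auto
  also have "\<dots> = exp 3.9" by (simp add: exp_add[symmetric])
  finally have "49.04 \<le> exp (3.9::real)" by simp
  then show ?thesis by (simp add: exp_minus field_simps)
qed

text \<open>For three signs the angle lies in the second quadrant and the power is odd, so the left
  side is not positive. From four signs on the angle is at most \<open>pi / 2\<close>, and a quartic
  Taylor bound gives a Gaussian estimate. Two signs are excluded because the square of the negative
  cosine is about 0.37.\<close>

lemma cos_power_bound:
  fixes m :: nat
  assumes "3 \<le> m"
  shows "cos (pi / sqrt m) ^ m \<le> 0.0204"
proof (cases "m = 3")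
  case True
  have "cos (pi / sqrt 3) \<le> 0"
  proof (rule less_imp_le, rule cos_lt_zero_pi)
    have "sqrt 3 < 2" and s: "1 < sqrt 3" by (auto intro: real_less_lsqrt)
    moreover have "2 < 3 * sqrt 3" using s by linarith
    ultimately show "pi / 2 < pi / sqrt 3" "pi / sqrt 3 < 3 * pi / 2"
      by (auto simp: field_simps)
  qed
  then have "cos (pi / sqrt 3) * cos (pi / sqrt 3) * cos (pi / sqrt 3) \<le> 0"
    by (intro mult_nonneg_nonpos) auto
  then show ?thesis using True by (simp add: power3_eq_cube)
next
  case False
  then have m: "4 \<le> m" using assms by simp
  define u where "u = pi / sqrt m"
  have u2: "u\<^sup>2 = pi\<^sup>2 / m" by (simp add: u_def power_divide)
  have u2le: "u\<^sup>2 \<le> 9.87 / 4"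
    unfolding u2 using pi_square_bounds m by (intro frac_le) auto
  have u0: "0 < u" using m by (simp add: u_def)
  have "2 \<le> sqrt m" using m real_le_rsqrt[of 2 m] by simp
  then have "u \<le> pi / 2" unfolding u_def using m by (intro divide_left_mono) auto
  then have c0: "0 \<le> cos u" using u0 by (intro cos_ge_zero) auto
  obtain t where t: "cos u = (\<Sum>i<4. cos_coeff i * u ^ i) + cos (t + 1/2 * real 4 * pi) / fact 4 * u ^ 4"
    using Maclaurin_cos_expansion2[OF u0, of 4] by auto
  have "cos u \<le> 1 - u\<^sup>2 / 2 + u ^ 4 / 24"
  proof -
    have "cos (t + 1/2 * real 4 * pi) = cos t" using cos_periodic[of t] by (simp add: mult.commute)
    moreover have "(\<Sum>i<4. cos_coeff i * u ^ i) = 1 - u\<^sup>2 / 2"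
    proof -
      have "{..<4::nat} = {0, 1, 2, 3}" by auto
      then show ?thesis by (simp add: cos_coeff_def)
    qed
    moreover have "cos t * u ^ 4 \<le> 1 * u ^ 4" using u0 by (intro mult_right_mono zero_le_power) auto
    ultimately show ?thesis using t by (simp add: fact_numeral)
  qed
  also have "u ^ 4 = u\<^sup>2 * u\<^sup>2" by (simp add: power4_eq_xxxx power2_eq_square)
  also have "1 - u\<^sup>2 / 2 + u\<^sup>2 * u\<^sup>2 / 24 \<le> 1 - u\<^sup>2 / 2 + u\<^sup>2 * (9.87 / 4) / 24"
    using u2le by (intro add_left_mono divide_right_mono mult_left_mono) auto
  \<comment> \<open>The factor 0.397 is just below 1/2 - 9.87/96, and
    \<open>0.397 * pi\<^sup>2\<close> still exceeds 3.9.\<close>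
  also have "\<dots> \<le> 1 + (- 0.397 * u\<^sup>2)" by simp
  also have "\<dots> \<le> exp (- 0.397 * u\<^sup>2)" by (rule exp_ge_add_one_self)
  finally have "cos u ^ m \<le> exp (- 0.397 * u\<^sup>2) ^ m" using c0 by (intro power_mono) auto
  also have "\<dots> = exp (- 0.397 * pi\<^sup>2)" using m by (simp add: exp_of_nat_mult[symmetric] u2)
  also have "\<dots> \<le> exp (- 3.9)" using pi_square_bounds by simp
  also have "\<dots> \<le> 0.0204" by (rule exp_minus_le)
  finally show ?thesis by (simp add: u_def)
qed

subsection \<open>Tails of the sample sample_mean of one person\<close>

text \<open>This is the source of the \<open>1 / k\<close>: the convex function
  \<open>t powr (k / 2)\<close> at \<open>t = u\<^sup>2\<close> lies above its tangent at 1, whose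
  slope is \<open>k / 2\<close>.\<close>

lemma max_square_le_powr:
  fixes u k :: real
  assumes k: "2 \<le> k"
  shows "max 0 (u\<^sup>2 - 1) \<le> 2 / k * \<bar>u\<bar> powr k"
proof (cases "u = 0")
  case False
  then have u: "0 < u\<^sup>2" by simp
  have "(u\<^sup>2) powr (k / 2) - 1 powr (k / 2) \<ge> (k / 2 * 1 powr (k / 2 - 1)) * (u\<^sup>2 - 1)"
  proof (rule convex_on_imp_above_tangent[OF powr_convex])
    show "((\<lambda>a. a powr (k / 2)) has_real_derivative k / 2 * 1 powr (k / 2 - 1)) (at 1 within {0<..})"
      by (auto intro!: derivative_eq_intros)
  qed (use k u in \<open>auto simp: interior_open\<close>)
  moreover have "(u\<^sup>2) powr (k / 2) = \<bar>u\<bar> powr k"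
  proof -
    have "u\<^sup>2 = \<bar>u\<bar> powr 2" using False by simp
    then show ?thesis by (simp only: powr_powr) simp
  qed
  ultimately have "k / 2 * (u\<^sup>2 - 1) \<le> \<bar>u\<bar> powr k" by simp
  then show ?thesis using k by (auto simp: field_simps max_def)
qed (use k in simp)

text \<open>Markov's inequality for \<open>g\<close> of the normalised sum; the excess of the
  squares over 1 is charged to the moment of order \<open>k\<close>.\<close>

lemma (in prob_space) prob_sum_le_avg_step:
  fixes Y :: "'a \<Rightarrow> real"
  assumes g: "chord_bound K g" "\<And>x. 0 \<le> g x" "g \<in> borel_measurable borel"
    and Y: "integrable M Y" "expectation Y = 0"
    and k: "2 \<le> k" "integrable M (\<lambda>x. \<bar>Y x\<bar> powr k)" "expectation (\<lambda>x. \<bar>Y x\<bar> powr k) \<le> B"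
    and a: "0 \<le> K" "0 < n" "0 \<le> B"
    and A: "A \<in> sets (\<Pi>\<^sub>M j\<in>{..<n}. M)" "\<And>x. x \<in> A \<Longrightarrow> G \<le> g (1 / sqrt n * (\<Sum>j<n. Y (x j)))" "0 \<le> G"
  shows "measure (\<Pi>\<^sub>M j\<in>{..<n}. M) A * G \<le> (avg_step (1 / sqrt n) ^^ n) g 0 + K * (2 / k * B)"
proof -
  let ?N = "\<Pi>\<^sub>M j\<in>{..<n}. M"
  interpret N: prob_space ?N by (intro prob_space_PiM prob_space_axioms)
  have Ym [measurable]: "Y \<in> borel_measurable M" using Y by auto
  have Q: "integrable M (\<lambda>x. max 0 ((Y x)\<^sup>2 - 1))"
    by (rule Bochner_Integration.integrable_bound[OF integrable_mult_right[OF k(2), of "2 / k"]])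
       (use max_square_le_powr[OF k(1)] k(1) in auto)
  have "expectation (\<lambda>x. max 0 ((Y x)\<^sup>2 - 1)) \<le> expectation (\<lambda>x. 2 / k * \<bar>Y x\<bar> powr k)"
    using Q k(2) by (intro integral_mono max_square_le_powr k(1)) auto
  also have "\<dots> \<le> 2 / k * B" using k by (simp add: mult_left_mono divide_right_mono)
  finally have q: "expectation (\<lambda>x. max 0 ((Y x)\<^sup>2 - 1)) \<le> 2 / k * B" .
  have "ennreal (measure ?N A * G) = (\<integral>\<^sup>+x. ennreal G * indicator A x \<partial>?N)"
    using A by (simp add: nn_integral_cmult_indicator N.emeasure_eq_measure ennreal_mult mult.commute)
  also have "\<dots> \<le> (\<integral>\<^sup>+x. g (0 + 1 / sqrt n * (\<Sum>j<n. Y (x j))) \<partial>?N)"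
    using A(2) by (intro nn_integral_mono) (auto simp: indicator_def intro!: ennreal_leI)
  also have "\<dots> \<le> ennreal ((avg_step (1 / sqrt n) ^^ n) g 0 + n * (K * (1 / sqrt n)\<^sup>2 * (2 / k * B)))"
    by (rule nn_integral_sum_le_avg_step[OF g Y Q q]) (use a in auto)
  also have "n * (K * (1 / sqrt n)\<^sup>2 * (2 / k * B)) = K * (2 / k * B)"
    using a by (simp add: power_divide)
  finally show ?thesis
  proof (subst (asm) ennreal_le_iff)
    have "0 \<le> (avg_step (1 / sqrt n) ^^ i) g x" for i x
      by (induction i arbitrary: x) (auto intro: avg_step_nonneg g(2))
    then show "0 \<le> (avg_step (1 / sqrt n) ^^ n) g 0 + K * (2 / k * B)"
      using a k by (intro add_nonneg_nonneg mult_nonneg_nonneg) auto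
  qed
qed

definition person_space :: "nat \<Rightarrow> real measure \<Rightarrow> (nat \<Rightarrow> real) measure" where
  "person_space m P = (\<Pi>\<^sub>M j\<in>{..<m}. P)"

definition sample_mean :: "nat \<Rightarrow> (nat \<Rightarrow> real) \<Rightarrow> real" where
  "sample_mean m x = (\<Sum>j<m. x j) / real m"

lemma sample_mean_measurable [measurable]:
  assumes [measurable_cong]: "sets P = sets borel"
  shows "sample_mean m \<in> borel_measurable (person_space m P)"
  unfolding sample_mean_def[abs_def] person_space_def by measurable

definition tail :: "nat \<Rightarrow> real measure \<Rightarrow> real \<Rightarrow> real \<Rightarrow> real \<Rightarrow> real" where
  "tail m P \<mu> \<sigma> t = measure (person_space m P) {x \<in> space (person_space m P). t \<le> \<sigma> * (sample_mean m x - \<mu>)}"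

lemma prob_space_person_space:
  "real_distribution_with_mean P \<mu> \<Longrightarrow> prob_space (person_space m P)"
  unfolding person_space_def real_distribution_with_mean_def by (intro prob_space_PiM) auto

text \<open>The target is split so that \<open>p\<close> does not depend on \<open>k\<close>. The
  first numerical condition is the inequality at \<open>b = 1\<close> without replacement error;
  1.978 bounds the sign average. The second compares the error, at most \<open>4.935 / k\<close>,
  with the tangent growth of the barrier, using \<open>b - 1 \<ge> ln 4 / k\<close> and
  \<open>ln 4 \<ge> 4 / 3\<close>.\<close>

lemma barrier_average_le:
  fixes m :: nat
  assumes m: "3 \<le> m" and k: "2 \<le> k" and b: "1 + ln 4 / k \<le> b" and y: "1 \<le> y"
    and p: "0 \<le> p" and c: "c \<le> cos (pi * y)" and s: "sin (pi * y) \<le> s" "0 \<le> s"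
    and 1: "1.978 \<le> p * (9.869 / 2 * y\<^sup>2 - 1 + c)"
    and 2: "4.935 \<le> p * (y * (9.869 * y - 3.1416 * s)) * (4 / 3)"
  shows "(avg_step (1 / sqrt m) ^^ m) barrier 0 + pi\<^sup>2 * (2 / k * (1 / 4)) \<le> p * barrier (y * b)"
proof -
  have "(2/3::real) * 2 \<le> ln 2 * 2" using ln2_ge_two_thirds by simp
  also have "\<dots> = ln (2\<^sup>2::real)" by (subst ln_realpow) auto
  finally have l4: "4/3 \<le> ln (4::real)" by simp
  have lk: "4 / 3 / k \<le> ln 4 / k" using l4 k by (intro divide_right_mono) auto
  then have b1: "1 \<le> b" "4 / 3 / k \<le> b - 1" using b k by (auto intro: order_trans[rotated, OF b])
  have "(avg_step (1 / sqrt m) ^^ m) barrier 0 \<le> (9.87 / 2 - 1 + 0.0204) / 2"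
    using m cos_power_bound[OF m] pi_square_bounds by (simp add: avg_step_iter_barrier_zero power_divide)
  then have A: "(avg_step (1 / sqrt m) ^^ m) barrier 0 \<le> 1.978" by simp
  have "pi\<^sup>2 * (2 / k * (1 / 4)) \<le> 4.935 / k" using pi_square_bounds k by (simp add: field_simps)
  also have "\<dots> \<le> p * (y * (9.869 * y - 3.1416 * s)) * (4 / 3) / k"
    using 2 k by (intro divide_right_mono) auto
  also have "\<dots> = p * ((9.869 * y - 3.1416 * s) * (y * (4 / 3 / k)))" by simp
  also have "\<dots> \<le> p * ((pi\<^sup>2 * y - pi * sin (pi * y)) * (y * (b - 1)))"
  proof -
    have "pi * sin (pi * y) \<le> pi * s" using s by simp
    also have "\<dots> \<le> 3.1416 * s" using s pi_approx by (intro mult_right_mono) auto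
    finally have "9.869 * y - 3.1416 * s \<le> pi\<^sup>2 * y - pi * sin (pi * y)"
      using pi_square_bounds y mult_right_mono[OF pi_square_bounds(1), of y] by linarith
    moreover have "0 \<le> pi\<^sup>2 * y - pi * sin (pi * y)" using barrier_deriv_mono(1)[of 0 y] y by simp
    ultimately show ?thesis using b1 y p k by (intro mult_left_mono mult_mono) auto
  qed
  finally have B: "pi\<^sup>2 * (2 / k * (1 / 4)) \<le> p * ((pi\<^sup>2 * y - pi * sin (pi * y)) * (y * (b - 1)))" .
  have "9.869 / 2 * y\<^sup>2 - 1 + c \<le> even_barrier y"
    using c mult_right_mono[OF pi_square_bounds(1), of "y\<^sup>2"] by (simp add: even_barrier_def)
  then have "1.978 \<le> p * even_barrier y" using 1 p by (meson mult_left_mono order_trans)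
  then have "(avg_step (1 / sqrt m) ^^ m) barrier 0 + pi\<^sup>2 * (2 / k * (1 / 4))
      \<le> p * even_barrier y + p * ((pi\<^sup>2 * y - pi * sin (pi * y)) * (y * (b - 1)))"
    using A B by linarith
  also have "\<dots> = p * (even_barrier y + (pi\<^sup>2 * y - pi * sin (pi * y)) * (y * (b - 1)))" by (simp add: algebra_simps)
  also have "\<dots> \<le> p * barrier (y * b)" using barrier_tangent[of y b] y b1 p by (intro mult_left_mono) auto
  finally show ?thesis .
qed

text \<open>Rescaling by \<open>b = sqrt (sqrt m * r)\<close> balances the two effects of a large \<open>k\<close>: the
  error term of the replacement is at most \<open>pi\<^sup>2 / (2 * k)\<close>, while \<open>b \<ge> 1 + ln 4 / k\<close> pushes the
  threshold outwards enough to absorb it.\<close>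

lemma tail_le:
  assumes P: "real_distribution_with_mean P \<mu>" and k: "2 \<le> k" and mom: "moment_bounded_by_one k P \<mu>"
    and m: "3 \<le> m" and r: "16 powr (1 / k) / sqrt (real m) < r" and \<sigma>: "\<bar>\<sigma>\<bar> = 1"
    and y: "1 \<le> y" "0 \<le> p" "c \<le> cos (pi * y)" "sin (pi * y) \<le> s" "0 \<le> s"
     "1.978 \<le> p * (9.869 / 2 * y\<^sup>2 - 1 + c)"
     "4.935 \<le> p * (y * (9.869 * y - 3.1416 * s)) * (4 / 3)"
  shows "tail m P \<mu> \<sigma> (y * r) \<le> p"
proof -
  interpret P: prob_space P using P by (simp add: real_distribution_with_mean_def)
  have sets [measurable_cong]: "sets P = sets borel" and int: "integrable P (\<lambda>x. x)" and mu: "(\<integral>x. x \<partial>P) = \<mu>"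
    using P by (auto simp: real_distribution_with_mean_def)
  have sm: "0 < sqrt m" using m by simp
  define b where "b = sqrt (sqrt m * r)"
  have s16: "16 powr (1 / k) < sqrt m * r" using r sm by (simp add: field_simps)
  then have s0: "0 < sqrt m * r" by (rule le_less_trans[rotated]) simp
  then have b0: "0 < b" by (simp add: b_def)
  have bb: "b * b = sqrt m * r" using s0 by (simp add: b_def)
  \<comment> \<open>The constant 16 enters here: half of the exponent goes into shrinking the
    moment, and the other half remains for pushing out the threshold.\<close>
  have "4 = (16 powr (1 / k)) powr (k / 2)" using k by (simp add: powr_powr powr_half_sqrt)
  also have "\<dots> \<le> (sqrt m * r) powr (k / 2)" using s16 k by (intro powr_mono2) auto
  also have "\<dots> = b powr k" using s0 by (simp add: b_def powr_half_sqrt[symmetric] powr_powr)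
  finally have b4: "4 \<le> b powr k" .
  have "ln 4 \<le> ln (b powr k)" by (rule ln_mono) (use b4 in auto)
  also have "ln (b powr k) = k * ln b" using b0 by (simp add: powr_def)
  finally have "ln 4 / k \<le> ln b" using k by (simp add: field_simps)
  then have b1: "1 + ln 4 / k \<le> b" using ln_le_minus_one[OF b0] by simp
  \<comment> \<open>Division by \<open>b\<close> leaves a moment of at most 1/4. As
    \<open>b * b = sqrt m * r\<close>, a deviation \<open>y * r\<close> of the mean becomes a value
    \<open>y * b\<close> of the normalised sum.\<close>
  define Y where "Y x = \<sigma> * (x - \<mu>) / b" for x
  have Yk: "\<bar>Y x\<bar> powr k = \<bar>x - \<mu>\<bar> powr k / b powr k" for x
    using b0 \<sigma> by (simp add: Y_def abs_mult powr_divide)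
  let ?A = "{x \<in> space (person_space m P). y * r \<le> \<sigma> * (sample_mean m x - \<mu>)}"
  have "measure (\<Pi>\<^sub>M j\<in>{..<m}. P) ?A * barrier (y * b) \<le> (avg_step (1 / sqrt m) ^^ m) barrier 0 + pi\<^sup>2 * (2 / k * (1 / 4))"
  proof (rule P.prob_sum_le_avg_step[OF barrier_chord_bound barrier_nonneg barrier_measurable _ _ k])
    show "integrable P Y" unfolding Y_def using int by simp
    show "P.expectation Y = 0" unfolding Y_def using int mu by (simp add: P.prob_space)
    show "integrable P (\<lambda>x. \<bar>Y x\<bar> powr k)" unfolding Yk using mom by (simp add: moment_bounded_by_one_def)
    have "P.expectation (\<lambda>x. \<bar>Y x\<bar> powr k) \<le> 1 / b powr k"
      unfolding Yk using mom by (simp add: moment_bounded_by_one_def divide_right_mono)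
    also have "\<dots> \<le> 1 / 4" using b4 by (intro divide_left_mono) auto
    finally show "P.expectation (\<lambda>x. \<bar>Y x\<bar> powr k) \<le> 1 / 4" .
    show "?A \<in> sets (\<Pi>\<^sub>M j\<in>{..<m}. P)"
      unfolding person_space_def[symmetric] using sample_mean_measurable[OF sets] by measurable
    show "0 \<le> barrier (y * b)" by (rule barrier_nonneg)
    fix x assume "x \<in> ?A"
    then have x: "y * r \<le> \<sigma> * (sample_mean m x - \<mu>)" by simp
    have "(\<Sum>j<m. Y (x j)) = \<sigma> / b * (\<Sum>j<m. x j - \<mu>)"
      unfolding Y_def by (simp add: sum_distrib_left)
    also have "(\<Sum>j<m. x j - \<mu>) = m * (sample_mean m x - \<mu>)"
      using m by (simp add: sum_subtractf sample_mean_def field_simps)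
    finally have "1 / sqrt m * (\<Sum>j<m. Y (x j)) = (m / sqrt m) * (\<sigma> * (sample_mean m x - \<mu>)) / b"
      by simp
    also have "m / sqrt m = sqrt m" by (simp add: real_div_sqrt)
    also have "sqrt m * (\<sigma> * (sample_mean m x - \<mu>)) / b \<ge> sqrt m * (y * r) / b"
      using x sm b0 by (intro divide_right_mono mult_left_mono) auto
    also have "sqrt m * (y * r) / b = y * b"
      using bb b0 by (simp add: field_simps)
    finally show "barrier (y * b) \<le> barrier (1 / sqrt m * (\<Sum>j<m. Y (x j)))" by (rule barrier_mono)
  qed (use m in auto)
  also have "\<dots> \<le> p * barrier (y * b)" by (rule barrier_average_le[OF m k b1 y])
  finally have "tail m P \<mu> \<sigma> (y * r) * barrier (y * b) \<le> p * barrier (y * b)"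
    by (simp add: tail_def person_space_def)
  moreover have "0 < barrier (y * b)"
  proof -
    have "0 < ln (4::real) / k" using k by simp
    then have b: "1 < b" using b1 by linarith
    then have "1 < y * b" using y b0 by (smt (verit) mult_le_cancel_right1)
    then have "4 * 2 / 2 - 1 - 1 \<le> 0 + barrier (y * b)"
    proof -
      assume yb: "1 < y * b"
      have "9 * 1 \<le> pi\<^sup>2 * (y * b)\<^sup>2" using pi_square_bounds yb by (intro mult_mono) auto
      moreover have "- 1 \<le> cos (pi * (y * b))" by simp
      moreover have "barrier (y * b) = pi\<^sup>2 * (y * b)\<^sup>2 / 2 - 1 + cos (pi * (y * b))"
        using yb by (simp add: barrier_def even_barrier_def)
      ultimately show ?thesis by linarith
    qed
    then show ?thesis by simp
  qed
  ultimately show ?thesis by simp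
qed

lemma sin_cos_values:
  "cos (pi * 1.5) = 0" "sin (pi * 1.5) = -1" "cos (pi * 2) = 1" "sin (pi * 2) = 0"
  "- 0.1414 \<le> cos (pi * 1.455)" "sin (pi * 1.455) \<le> 0"
  "0 \<le> cos (pi * 1.545)" "sin (pi * 1.545) \<le> 0"
  "0 \<le> cos (pi * 1.6)" "sin (pi * 1.6) \<le> 0"
  "0 \<le> cos (pi * 2.4)" "sin (pi * 2.4) \<le> 1"
proof -
  have c: "cos (pi * (3/2 + d)) = sin (pi * d)" for d
  proof -
    have "pi * (3/2 + d) = (pi + pi / 2) + pi * d" by (simp add: algebra_simps)
    then show ?thesis by (simp only: cos_add sin_add) simp
  qed
  have s: "sin (pi * (3/2 + d)) = - cos (pi * d)" for d
  proof -
    have "pi * (3/2 + d) = (pi + pi / 2) + pi * d" by (simp add: algebra_simps)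
    then show ?thesis by (simp only: cos_add sin_add) simp
  qed
  show "cos (pi * 1.5) = 0" "sin (pi * 1.5) = -1" using c[of 0] s[of 0] by simp_all
  show "cos (pi * 2) = 1" "sin (pi * 2) = 0" using cos_two_pi sin_two_pi by (simp_all add: mult.commute)
  have "sin (pi * 0.045) \<le> pi * 0.045" by (intro sin_x_le_x) auto
  then show "- 0.1414 \<le> cos (pi * 1.455)" using c[of "-0.045"] pi_approx by simp
  show "sin (pi * 1.455) \<le> 0" using s[of "-0.045"] cos_ge_zero[of "pi * 0.045"] by simp
  show "0 \<le> cos (pi * 1.545)" using c[of "0.045"] sin_ge_zero[of "pi * 0.045"] by simp
  show "sin (pi * 1.545) \<le> 0" using s[of "0.045"] cos_ge_zero[of "pi * 0.045"] by simp
  show "0 \<le> cos (pi * 1.6)" using c[of "0.1"] sin_ge_zero[of "pi * 0.1"] by simp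
  show "sin (pi * 1.6) \<le> 0" using s[of "0.1"] cos_ge_zero[of "pi * 0.1"] by simp
  have "pi * 2.4 = pi * 0.4 + 2 * pi" by simp
  then have "cos (pi * 2.4) = cos (pi * 0.4)" by (simp only: cos_periodic)
  then show "0 \<le> cos (pi * 2.4)" using cos_ge_zero[of "pi * 0.4"] by simp
qed simp

text \<open>The distances are 3/2 and 5/2 moved towards each other by 0.045, 0.1 or 1/2 as the
  position of \<mu> in its bucket requires, and 1.455 = 1.5 - 0.045. Up to 1.6 the value is
  essentially 1.978 divided by the barrier; at 2.4 the crude bound 1 for the sine makes the other
  condition of \<open>tail_le\<close> binding, and at 2 there is room to spare.\<close>

lemma tail_values:
  assumes "real_distribution_with_mean P \<mu>" "2 \<le> k" "moment_bounded_by_one k P \<mu>"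
    "3 \<le> m" "16 powr (1 / k) / sqrt (real m) < r" "\<bar>\<sigma>\<bar> = 1"
  shows "tail m P \<mu> \<sigma> (1.5 * r) \<le> 0.1958" "tail m P \<mu> \<sigma> (1.455 * r) \<le> 0.2127"
    "tail m P \<mu> \<sigma> (1.545 * r) \<le> 0.1836" "tail m P \<mu> \<sigma> (1.6 * r) \<le> 0.171"
    "tail m P \<mu> \<sigma> (2 * r) \<le> 0.12" "tail m P \<mu> \<sigma> (2.4 * r) \<le> 0.0755"
proof -
  note t = tail_le[OF assms]
  show "tail m P \<mu> \<sigma> (1.5 * r) \<le> 0.1958"
    by (rule t[where c = 0 and s = 0]) (simp_all only: sin_cos_values, simp_all add: power2_eq_square)
  show "tail m P \<mu> \<sigma> (1.455 * r) \<le> 0.2127"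
    by (rule t[OF _ _ sin_cos_values(5,6)]) (simp_all add: power2_eq_square)
  show "tail m P \<mu> \<sigma> (1.545 * r) \<le> 0.1836"
    by (rule t[OF _ _ sin_cos_values(7,8)]) (simp_all add: power2_eq_square)
  show "tail m P \<mu> \<sigma> (1.6 * r) \<le> 0.171"
    by (rule t[OF _ _ sin_cos_values(9,10)]) (simp_all add: power2_eq_square)
  show "tail m P \<mu> \<sigma> (2.4 * r) \<le> 0.0755"
    by (rule t[OF _ _ sin_cos_values(11,12)]) (simp_all add: power2_eq_square)
  show "tail m P \<mu> \<sigma> (2 * r) \<le> 0.12"
    by (rule t[where c = 1 and s = 0]) (simp_all only: sin_cos_values, simp_all add: power2_eq_square)
qed

section \<open>At most two samples per person, and a two-sided bound\<close>

lemma (in prob_space) prob_component: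
  assumes "j \<in> I" "A \<in> sets M"
  shows "measure (\<Pi>\<^sub>M i\<in>I. M) {x \<in> space (\<Pi>\<^sub>M i\<in>I. M). x j \<in> A} = prob A"
proof -
  interpret N: product_prob_space "\<lambda>_. M" I by standard
  have "distr (\<Pi>\<^sub>M i\<in>I. M) M (\<lambda>x. x j) = M"
    using assms by (intro N.PiM_component)
  then have "prob A = measure (distr (\<Pi>\<^sub>M i\<in>I. M) M (\<lambda>x. x j)) A" by simp
  also have "\<dots> = measure (\<Pi>\<^sub>M i\<in>I. M) ((\<lambda>x. x j) -` A \<inter> space (\<Pi>\<^sub>M i\<in>I. M))"
    using assms by (intro measure_distr) auto
  also have "(\<lambda>x. x j) -` A \<inter> space (\<Pi>\<^sub>M i\<in>I. M) = {x \<in> space (\<Pi>\<^sub>M i\<in>I. M). x j \<in> A}" by auto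
  finally show ?thesis ..
qed

lemma moment_markov:
  assumes P: "real_distribution_with_mean P \<mu>" and k: "2 \<le> k" and mom: "moment_bounded_by_one k P \<mu>"
    and s: "16 powr (1 / k) < s"
  shows "measure P {x \<in> space P. s \<le> \<bar>x - \<mu>\<bar>} \<le> 1 / 16"
proof -
  interpret P: prob_space P using P by (simp add: real_distribution_with_mean_def)
  have sets [measurable_cong]: "sets P = sets borel"
    using P by (auto simp: real_distribution_with_mean_def)
  have s0: "0 < s" using s by (rule le_less_trans[rotated]) simp
  have "16 = (16 powr (1 / k)) powr k" using k by (simp add: powr_powr)
  also have "\<dots> \<le> s powr k" using s k by (intro powr_mono2) auto
  finally have s16: "16 \<le> s powr k" .
  have "measure P {x \<in> space P. s \<le> \<bar>x - \<mu>\<bar>} \<le> measure P {x \<in> space P. 16 \<le> \<bar>x - \<mu>\<bar> powr k}"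
  proof (intro P.finite_measure_mono subsetI)
    fix x assume "x \<in> {x \<in> space P. s \<le> \<bar>x - \<mu>\<bar>}"
    then have "s powr k \<le> \<bar>x - \<mu>\<bar> powr k" "x \<in> space P" using s0 k by (auto intro!: powr_mono2)
    then show "x \<in> {x \<in> space P. 16 \<le> \<bar>x - \<mu>\<bar> powr k}" using s16 by simp
  qed measurable
  also have "\<dots> \<le> (\<integral>x. \<bar>x - \<mu>\<bar> powr k \<partial>P) / 16"
    using mom by (intro integral_Markov_inequality_measure[where A = "space P"]) (auto simp: moment_bounded_by_one_def)
  also have "\<dots> \<le> 1 / 16" using mom by (simp add: moment_bounded_by_one_def)
  finally show ?thesis .
qed

text \<open>With so few signs the barrier is replaced by a direct argument: a deviation
  \<open>y * r\<close> of the mean forces some sample to deviate by \<open>sqrt m * r\<close>, which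
  has probability at most 1/16 per sample. For two samples this rests on
  \<open>sqrt 2 * y \<ge> 2\<close>, which holds from 1.455 on.\<close>

lemma tail_le_few_samples:
  assumes P: "real_distribution_with_mean P \<mu>" and k: "2 \<le> k" and mom: "moment_bounded_by_one k P \<mu>"
    and m: "1 \<le> m" "m \<le> 2" and r: "16 powr (1 / k) / sqrt (real m) < r" and \<sigma>: "\<bar>\<sigma>\<bar> = 1" and y: "1.455 \<le> y"
  shows "tail m P \<mu> \<sigma> (y * r) \<le> 1 / 8"
proof -
  interpret P: prob_space P using P by (simp add: real_distribution_with_mean_def)
  have sets [measurable_cong]: "sets P = sets borel"
    using P by (auto simp: real_distribution_with_mean_def)
  interpret N: prob_space "person_space m P" by (rule prob_space_person_space[OF P])
  define s where "s = sqrt m * r"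
  have sm: "1 \<le> sqrt m" using m by simp
  have s: "16 powr (1 / k) < s" using r sm by (simp add: s_def field_simps)
  have s0: "0 < s" using s by (rule le_less_trans[rotated]) simp
  let ?E = "{z \<in> space P. s \<le> \<bar>z - \<mu>\<bar>}"
  have E [measurable]: "?E \<in> sets P" by measurable
  have comp: "{x \<in> space (person_space m P). x j \<in> ?E} \<in> sets (person_space m P)" if "j < m" for j
  proof -
    have "(\<lambda>x. x j) \<in> person_space m P \<rightarrow>\<^sub>M P"
      using that unfolding person_space_def by (intro measurable_component_singleton) auto
    from measurable_sets[OF this E] show ?thesis by (simp add: vimage_def Int_def conj_commute)
  qed
  have m12: "m = 1 \<or> m = 2" using m by auto
  have key: "s \<le> \<bar>x 0 - \<mu>\<bar> \<or> (m = 2 \<and> s \<le> \<bar>x 1 - \<mu>\<bar>)" if "y * r \<le> \<sigma> * (sample_mean m x - \<mu>)" for x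
    using m12
  proof
    assume m: "m = 1"
    have "1 * s \<le> y * s" using y s0 by (intro mult_right_mono) auto
    then have "s \<le> \<sigma> * (sample_mean m x - \<mu>)" using that m by (simp add: s_def)
    also have "\<dots> \<le> \<bar>\<sigma> * (sample_mean m x - \<mu>)\<bar>" by simp
    also have "\<dots> = \<bar>x 0 - \<mu>\<bar>" using \<sigma> m by (simp add: abs_mult sample_mean_def)
    finally show ?thesis by simp
  next
    assume m: "m = 2"
    have "1.4142\<^sup>2 \<le> (2::real)" by (simp add: power2_eq_square)
    then have "1.4142 \<le> sqrt 2" by (rule real_le_rsqrt)
    then have "1.4142 * 1.455 \<le> sqrt 2 * y" using y by (intro mult_mono) auto
    then have "2 * s \<le> (sqrt 2 * y) * s" using s0 by (intro mult_right_mono) auto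
    also have "\<dots> = 2 * (y * r)" using m by (simp add: s_def)
    also have "\<dots> \<le> 2 * (\<sigma> * (sample_mean m x - \<mu>))" using that by simp
    also have "\<dots> \<le> \<bar>2 * (\<sigma> * (sample_mean m x - \<mu>))\<bar>" by simp
    also have "\<dots> = \<bar>(x 0 - \<mu>) + (x 1 - \<mu>)\<bar>"
    proof -
      have "2 * (sample_mean m x - \<mu>) = (x 0 - \<mu>) + (x 1 - \<mu>)" using m by (simp add: sample_mean_def numeral_2_eq_2)
      moreover have "\<bar>2 * (\<sigma> * (sample_mean m x - \<mu>))\<bar> = \<bar>2 * (sample_mean m x - \<mu>)\<bar>" using \<sigma> by (simp only: abs_mult)
      ultimately show ?thesis by simp
    qed
    finally show ?thesis using m by linarith
  qed
  have "tail m P \<mu> \<sigma> (y * r) \<le> N.prob (\<Union>j\<in>{..<m}. {x \<in> space (person_space m P). x j \<in> ?E})"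
    unfolding tail_def
  proof (rule N.finite_measure_mono)
    show "{x \<in> space (person_space m P). y * r \<le> \<sigma> * (sample_mean m x - \<mu>)} \<subseteq> (\<Union>j\<in>{..<m}. {x \<in> space (person_space m P). x j \<in> ?E})"
    proof
      fix x assume "x \<in> {x \<in> space (person_space m P). y * r \<le> \<sigma> * (sample_mean m x - \<mu>)}"
      then have x: "x \<in> space (person_space m P)" and "y * r \<le> \<sigma> * (sample_mean m x - \<mu>)" by auto
      from key[OF this(2)] have "\<exists>j<m. s \<le> \<bar>x j - \<mu>\<bar>"
      proof
        assume "s \<le> \<bar>x 0 - \<mu>\<bar>"
        then show ?thesis using m by (intro exI[of _ 0] conjI) simp_all
      next
        assume "m = 2 \<and> s \<le> \<bar>x 1 - \<mu>\<bar>"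
        then show ?thesis by (intro exI[of _ 1] conjI) simp_all
      qed
      then obtain j where j: "j < m" "s \<le> \<bar>x j - \<mu>\<bar>" by auto
      moreover have "x j \<in> space P" using x j by (auto simp: person_space_def space_PiM)
      ultimately show "x \<in> (\<Union>j\<in>{..<m}. {x \<in> space (person_space m P). x j \<in> ?E})" using x by auto
    qed
  qed (use comp in auto)
  also have "\<dots> \<le> (\<Sum>j<m. N.prob {x \<in> space (person_space m P). x j \<in> ?E})"
    using comp by (intro N.finite_measure_subadditive_finite) auto
  also have "\<dots> = (\<Sum>j<m. P.prob ?E)"
    unfolding person_space_def using E by (intro sum.cong P.prob_component) auto
  also have "\<dots> \<le> (\<Sum>j<m. 1 / 16)" by (intro sum_mono moment_markov[OF P k mom s])
  also have "\<dots> \<le> 1 / 8" using m by simp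
  finally show ?thesis .
qed

text \<open>Each budget has the form \<open>c * t + (t' + t'')\<close>: among \<open>c\<close> good buckets that cover all but
  \<open>t' + t''\<close> of the mass, the best one then beats a whole tail of mass \<open>t\<close>; so \<open>4 * t1 + t2\<close>
  belongs to three buckets and the two others to four. Which budget applies depends on the
  position of \<open>\<mu>\<close> inside its bucket.\<close>

lemma tail_budget:
  assumes "real_distribution_with_mean P \<mu>" "2 \<le> k" "moment_bounded_by_one k P \<mu>"
    "1 \<le> m" "16 powr (1 / k) / sqrt (real m) < r"
  obtains t1 t2 t3 t4 t5 t6 where
    "\<And>\<sigma>. \<bar>\<sigma>\<bar> = 1 \<Longrightarrow> tail m P \<mu> \<sigma> (1.5 * r) \<le> t1"
    "\<And>\<sigma>. \<bar>\<sigma>\<bar> = 1 \<Longrightarrow> tail m P \<mu> \<sigma> (1.455 * r) \<le> t2"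
    "\<And>\<sigma>. \<bar>\<sigma>\<bar> = 1 \<Longrightarrow> tail m P \<mu> \<sigma> (1.545 * r) \<le> t3"
    "\<And>\<sigma>. \<bar>\<sigma>\<bar> = 1 \<Longrightarrow> tail m P \<mu> \<sigma> (2.4 * r) \<le> t4"
    "\<And>\<sigma>. \<bar>\<sigma>\<bar> = 1 \<Longrightarrow> tail m P \<mu> \<sigma> (1.6 * r) \<le> t5"
    "\<And>\<sigma>. \<bar>\<sigma>\<bar> = 1 \<Longrightarrow> tail m P \<mu> \<sigma> (2 * r) \<le> t6"
    "4 * t1 + t2 \<le> 0.996" "5 * t3 + t4 \<le> 0.996" "5 * t5 + t6 \<le> 0.996" "t4 \<le> t3" "t6 \<le> t5"
proof (cases "3 \<le> m")
  case True
  note t = tail_values[OF assms(1-3) True assms(5)]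
  show thesis
    by (rule that[OF t(1) t(2) t(3) t(6) t(4) t(5)]) auto
next
  case False
  then have "m \<le> 2" by simp
  note t = tail_le_few_samples[OF assms(1-4) this assms(5)]
  show thesis
    by (rule that[of "1/8" "1/8" "1/8" "1/8" "1/8" "1/8"]; (rule t)?; simp)
qed

text \<open>Here the square replaces the barrier: its sign average is 1, its replacement error
  \<open>2 / k\<close> is at most 1, and \<open>1.455\<^sup>2\<close> exceeds their sum. The
  distance 1.455 is the smallest margin between \<mu> and the end of a window below.\<close>

lemma tail_two_sided:
  assumes P: "real_distribution_with_mean P \<mu>" and k: "2 \<le> k" and mom: "moment_bounded_by_one k P \<mu>"
    and m: "1 \<le> m" and r: "0 < r"
  shows "measure (person_space m P) {x \<in> space (person_space m P). 1.455 * r \<le> \<bar>sample_mean m x - \<mu>\<bar>} \<le> 1 / (sqrt m * r)\<^sup>2"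
proof -
  interpret P: prob_space P using P by (simp add: real_distribution_with_mean_def)
  have sets [measurable_cong]: "sets P = sets borel" and int: "integrable P (\<lambda>x. x)" and mu: "(\<integral>x. x \<partial>P) = \<mu>"
    using P by (auto simp: real_distribution_with_mean_def)
  have sm: "0 < sqrt m" using m by simp
  let ?A = "{x \<in> space (person_space m P). 1.455 * r \<le> \<bar>sample_mean m x - \<mu>\<bar>}"
  have "measure (\<Pi>\<^sub>M j\<in>{..<m}. P) ?A * (1.455 * (sqrt m * r))\<^sup>2 \<le> (avg_step (1 / sqrt m) ^^ m) (\<lambda>x. x\<^sup>2) 0 + 1 * (2 / k * 1)"
  proof (rule P.prob_sum_le_avg_step[OF square_chord_bound])
    show "integrable P (\<lambda>x. x - \<mu>)" "P.expectation (\<lambda>x. x - \<mu>) = 0" using int mu by (auto simp: P.prob_space)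
    show "integrable P (\<lambda>x. \<bar>x - \<mu>\<bar> powr k)" "P.expectation (\<lambda>x. \<bar>x - \<mu>\<bar> powr k) \<le> 1"
      using mom by (auto simp: moment_bounded_by_one_def)
    show "?A \<in> sets (\<Pi>\<^sub>M j\<in>{..<m}. P)"
      unfolding person_space_def[symmetric] using sample_mean_measurable[OF sets] by measurable
    fix x assume "x \<in> ?A"
    then have x: "1.455 * r \<le> \<bar>sample_mean m x - \<mu>\<bar>" by simp
    have "(\<Sum>j<m. x j - \<mu>) = m * (sample_mean m x - \<mu>)"
      using m by (simp add: sum_subtractf sample_mean_def field_simps)
    then have "1 / sqrt m * (\<Sum>j<m. x j - \<mu>) = (m / sqrt m) * (sample_mean m x - \<mu>)"
      by simp
    also have "m / sqrt m = sqrt m" by (simp add: real_div_sqrt)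
    finally have e: "1 / sqrt m * (\<Sum>j<m. x j - \<mu>) = sqrt m * (sample_mean m x - \<mu>)" .
    have "\<bar>1.455 * (sqrt m * r)\<bar> \<le> \<bar>sqrt m * (sample_mean m x - \<mu>)\<bar>"
      using mult_left_mono[OF x, of "sqrt m"] sm r by (simp add: abs_mult)
    then show "(1.455 * (sqrt m * r))\<^sup>2 \<le> (1 / sqrt m * (\<Sum>j<m. x j - \<mu>))\<^sup>2"
      unfolding e by (simp only: abs_le_square_iff)
  qed (use m k in auto)
  also have "\<dots> \<le> 2" using m k by (simp add: avg_step_iter_square power_divide)
  finally have "measure (person_space m P) ?A * (1.455\<^sup>2 * (sqrt m * r)\<^sup>2) \<le> 2"
    unfolding person_space_def power_mult_distrib .
  moreover have "measure (person_space m P) ?A * (2 * (sqrt m * r)\<^sup>2) \<le> measure (person_space m P) ?A * (1.455\<^sup>2 * (sqrt m * r)\<^sup>2)"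
    by (intro mult_left_mono mult_right_mono) (auto simp: power2_eq_square)
  moreover have "0 < (sqrt m * r)\<^sup>2" using sm r by simp
  ultimately show ?thesis by (simp add: field_simps)
qed

section \<open>Exponential moment bounds over independent people\<close>

lemma (in prob_space) chernoff:
  fixes W :: "'a \<Rightarrow> real"
  assumes [measurable]: "W \<in> borel_measurable M" and "\<And>x. 0 \<le> W x" and W: "integrable M W" "expectation W \<le> w" and "0 < A"
  shows "measure (\<Pi>\<^sub>M i\<in>{..<n}. M) {x \<in> space (\<Pi>\<^sub>M i\<in>{..<n}. M). A \<le> (\<Prod>i<n. W (x i))} \<le> w ^ n / A"
proof -
  let ?N = "\<Pi>\<^sub>M i\<in>{..<n}. M"
  interpret N: prob_space ?N by (intro prob_space_PiM prob_space_axioms)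
  interpret PS: product_sigma_finite "\<lambda>_::nat. M"
    by (simp add: product_sigma_finite_def prob_space_axioms prob_space_imp_sigma_finite)
  let ?A = "{x \<in> space ?N. A \<le> (\<Prod>i<n. W (x i))}"
  have w: "0 \<le> w" 
  proof -
    have "0 \<le> expectation W" by (rule integral_nonneg_AE) (simp add: assms(2))
    then show ?thesis using W(2) by linarith
  qed
  have [measurable]: "?A \<in> sets ?N" by measurable
  have "ennreal (measure ?N ?A * A) = (\<integral>\<^sup>+x. ennreal A * indicator ?A x \<partial>?N)"
    using \<open>0 < A\<close> by (simp add: nn_integral_cmult_indicator N.emeasure_eq_measure ennreal_mult mult.commute)
  also have "\<dots> \<le> (\<integral>\<^sup>+x. (\<Prod>i<n. ennreal (W (x i))) \<partial>?N)"
    by (intro nn_integral_mono) (auto simp: indicator_def prod_ennreal assms(2) intro!: ennreal_leI)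
  also have "\<dots> = (\<Prod>i<n. \<integral>\<^sup>+x. W x \<partial>M)"
    by (intro PS.product_nn_integral_prod) auto
  also have "\<dots> = ennreal (expectation W) ^ n"
    using W assms(2) by (simp add: nn_integral_eq_integral)
  also have "\<dots> \<le> ennreal w ^ n" using W by (intro power_mono ennreal_leI) auto
  also have "\<dots> = ennreal (w ^ n)" using w by (simp add: ennreal_power)
  finally have "measure ?N ?A * A \<le> w ^ n" using w by (simp add: ennreal_le_iff)
  then show ?thesis using \<open>0 < A\<close> by (simp add: field_simps)
qed

lemma exp_le_quadratic:
  fixes y :: real
  assumes "y \<le> 1"
  shows "exp y \<le> 1 + y + y\<^sup>2"
proof (cases "0 \<le> y")
  case True
  then show ?thesis using exp_bound[of y] assms by simp
next
  case False
  define z where "z = - y"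
  have z: "0 < z" using False by (simp add: z_def)
  have pos: "0 < 1 - z + z\<^sup>2"
  proof -
    have "1 - z + z\<^sup>2 = (z - 1/2)\<^sup>2 + 3/4" by (simp add: power2_eq_square field_simps)
    then show ?thesis by (metis add_nonneg_pos zero_le_power2 zero_less_divide_iff zero_less_numeral)
  qed
  have "1 \<le> (1 - z + z\<^sup>2) * (1 + z + z\<^sup>2 / 2)"
  proof -
    have "(1 - z + z\<^sup>2) * (1 + z + z\<^sup>2 / 2) = 1 + (z * z / 2 + z * z * z / 2 + z * z * z * z / 2)"
      by (simp add: power2_eq_square field_simps)
    then show ?thesis using z by simp
  qed
  also have "\<dots> \<le> (1 - z + z\<^sup>2) * exp z"
    using pos exp_lower_Taylor_quadratic[of z] z by (intro mult_left_mono) auto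
  finally have "exp (- z) \<le> 1 - z + z\<^sup>2" by (simp add: exp_minus field_simps)
  then show ?thesis by (simp add: z_def)
qed

lemma (in prob_space) integrable_indicator: "A \<in> events \<Longrightarrow> integrable M (indicat_real A)"
  by (intro integrable_real_indicator) (auto simp: less_top[symmetric])

text \<open>One variable handles both counts: the indicator of the window minus \<open>c\<close>
  times that of the tail has mean at least \<gamma> and values in [-4, 1], so its sum over the
  people rarely drops to a quarter of the guaranteed mean.\<close>

lemma (in prob_space) concentration:
  fixes c \<gamma> :: real
  assumes [measurable]: "G \<in> events" "E \<in> events" and c: "0 \<le> c" "c \<le> 4" and \<gamma>: "0 < \<gamma>" "\<gamma> \<le> 1"
    and gap: "c * prob E + \<gamma> \<le> prob G"
  shows "measure (\<Pi>\<^sub>M i\<in>{..<n}. M) {x \<in> space (\<Pi>\<^sub>M i\<in>{..<n}. M).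
      (\<Sum>i<n. indicator G (x i) - c * indicator E (x i)) \<le> n * \<gamma> / 4} \<le> exp (- \<gamma>\<^sup>2 / 128) ^ n"
proof -
  define Z where "Z x = (indicator G x - c * indicator E x :: real)" for x
  have Z4: "\<bar>Z x\<bar> \<le> 4" for x using c by (auto simp: Z_def indicator_def)
  have Zm [measurable]: "Z \<in> borel_measurable M" unfolding Z_def by measurable
  have Zi: "integrable M Z" unfolding Z_def by (intro Bochner_Integration.integrable_diff integrable_mult_right integrable_indicator) auto
  have Ze: "\<gamma> \<le> expectation Z" unfolding Z_def using gap
    by (subst Bochner_Integration.integral_diff) (auto intro!: integrable_indicator)
  \<comment> \<open>With \<open>l = \<gamma> / 32\<close> the exponent
    \<open>- l * \<gamma> + 16 * l\<^sup>2 + l * \<gamma> / 4\<close> equals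
    \<open>- \<gamma>\<^sup>2 / 128\<close>, and \<open>l * Z x\<close> stays within [-1, 1], where
    the quadratic bound for \<open>exp\<close> applies.\<close>
  define l where "l = \<gamma> / 32"
  define W where "W x = exp (- l * (Z x - \<gamma> / 4))" for x
  have [measurable]: "W \<in> borel_measurable M" unfolding W_def by measurable
  have Wle: "W x \<le> (1 - l * Z x + 16 * l\<^sup>2) * exp (l * \<gamma> / 4)" for x
  proof -
    have "\<bar>- l * Z x\<bar> \<le> 1" using mult_mono[of l "1/32" "\<bar>Z x\<bar>" 4] \<gamma> Z4[of x] by (auto simp: l_def abs_mult)
    then have "exp (- l * Z x) \<le> 1 + (- l * Z x) + (- l * Z x)\<^sup>2"
      by (intro exp_le_quadratic) (simp add: abs_le_iff)
    also have "(- l * Z x)\<^sup>2 \<le> 16 * l\<^sup>2"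
      using power_mono[OF Z4[of x], of 2] by (simp add: power_mult_distrib mult.commute mult_left_mono)
    finally have "exp (- l * Z x) \<le> 1 - l * Z x + 16 * l\<^sup>2" by simp
    then have "exp (- l * Z x) * exp (l * \<gamma> / 4) \<le> (1 - l * Z x + 16 * l\<^sup>2) * exp (l * \<gamma> / 4)"
      by (intro mult_right_mono) auto
    then show ?thesis by (simp add: W_def exp_add[symmetric] algebra_simps)
  qed
  have Ub: "integrable M (\<lambda>x. (1 - l * Z x + 16 * l\<^sup>2) * exp (l * \<gamma> / 4))"
    using Zi by (intro integrable_mult_left integrable_add Bochner_Integration.integrable_diff integrable_mult_right) auto
  have Wi: "integrable M W"
  proof (rule Bochner_Integration.integrable_bound[OF Ub])
    have "norm (W x) \<le> norm ((1 - l * Z x + 16 * l\<^sup>2) * exp (l * \<gamma> / 4))" for x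
      using order_trans[OF Wle[of x] abs_ge_self] by (simp add: W_def)
    then show "AE x in M. norm (W x) \<le> norm ((1 - l * Z x + 16 * l\<^sup>2) * exp (l * \<gamma> / 4))" by simp
  qed simp
  have "expectation W \<le> expectation (\<lambda>x. (1 - l * Z x + 16 * l\<^sup>2) * exp (l * \<gamma> / 4))"
    using Wle by (intro integral_mono Wi Ub)
  also have "\<dots> = (1 - l * expectation Z + 16 * l\<^sup>2) * exp (l * \<gamma> / 4)"
    using Zi by (simp add: prob_space)
  also have "\<dots> \<le> (1 + (- l * \<gamma> + 16 * l\<^sup>2)) * exp (l * \<gamma> / 4)"
    using mult_left_mono[OF Ze, of l] \<gamma> by (intro mult_right_mono) (auto simp: l_def)
  also have "\<dots> \<le> exp (- l * \<gamma> + 16 * l\<^sup>2) * exp (l * \<gamma> / 4)"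
    by (intro mult_right_mono exp_ge_add_one_self) auto
  also have "\<dots> = exp (- \<gamma>\<^sup>2 / 128)"
    by (simp add: exp_add[symmetric] l_def power2_eq_square field_simps)
  finally have We: "expectation W \<le> exp (- \<gamma>\<^sup>2 / 128)" .
  have "{x \<in> space (\<Pi>\<^sub>M i\<in>{..<n}. M). (\<Sum>i<n. indicator G (x i) - c * indicator E (x i)) \<le> n * \<gamma> / 4}
     = {x \<in> space (\<Pi>\<^sub>M i\<in>{..<n}. M). 1 \<le> (\<Prod>i<n. W (x i))}"
  proof (intro Collect_cong conj_cong refl)
    fix x
    have "(\<Prod>i<n. W (x i)) = exp (- l * ((\<Sum>i<n. Z (x i)) - n * \<gamma> / 4))"
      unfolding W_def by (subst exp_sum[symmetric]) (auto simp: sum_distrib_left[symmetric] sum_negf sum_subtractf right_diff_distrib)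
    then have "1 \<le> (\<Prod>i<n. W (x i)) \<longleftrightarrow> 0 \<le> - l * ((\<Sum>i<n. Z (x i)) - n * \<gamma> / 4)" by simp
    also have "\<dots> \<longleftrightarrow> (\<Sum>i<n. Z (x i)) \<le> n * \<gamma> / 4"
      using \<gamma> by (auto simp: l_def mult_le_0_iff zero_le_mult_iff)
    finally show "(\<Sum>i<n. indicator G (x i) - c * indicator E (x i)) \<le> n * \<gamma> / 4 \<longleftrightarrow> 1 \<le> (\<Prod>i<n. W (x i))"
      by (simp add: Z_def)
  qed
  then show ?thesis
    using chernoff[of W "exp (- \<gamma>\<^sup>2 / 128)" 1 n] Wi We by (simp add: W_def)
qed

text \<open>Tilting by \<open>s powr indicator\<close> has expectation at most 2 because the event
  has mass at most \<open>1 / s\<^sup>2\<close>. Half of the exponent \<open>n / 9\<close> absorbs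
  the resulting \<open>2 ^ n\<close>, which is why \<open>s\<close> must reach
  \<open>2 ^ 18\<close>.\<close>

lemma (in prob_space) many_rare_events:
  fixes s :: real and n :: nat
  assumes [measurable]: "T \<in> events" and T: "prob T \<le> 1 / s\<^sup>2" and s: "2 ^ 18 \<le> s"
  shows "measure (\<Pi>\<^sub>M i\<in>{..<n}. M) {x \<in> space (\<Pi>\<^sub>M i\<in>{..<n}. M).
      n / 9 \<le> (\<Sum>i<n. indicator T (x i))} \<le> s powr (- (n / 18))"
proof -
  have s1: "1 < s" using s by simp
  define W where "W x = s powr (indicator T x)" for x
  have We: "W x = 1 + (s - 1) * indicator T x" for x using s1 by (simp add: W_def indicator_def)
  have Wi: "integrable M W"
    unfolding We[abs_def] by (intro Bochner_Integration.integrable_add integrable_mult_right integrable_indicator) (simp_all)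
  have "expectation W = 1 + (s - 1) * prob T" unfolding We
    by (subst Bochner_Integration.integral_add) (auto simp: prob_space integrable_indicator)
  also have "\<dots> \<le> 1 + (s - 1) * (1 / s\<^sup>2)" using T s1 by (intro add_left_mono mult_left_mono) auto
  also have "\<dots> \<le> 1 + s * (1 / s\<^sup>2)" using s1 by (intro add_left_mono mult_right_mono) auto
  also have "\<dots> \<le> 2" using s1 by (simp add: power2_eq_square)
  finally have W2: "expectation W \<le> 2" .
  have "{x \<in> space (\<Pi>\<^sub>M i\<in>{..<n}. M). n / 9 \<le> (\<Sum>i<n. indicator T (x i))}
      = {x \<in> space (\<Pi>\<^sub>M i\<in>{..<n}. M). s powr (n / 9) \<le> (\<Prod>i<n. W (x i))}"
    unfolding W_def using s1 by (simp add: powr_sum[symmetric])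
  then have "measure (\<Pi>\<^sub>M i\<in>{..<n}. M) {x \<in> space (\<Pi>\<^sub>M i\<in>{..<n}. M). n / 9 \<le> (\<Sum>i<n. indicator T (x i))}
      = measure (\<Pi>\<^sub>M i\<in>{..<n}. M) {x \<in> space (\<Pi>\<^sub>M i\<in>{..<n}. M). s powr (n / 9) \<le> (\<Prod>i<n. W (x i))}"
    by (rule arg_cong)
  also have "\<dots> \<le> 2 ^ n / s powr (n / 9)"
  proof (rule chernoff[OF _ _ Wi W2])
    show "W \<in> borel_measurable M" using Wi by (rule borel_measurable_integrable)
    show "0 \<le> W x" for x by (simp add: W_def)
    show "0 < s powr (n / 9)" using s1 by simp
  qed
  also have "\<dots> \<le> s powr (n / 18) / s powr (n / 9)"
  proof (rule divide_right_mono)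
    have "2 = (2 ^ 18) powr (1 / 18 :: real)" by (simp add: powr_realpow[symmetric] powr_powr del: powr_realpow)
    also have "\<dots> \<le> s powr (1 / 18)" using s by (intro powr_mono2) auto
    finally have "2 ^ n \<le> (s powr (1 / 18)) ^ n" by (intro power_mono) auto
    also have "\<dots> = s powr (n / 18)" using s1 by (simp add: powr_realpow[symmetric] powr_powr)
    finally show "2 ^ n \<le> s powr (n / 18)" .
  qed simp
  also have "\<dots> = s powr (- (n / 18))" by (simp add: powr_diff[symmetric])
  finally show ?thesis .
qed

lemma (in prob_space) prob_all:
  assumes "E \<in> events"
  shows "measure (\<Pi>\<^sub>M i\<in>{..<n::nat}. M) {x \<in> space (\<Pi>\<^sub>M i\<in>{..<n}. M). \<forall>i<n. x i \<in> E} = prob E ^ n"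
proof -
  interpret F: finite_product_prob_space "\<lambda>_::nat. M" "{..<n}" by standard auto
  have "{x \<in> space (\<Pi>\<^sub>M i\<in>{..<n}. M). \<forall>i<n. x i \<in> E} = (\<Pi>\<^sub>E i\<in>{..<n}. E)"
    using sets.sets_into_space[OF assms] by (auto simp: space_PiM PiE_iff extensional_def)
  then show ?thesis using F.finite_measure_PiM_emb assms F.prob_times[of "\<lambda>_. E"] by simp
qed

subsection \<open>Buckets near the sample_mean\<close>

definition bucket_left :: "real \<Rightarrow> real \<Rightarrow> nat \<Rightarrow> real" where
  "bucket_left r R b = - R - 2 * r + real b * r"

definition good_bucket :: "real \<Rightarrow> real \<Rightarrow> real \<Rightarrow> nat \<Rightarrow> bool" where
  "good_bucket r R \<mu> b \<longleftrightarrow> \<bar>\<mu> - (bucket_left r R b + r / 2)\<bar> < 2 * r"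

lemma length_range_buckets: "length (range_buckets r R) = nat \<lceil>((R + 2 * r) - (- R - 2 * r)) / r\<rceil>"
  by (simp add: range_buckets_def)

lemma nth_range_buckets:
  "b < length (range_buckets r R) \<Longrightarrow> range_buckets r R ! b = (bucket_left r R b, bucket_left r R b + r)"
  by (simp add: range_buckets_def bucket_left_def algebra_simps)

definition window :: "nat \<Rightarrow> real measure \<Rightarrow> real \<Rightarrow> real \<Rightarrow> nat set \<Rightarrow> (nat \<Rightarrow> real) set" where
  "window m P r R J = {x \<in> space (person_space m P). \<exists>b\<in>J. bucket_left r R b \<le> sample_mean m x \<and> sample_mean m x < bucket_left r R b + r}"

lemma window_measurable:
  assumes [measurable_cong]: "sets P = sets borel" and "finite J"
  shows "window m P r R J \<in> sets (person_space m P)"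
proof -
  have [measurable]: "sample_mean m \<in> borel_measurable (person_space m P)" using assms by (intro sample_mean_measurable)
  have [measurable]: "countable J" using assms by (intro countable_finite)
  show ?thesis unfolding window_def using \<open>finite J\<close> by measurable
qed

text \<open>The distances \<open>y1\<close> and \<open>y2\<close> reach to the ends of the window,
  whose complement is covered by the two tails beyond them; \<open>y3\<close> and \<open>y4\<close>
  reach to the bad buckets. The margin 0.004 is what the budget 0.996 leaves of the total
  mass.\<close>

lemma window_gap:
  assumes P: "real_distribution_with_mean P \<mu>" and r: "0 < r"
    and lo: "bucket_left r R j \<le> \<mu> - y1 * r" and hi: "\<mu> + y2 * r \<le> bucket_left r R (j + c)"
    and t: "real c * tail m P \<mu> 1 (y3 * r) + (tail m P \<mu> (-1) (y1 * r) + tail m P \<mu> 1 (y2 * r)) \<le> 0.996"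
      "real c * tail m P \<mu> (-1) (y4 * r) + (tail m P \<mu> (-1) (y1 * r) + tail m P \<mu> 1 (y2 * r)) \<le> 0.996"
  shows "real c * measure (person_space m P) {x \<in> space (person_space m P). \<mu> + y3 * r \<le> sample_mean m x} + 0.004
       \<le> measure (person_space m P) (window m P r R {j..<j + c})"
    and "real c * measure (person_space m P) {x \<in> space (person_space m P). sample_mean m x < \<mu> - y4 * r} + 0.004
       \<le> measure (person_space m P) (window m P r R {j..<j + c})"
    and "x \<in> space (person_space m P) \<Longrightarrow> x \<notin> window m P r R {j..<j + c} \<Longrightarrow>
       y1 * r \<le> \<mu> - sample_mean m x \<or> y2 * r \<le> sample_mean m x - \<mu>"
proof -
  interpret M: prob_space "person_space m P" by (rule prob_space_person_space[OF P])
  have [measurable_cong]: "sets P = sets borel" using P by (simp add: real_distribution_with_mean_def)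
  have [measurable]: "sample_mean m \<in> borel_measurable (person_space m P)"
    using P by (intro sample_mean_measurable) (simp add: real_distribution_with_mean_def)
  let ?W = "window m P r R {j..<j + c}"
  let ?A = "{x \<in> space (person_space m P). y1 * r \<le> -1 * (sample_mean m x - \<mu>)}"
  let ?B = "{x \<in> space (person_space m P). y2 * r \<le> 1 * (sample_mean m x - \<mu>)}"
  have W: "?W \<in> M.events" using P by (intro window_measurable) (auto simp: real_distribution_with_mean_def)
  have cover: "space (person_space m P) \<subseteq> ?W \<union> (?A \<union> ?B)"
  proof
    fix x assume x: "x \<in> space (person_space m P)"
    show "x \<in> ?W \<union> (?A \<union> ?B)"
    proof (rule ccontr)
      assume n: "x \<notin> ?W \<union> (?A \<union> ?B)"
      then have l: "bucket_left r R j \<le> sample_mean m x" and u: "sample_mean m x < bucket_left r R (j + c)" using x lo hi by auto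
      define z where "z = (sample_mean m x + R + 2 * r) / r"
      have z: "sample_mean m x = - R - 2 * r + z * r" using r by (simp add: z_def field_simps)
      have zj: "real j \<le> z" using l r unfolding z bucket_left_def by simp
      have zc: "z < real (j + c)" using u r unfolding z bucket_left_def by simp
      define b where "b = nat \<lfloor>z\<rfloor>"
      have z0: "0 \<le> z" using zj by (rule order_trans[rotated]) simp
      then have b: "real b \<le> z" "z < real b + 1" by (auto simp: b_def)
      then have "j \<le> b" "b < j + c" using zj zc by linarith+
      moreover have "bucket_left r R b \<le> sample_mean m x \<and> sample_mean m x < bucket_left r R b + r"
      proof -
        have "real b * r \<le> z * r" "z * r < (real b + 1) * r" using b r by auto
        then show ?thesis unfolding z bucket_left_def by (simp add: algebra_simps)
      qed
      ultimately have "x \<in> ?W" using x unfolding window_def by auto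
      then show False using n by simp
    qed
  qed
  show "x \<in> space (person_space m P) \<Longrightarrow> x \<notin> ?W \<Longrightarrow>
       y1 * r \<le> \<mu> - sample_mean m x \<or> y2 * r \<le> sample_mean m x - \<mu>"
    using subsetD[OF cover, of x] by auto
  from cover have "1 \<le> M.prob (?W \<union> (?A \<union> ?B))"
    using M.finite_measure_mono[of "space (person_space m P)" "?W \<union> (?A \<union> ?B)"] W by (simp add: M.prob_space)
  also have "\<dots> \<le> M.prob ?W + (M.prob ?A + M.prob ?B)"
    using W by (intro order_trans[OF measure_Un_le] add_left_mono measure_Un_le) auto
  finally have 1: "1 \<le> M.prob ?W + (tail m P \<mu> (-1) (y1 * r) + tail m P \<mu> 1 (y2 * r))"
    by (simp add: tail_def)
  have "M.prob {x \<in> space (person_space m P). \<mu> + y3 * r \<le> sample_mean m x} = tail m P \<mu> 1 (y3 * r)"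
    unfolding tail_def by (intro arg_cong2[where f = measure]) (auto simp: algebra_simps)
  then show "real c * M.prob {x \<in> space (person_space m P). \<mu> + y3 * r \<le> sample_mean m x} + 0.004 \<le> M.prob ?W"
    using 1 t(1) by simp
  have "M.prob {x \<in> space (person_space m P). sample_mean m x < \<mu> - y4 * r} \<le> tail m P \<mu> (-1) (y4 * r)"
    unfolding tail_def by (intro M.finite_measure_mono) auto
  then have "real c * M.prob {x \<in> space (person_space m P). sample_mean m x < \<mu> - y4 * r} \<le> real c * tail m P \<mu> (-1) (y4 * r)"
    by (intro mult_left_mono) auto
  then show "real c * M.prob {x \<in> space (person_space m P). sample_mean m x < \<mu> - y4 * r} + 0.004 \<le> M.prob ?W"
    using 1 t(2) by simp
qed

lemma good_window:
  assumes P: "real_distribution_with_mean P \<mu>" "2 \<le> k" "moment_bounded_by_one k P \<mu>"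
    "1 \<le> m" "16 powr (1 / k) / sqrt (real m) < r" and R: "- R \<le> \<mu>" "\<mu> \<le> R" "r < R"
  obtains J right left where
    "J \<subseteq> {..<length (range_buckets r R)}" "J \<noteq> {}" "card J \<le> 4" "\<And>b. b \<in> J \<Longrightarrow> good_bucket r R \<mu> b"
    "\<And>b. \<not> good_bucket r R \<mu> b \<Longrightarrow> right \<le> bucket_left r R b \<or> bucket_left r R b + r \<le> left"
    "real (card J) * measure (person_space m P) {x \<in> space (person_space m P). right \<le> sample_mean m x} + 0.004
       \<le> measure (person_space m P) (window m P r R J)"
    "real (card J) * measure (person_space m P) {x \<in> space (person_space m P). sample_mean m x < left} + 0.004
       \<le> measure (person_space m P) (window m P r R J)"
    "\<And>x. x \<in> space (person_space m P) \<Longrightarrow> x \<notin> window m P r R J \<Longrightarrow> 1.455 * r \<le> \<bar>sample_mean m x - \<mu>\<bar>"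
proof -
  note thesisI = that
  have "0 < 16 powr (1 / k) / sqrt (real m)" using P(4) by simp
  then have r: "0 < r" using P(5) by linarith
  define u where "u = (\<mu> + R) / r"
  have u0: "0 \<le> u" using R r by (simp add: u_def)
  have mu: "\<mu> = - R + u * r" using r by (simp add: u_def)
  define j where "j = nat \<lfloor>u + 1/2\<rfloor>"
  have j: "real j \<le> u + 1/2" "u + 1/2 < real j + 1" using u0 by (auto simp: j_def)
  \<comment> \<open>The parameter \<open>a\<close> is the position of \<mu> relative to the grid:
    the buckets \<open>j\<close> to \<open>j + 3\<close> extend from
    \<open>\<mu> - (2.5 - a) * r\<close> to \<open>\<mu> + (1.5 + a) * r\<close>. All four are good
    if \<open>a < 1\<close>; at \<open>a = 1\<close> the midpoint of the last is exactly
    \<open>2 * r\<close> away, which the strict inequality forbids.\<close>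
  define a where "a = real j + 1/2 - u"
  have a: "0 < a" "a \<le> 1" using j by (auto simp: a_def)
  have left: "bucket_left r R b = \<mu> + (real b - real j - 2.5 + a) * r" for b
    unfolding bucket_left_def mu a_def by (simp add: algebra_simps)
  have good: "good_bucket r R \<mu> b \<longleftrightarrow> - a < real b - real j \<and> real b - real j < 4 - a" for b
  proof -
    have "\<mu> - (bucket_left r R b + r / 2) = - (real b - real j - 2 + a) * r"
      unfolding left by (simp add: algebra_simps)
    then have "\<bar>\<mu> - (bucket_left r R b + r / 2)\<bar> = \<bar>real b - real j - 2 + a\<bar> * r"
      using r by (simp add: abs_mult)
    then have "good_bucket r R \<mu> b \<longleftrightarrow> \<bar>real b - real j - 2 + a\<bar> < 2"
      unfolding good_bucket_def using r by simp
    then show ?thesis by (auto simp: abs_less_iff)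
  qed
  have len: "{j..<j+4} \<subseteq> {..<length (range_buckets r R)}"
  proof
    fix b assume "b \<in> {j..<j+4}"
    then have "real b < real j + 3.5" by simp
    also have "\<dots> \<le> u + 4" using j by simp
    also have "\<dots> \<le> 2 * R / r + 4" unfolding u_def using R r by (simp add: divide_right_mono)
    also have "\<dots> = ((R + 2 * r) - (- R - 2 * r)) / r" using r by (simp add: field_simps)
    also have "\<dots> \<le> real (length (range_buckets r R))"
      unfolding length_range_buckets by (rule real_nat_ceiling_ge)
    finally show "b \<in> {..<length (range_buckets r R)}" by simp
  qed
  have bad: "4 - a \<le> real b - real j \<or> real b \<le> real j - 1" if "\<not> good_bucket r R \<mu> b" for b
  proof (cases "j \<le> b")
    case True
    then show ?thesis using that a unfolding good by simp
  next
    case False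
    then have "b + 1 \<le> j" by simp
    then show ?thesis by linarith
  qed
  have bad_left: "bucket_left r R b + r \<le> \<mu> - (2.5 - a) * r" if "real b \<le> real j - 1" for b
  proof -
    have "(real b - real j - 1.5 + a) * r \<le> (- 2.5 + a) * r" using that r by (intro mult_right_mono) auto
    then show ?thesis unfolding left by (simp add: algebra_simps)
  qed
  have bad1: "\<mu> + 1.5 * r \<le> bucket_left r R b \<or> bucket_left r R b + r \<le> \<mu> - 1.5 * r" if nb: "\<not> good_bucket r R \<mu> b" for b
    using bad[OF nb]
  proof
    assume "4 - a \<le> real b - real j"
    then have "1.5 * r \<le> (real b - real j - 2.5 + a) * r" using r by (intro mult_right_mono) auto
    then show ?thesis unfolding left by simp
  next
    assume "real b \<le> real j - 1"
    from bad_left[OF this] have "bucket_left r R b + r \<le> \<mu> - (2.5 - a) * r" .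
    also have "\<dots> \<le> \<mu> - 1.5 * r" using a r by simp
    finally show ?thesis by simp
  qed
  \<comment> \<open>For \<open>a < 1\<close> integrality improves \<open>4 - a\<close> to 4, so bad
    buckets on the right only begin at distance \<open>1.5 + a\<close>.\<close>
  have bad2: "\<mu> + y3 * r \<le> bucket_left r R b \<or> bucket_left r R b + r \<le> \<mu> - y4 * r"
    if nb: "\<not> good_bucket r R \<mu> b" and y: "a < 1" "y3 \<le> 1.5 + a" "y4 \<le> 2.5 - a" for b y3 y4
    using bad[OF nb]
  proof
    assume "4 - a \<le> real b - real j"
    then have "real j + 3 < real b" using y by linarith
    then have "j + 4 \<le> b" by linarith
    then have "real j + 4 \<le> real b" by linarith
    then have "y3 * r \<le> (real b - real j - 2.5 + a) * r" using y r by (intro mult_right_mono) auto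
    then show ?thesis unfolding left by simp
  next
    assume "real b \<le> real j - 1"
    from bad_left[OF this] have "bucket_left r R b + r \<le> \<mu> - (2.5 - a) * r" .
    also have "\<dots> \<le> \<mu> - y4 * r" using y r by (simp add: mult_right_mono)
    finally show ?thesis by simp
  qed
  have goodJ: "good_bucket r R \<mu> b" if "b \<in> {j..<j+4}" "a < 1 \<or> b < j + 3" for b
    using that a unfolding good by auto
  have lo: "bucket_left r R (j + i) \<le> \<mu> - y * r" if "y \<le> 2.5 - real i - a" for i y
  proof -
    have "(real i - 2.5 + a) * r \<le> (- y) * r" using that r by (intro mult_right_mono) auto
    then show ?thesis unfolding left by simp
  qed
  have hi: "\<mu> + y * r \<le> bucket_left r R (j + i)" if "y \<le> real i - 2.5 + a" for i y
    unfolding left using that r by (simp add: mult_right_mono)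
  have ab: "\<bar>1::real\<bar> = 1" "\<bar>-1::real\<bar> = 1" by auto
  obtain t1 t2 t3 t4 t5 t6 where t:
    "\<And>\<sigma>. \<bar>\<sigma>\<bar> = 1 \<Longrightarrow> tail m P \<mu> \<sigma> (1.5 * r) \<le> t1"
    "\<And>\<sigma>. \<bar>\<sigma>\<bar> = 1 \<Longrightarrow> tail m P \<mu> \<sigma> (1.455 * r) \<le> t2"
    "\<And>\<sigma>. \<bar>\<sigma>\<bar> = 1 \<Longrightarrow> tail m P \<mu> \<sigma> (1.545 * r) \<le> t3"
    "\<And>\<sigma>. \<bar>\<sigma>\<bar> = 1 \<Longrightarrow> tail m P \<mu> \<sigma> (2.4 * r) \<le> t4"
    "\<And>\<sigma>. \<bar>\<sigma>\<bar> = 1 \<Longrightarrow> tail m P \<mu> \<sigma> (1.6 * r) \<le> t5"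
    "\<And>\<sigma>. \<bar>\<sigma>\<bar> = 1 \<Longrightarrow> tail m P \<mu> \<sigma> (2 * r) \<le> t6"
    "4 * t1 + t2 \<le> 0.996" "5 * t3 + t4 \<le> 0.996" "5 * t5 + t6 \<le> 0.996" "t4 \<le> t3" "t6 \<le> t5"
    using tail_budget[OF P] by blast
  note tt = t(1)[OF ab(1)] t(1)[OF ab(2)] t(2)[OF ab(1)] t(2)[OF ab(2)] t(3)[OF ab(1)] t(3)[OF ab(2)]
    t(4)[OF ab(1)] t(4)[OF ab(2)] t(5)[OF ab(1)] t(5)[OF ab(2)] t(6)[OF ab(1)] t(6)[OF ab(2)] t(7-11)
  have window_thesis: thesis
    if c: "0 < c" "i + c \<le> 4" "a < 1 \<or> i + c \<le> 3"
      and bad: "\<And>b. \<not> good_bucket r R \<mu> b \<Longrightarrow> \<mu> + y3 * r \<le> bucket_left r R b \<or> bucket_left r R b + r \<le> \<mu> - y4 * r"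
      and y14: "1.455 \<le> y1" "1.455 \<le> y2"
      and y: "y1 \<le> 2.5 - real i - a" "y2 \<le> real (i + c) - 2.5 + a"
      and t: "real c * tail m P \<mu> 1 (y3 * r) + (tail m P \<mu> (-1) (y1 * r) + tail m P \<mu> 1 (y2 * r)) \<le> 0.996"
      "real c * tail m P \<mu> (-1) (y4 * r) + (tail m P \<mu> (-1) (y1 * r) + tail m P \<mu> 1 (y2 * r)) \<le> 0.996"
    for c i :: nat and y1 y2 y3 y4 :: real
  proof -
    have hi': "\<mu> + y2 * r \<le> bucket_left r R (j + i + c)" using hi[OF y(2)] by (simp add: add.assoc)
    note w = window_gap[OF P(1) r lo[OF y(1)] hi' t]
    show thesis
    proof (rule thesisI[of "{j + i..<j + i + c}" "\<mu> + y3 * r" "\<mu> - y4 * r"])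
      show "{j + i..<j + i + c} \<subseteq> {..<length (range_buckets r R)}"
        using c by (intro order_trans[OF _ len]) auto
      show "good_bucket r R \<mu> b" if "b \<in> {j + i..<j + i + c}" for b
        using that c by (intro goodJ) auto
      show "1.455 * r \<le> \<bar>sample_mean m x - \<mu>\<bar>"
        if "x \<in> space (person_space m P)" "x \<notin> window m P r R {j + i..<j + i + c}" for x
        using w(3)[OF that] mult_right_mono[OF y14(1), of r] mult_right_mono[OF y14(2), of r] r by linarith
    qed (use c bad w(1,2) in simp_all)
  qed
  \<comment> \<open>For \<open>a\<close> near 0 or 1 the bad buckets on one side are only about
    \<open>3 * r / 2\<close> away. The window then omits the outermost bucket on the opposite side,
    which lowers the factor of the tail from four to three at the price of an end at distance 1.455.
    Otherwise all four buckets are used and the distances add up to 4 or nearly so.\<close>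
  consider "a \<le> 0.045" | "0.955 \<le> a" | "0.045 < a" "a < 0.1" | "0.9 < a" "a < 0.955" | "0.1 \<le> a" "a \<le> 0.5" | "0.5 < a" "a \<le> 0.9"
    by linarith
  then show thesis
  proof cases
    case 1
    then show thesis
      using tt a by (intro window_thesis[where c = 3 and i = 1 and ?y3.0 = "1.5" and ?y4.0 = "1.5" and ?y1.0 = "1.455" and ?y2.0 = "1.5"] bad1) simp_all
  next
    case 2
    then show thesis
      using tt a by (intro window_thesis[where c = 3 and i = 0 and ?y3.0 = "1.5" and ?y4.0 = "1.5" and ?y1.0 = "1.5" and ?y2.0 = "1.455"] bad1) simp_all
  next
    case 3
    then show thesis
      using tt a by (intro window_thesis[where c = 4 and i = 0 and ?y3.0 = "1.545" and ?y4.0 = "2.4" and ?y1.0 = "2.4" and ?y2.0 = "1.545"] bad2) simp_all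
  next
    case 4
    then show thesis
      using tt a by (intro window_thesis[where c = 4 and i = 0 and ?y3.0 = "2.4" and ?y4.0 = "1.545" and ?y1.0 = "1.545" and ?y2.0 = "2.4"] bad2) simp_all
  next
    case 5
    then show thesis
      using tt a by (intro window_thesis[where c = 4 and i = 0 and ?y3.0 = "1.6" and ?y4.0 = "2" and ?y1.0 = "2" and ?y2.0 = "1.6"] bad2) simp_all
  next
    case 6
    then show thesis
      using tt a by (intro window_thesis[where c = 4 and i = 0 and ?y3.0 = "2" and ?y4.0 = "1.6" and ?y1.0 = "1.6" and ?y2.0 = "2"] bad2) simp_all
  qed
qed

subsection \<open>Concentration of the bucket counts\<close>

definition bucket_freq :: "nat \<Rightarrow> nat \<Rightarrow> real \<Rightarrow> real \<Rightarrow> dataset \<Rightarrow> nat \<Rightarrow> real" where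
  "bucket_freq n m r R X b = real (bucket_count n (person_means n m X) (bucket_left r R b, bucket_left r R b + r))"

text \<open>The margin is twice \<alpha> because noise may lower the count of \<open>g\<close> and
  raise that of a bad bucket by \<alpha> each. The bucket \<open>g\<close> may depend on the
  data.\<close>

definition good_data :: "nat \<Rightarrow> nat \<Rightarrow> real \<Rightarrow> real \<Rightarrow> real \<Rightarrow> real \<Rightarrow> dataset \<Rightarrow> bool" where
  "good_data n m r R \<mu> \<alpha> X \<longleftrightarrow> (\<exists>g<length (range_buckets r R). good_bucket r R \<mu> g \<and>
     (\<forall>b<length (range_buckets r R). \<not> good_bucket r R \<mu> b \<longrightarrow> bucket_freq n m r R X b + 2 * \<alpha> < bucket_freq n m r R X g))"

lemma iid_dataset_eq: "iid_dataset n m P = (\<Pi>\<^sub>M i\<in>{..<n}. person_space m P)"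
  by (simp add: iid_dataset_def person_space_def)

lemma bucket_freq_eq_sum:
  "bucket_freq n m r R X b = (\<Sum>i<n. indicator {bucket_left r R b..<bucket_left r R b + r} (sample_mean m (X i)))"
proof -
  have "{i. i < n \<and> person_means n m X i \<in> {bucket_left r R b..<bucket_left r R b + r}}
      = {i \<in> {..<n}. sample_mean m (X i) \<in> {bucket_left r R b..<bucket_left r R b + r}}"
    by (auto simp: person_means_def sample_mean_def)
  then show ?thesis
    unfolding bucket_freq_def bucket_count_def by (simp add: indicator_def sum.If_cases Int_def)
qed

lemma bucket_freq_measurable:
  assumes "sets P = sets borel"
  shows "(\<lambda>X. bucket_freq n m r R X b) \<in> borel_measurable (iid_dataset n m P)"
proof -
  have mm: "sample_mean m \<in> borel_measurable (person_space m P)" using assms by (rule sample_mean_measurable)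
  have [measurable]: "(\<lambda>X. sample_mean m (X i)) \<in> borel_measurable (iid_dataset n m P)" if "i < n" for i
    unfolding iid_dataset_eq using that by (intro measurable_compose[OF _ mm] measurable_component_singleton) auto
  show ?thesis unfolding bucket_freq_eq_sum by (intro borel_measurable_sum) (simp add: measurable_compose[OF _ borel_measurable_indicator])
qed

lemma good_data_measurable:
  assumes "sets P = sets borel"
  shows "{X \<in> space (iid_dataset n m P). good_data n m r R \<mu> \<alpha> X} \<in> sets (iid_dataset n m P)"
proof -
  have [measurable]: "(\<lambda>X. bucket_freq n m r R X b) \<in> borel_measurable (iid_dataset n m P)" for b
    using assms by (rule bucket_freq_measurable)
  show ?thesis unfolding good_data_def by measurable
qed

definition bad_prob :: "nat \<Rightarrow> nat \<Rightarrow> real measure \<Rightarrow> real \<Rightarrow> real \<Rightarrow> real \<Rightarrow> real \<Rightarrow> real" where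
  "bad_prob n m P r R \<mu> \<alpha> = measure (iid_dataset n m P) {X \<in> space (iid_dataset n m P). \<not> good_data n m r R \<mu> \<alpha> X}"

lemma bucket_freq_window:
  assumes r: "0 < r" and J: "finite J" and X: "X \<in> space (iid_dataset n m P)"
  shows "(\<Sum>i<n. indicat_real (window m P r R J) (X i)) = (\<Sum>b\<in>J. bucket_freq n m r R X b)"
proof -
  have "indicat_real (window m P r R J) (X i) = (\<Sum>b\<in>J. indicator {bucket_left r R b..<bucket_left r R b + r} (sample_mean m (X i)))"
    if i: "i < n" for i
  proof -
    have sp: "X i \<in> space (person_space m P)" using X i unfolding iid_dataset_eq by (auto simp: space_PiM)
    have disj: "b = b'" if "bucket_left r R b \<le> z" "z < bucket_left r R b + r" "bucket_left r R b' \<le> z" "z < bucket_left r R b' + r" for b b' z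
    proof -
      have "real b * r < (real b' + 1) * r" "real b' * r < (real b + 1) * r"
        using that unfolding bucket_left_def by (auto simp: algebra_simps)
      then have "real b < real b' + 1" "real b' < real b + 1" using r by auto
      then show ?thesis by linarith
    qed
    show ?thesis
    proof (cases "X i \<in> window m P r R J")
      case True
      then obtain b where b: "b \<in> J" "bucket_left r R b \<le> sample_mean m (X i)" "sample_mean m (X i) < bucket_left r R b + r"
        by (auto simp: window_def)
      have "(\<Sum>b'\<in>J. indicator {bucket_left r R b'..<bucket_left r R b' + r} (sample_mean m (X i))) = (\<Sum>b'\<in>J. if b' = b then 1 else 0 :: real)"
        using b disj by (intro sum.cong) (auto simp: indicator_def)
      then show ?thesis using True b J by simp
    next
      case False
      then show ?thesis using sp by (auto simp: window_def indicator_def intro!: sum.neutral)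
    qed
  qed
  then have "(\<Sum>i<n. indicat_real (window m P r R J) (X i)) =
    (\<Sum>i<n. \<Sum>b\<in>J. indicator {bucket_left r R b..<bucket_left r R b + r} (sample_mean m (X i)))" by simp
  also have "\<dots> = (\<Sum>b\<in>J. \<Sum>i<n. indicator {bucket_left r R b..<bucket_left r R b + r} (sample_mean m (X i)))"
    by (rule sum.swap)
  finally show ?thesis by (simp add: bucket_freq_eq_sum)
qed

lemma exists_ge_average:
  fixes f :: "'a \<Rightarrow> real"
  assumes "finite J" "J \<noteq> {}"
  obtains g where "g \<in> J" "(\<Sum>b\<in>J. f b) \<le> real (card J) * f g" "\<And>b. b \<in> J \<Longrightarrow> f b \<le> f g"
proof -
  have "Max (f ` J) \<in> f ` J" using assms by (intro Max_in) auto
  then obtain g where g: "g \<in> J" "f g = Max (f ` J)" by auto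
  then have "f b \<le> f g" if "b \<in> J" for b using that assms by simp
  then show thesis using g sum_bounded_above[of J f "f g"] by (intro that) auto
qed

text \<open>The three bounds serve many people, few people, and large \<open>sqrt m * r\<close>. The
  noise limit comes from the margin 0.004: a quarter of it survives concentration, giving
  \<open>n / 1000\<close>, and the best of at most four buckets gets \<open>n / 4000\<close>, twice
  the limit \<open>n / 8000\<close>.\<close>

lemma bad_prob_bounds:
  assumes P: "real_distribution_with_mean P \<mu>" "2 \<le> k" "moment_bounded_by_one k P \<mu>"
    "1 \<le> m" "16 powr (1 / k) / sqrt (real m) < r" and R: "- R \<le> \<mu>" "\<mu> \<le> R" "r < R"
    and n: "1 \<le> n" and \<alpha>: "\<alpha> \<le> n / 8000"
  shows "bad_prob n m P r R \<mu> \<alpha> \<le> 2 * exp (- 0.004\<^sup>2 / 128) ^ n"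
    and "bad_prob n m P r R \<mu> \<alpha> \<le> 1 - 0.001 ^ n"
    and "2 ^ 18 \<le> sqrt m * r \<Longrightarrow> bad_prob n m P r R \<mu> \<alpha> \<le> (sqrt m * r) powr (- (n / 18))"
proof -
  have "0 < 16 powr (1 / k) / sqrt (real m)" using P(4) by simp
  then have r: "0 < r" using P(5) by linarith
  have setsP [measurable_cong]: "sets P = sets borel" using P by (simp add: real_distribution_with_mean_def)
  interpret M: prob_space "person_space m P" by (rule prob_space_person_space[OF P(1)])
  interpret D: prob_space "iid_dataset n m P"
    unfolding iid_dataset_eq by (intro prob_space_PiM M.prob_space_axioms)
  have mm [measurable]: "sample_mean m \<in> borel_measurable (person_space m P)" using setsP by (rule sample_mean_measurable)
  let ?N = "length (range_buckets r R)"
  let ?S = "space (iid_dataset n m P)"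
  let ?f = "bucket_freq n m r R"
  obtain J right left where J: "J \<subseteq> {..<?N}" "J \<noteq> {}" "card J \<le> 4" "\<And>b. b \<in> J \<Longrightarrow> good_bucket r R \<mu> b"
    and bad: "\<And>b. \<not> good_bucket r R \<mu> b \<Longrightarrow> right \<le> bucket_left r R b \<or> bucket_left r R b + r \<le> left"
    and gap: "real (card J) * M.prob {x \<in> space (person_space m P). right \<le> sample_mean m x} + 0.004
       \<le> M.prob (window m P r R J)"
    "real (card J) * M.prob {x \<in> space (person_space m P). sample_mean m x < left} + 0.004
       \<le> M.prob (window m P r R J)"
    and far: "\<And>x. x \<in> space (person_space m P) \<Longrightarrow> x \<notin> window m P r R J \<Longrightarrow> 1.455 * r \<le> \<bar>sample_mean m x - \<mu>\<bar>"
    by (rule good_window[OF P R]) blast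
  have finJ: "finite J" using J(1) finite_subset by blast
  have cJ: "1 \<le> card J" using finJ J(2) by (simp add: Suc_leI card_gt_0_iff)
  have W: "window m P r R J \<in> M.events" by (rule window_measurable[OF setsP finJ])
  let ?RE = "{x \<in> space (person_space m P). right \<le> sample_mean m x}"
  let ?LE = "{x \<in> space (person_space m P). sample_mean m x < left}"
  have Xi: "X i \<in> space (person_space m P)" if "X \<in> ?S" "i < n" for X i
    using that unfolding iid_dataset_eq by (auto simp: space_PiM)
  have freq_bad: "?f X b \<le> max (\<Sum>i<n. indicator ?RE (X i)) (\<Sum>i<n. indicator ?LE (X i))"
    if X: "X \<in> ?S" and b: "\<not> good_bucket r R \<mu> b" for X b
    using bad[OF b]
  proof
    assume "right \<le> bucket_left r R b"
    then have "?f X b \<le> (\<Sum>i<n. indicator ?RE (X i))"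
      unfolding bucket_freq_eq_sum using Xi[OF X] by (intro sum_mono) (auto simp: indicator_def)
    then show ?thesis by simp
  next
    assume "bucket_left r R b + r \<le> left"
    then have "?f X b \<le> (\<Sum>i<n. indicator ?LE (X i))"
      unfolding bucket_freq_eq_sum using Xi[OF X] by (intro sum_mono) (auto simp: indicator_def)
    then show ?thesis by simp
  qed
  show "bad_prob n m P r R \<mu> \<alpha> \<le> 2 * exp (- 0.004\<^sup>2 / 128) ^ n"
  proof -
    let ?A = "\<lambda>E. {x \<in> ?S. (\<Sum>i<n. indicator (window m P r R J) (x i) - real (card J) * indicator E (x i)) \<le> n * 0.004 / 4}"
    have ind: "(\<lambda>x. indicat_real E (x i)) \<in> borel_measurable (iid_dataset n m P)" if "E \<in> M.events" "i < n" for E i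
      unfolding iid_dataset_eq using that
      by (intro measurable_compose[OF measurable_component_singleton borel_measurable_indicator]) auto
    have Am: "?A E \<in> D.events" if E: "E \<in> M.events" for E
    proof -
      have [measurable]: "(\<lambda>x. (\<Sum>i<n. indicator (window m P r R J) (x i) - real (card J) * indicator E (x i))) \<in> borel_measurable (iid_dataset n m P)"
        using ind[OF E] ind[OF W] by (intro borel_measurable_sum borel_measurable_diff borel_measurable_times) auto
      show ?thesis by measurable
    qed
    have "{X \<in> ?S. \<not> good_data n m r R \<mu> \<alpha> X} \<subseteq> ?A ?RE \<union> ?A ?LE"
    proof (rule subsetI, rule ccontr)
      fix X assume X: "X \<in> {X \<in> ?S. \<not> good_data n m r R \<mu> \<alpha> X}" and nA: "X \<notin> ?A ?RE \<union> ?A ?LE"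
      then have XS: "X \<in> ?S" by simp
      obtain g where g: "g \<in> J" "(\<Sum>b\<in>J. ?f X b) \<le> real (card J) * ?f X g"
        using exists_ge_average[OF finJ J(2)] by metis
      let ?m = "max (\<Sum>i<n. indicat_real ?RE (X i)) (\<Sum>i<n. indicat_real ?LE (X i))"
      have "n / 1000 + real (card J) * ?m < (\<Sum>b\<in>J. ?f X b)"
        using nA XS unfolding bucket_freq_window[OF r finJ XS, symmetric]
        by (auto simp: sum_subtractf sum_distrib_left[symmetric] max_def)
      also note g(2)
      finally have 1: "n / 1000 + real (card J) * ?m < real (card J) * ?f X g" .
      have "real (card J) * (n / 4000) \<le> 4 * (n / 4000)" using J(3) by (intro mult_right_mono) auto
      with 1 have "real (card J) * (n / 4000 + ?m) < real (card J) * ?f X g" unfolding distrib_left by linarith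
      then have "n / 4000 + ?m < ?f X g" using cJ by simp
      then have "?f X b + 2 * \<alpha> < ?f X g" if "\<not> good_bucket r R \<mu> b" for b
        using freq_bad[OF XS that] \<alpha> by simp
      then have "good_data n m r R \<mu> \<alpha> X" unfolding good_data_def using g(1) J(1,4) by blast
      then show False using X by simp
    qed
    then have "bad_prob n m P r R \<mu> \<alpha> \<le> D.prob (?A ?RE \<union> ?A ?LE)"
      unfolding bad_prob_def by (intro D.finite_measure_mono sets.Un Am) measurable
    also have "\<dots> \<le> D.prob (?A ?RE) + D.prob (?A ?LE)"
      by (intro measure_Un_le Am) measurable
    also have "\<dots> \<le> exp (- 0.004\<^sup>2 / 128) ^ n + exp (- 0.004\<^sup>2 / 128) ^ n"
      unfolding iid_dataset_eq using J(3) by (intro add_mono M.concentration W gap) auto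
    finally show ?thesis by simp
  qed
  show "bad_prob n m P r R \<mu> \<alpha> \<le> 1 - 0.001 ^ n"
  proof -
    have "window m P r R J = (\<Union>b\<in>J. window m P r R {b})" by (auto simp: window_def)
    then have "M.prob (window m P r R J) \<le> (\<Sum>b\<in>J. M.prob (window m P r R {b}))"
      using finJ by (auto intro!: M.finite_measure_subadditive_finite window_measurable[OF setsP])
    moreover obtain g where g: "g \<in> J" "(\<Sum>b\<in>J. M.prob (window m P r R {b})) \<le> real (card J) * M.prob (window m P r R {g})"
      using exists_ge_average[OF finJ J(2)] by metis
    moreover have "real (card J) * M.prob (window m P r R {g}) \<le> 4 * M.prob (window m P r R {g})"
      using J(3) by (intro mult_right_mono) auto
    moreover have "0.004 \<le> M.prob (window m P r R J)" using gap(1)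
      by (rule order_trans[rotated]) simp
    \<comment> \<open>The margin 0.004 shared among at most four buckets: a fixed good bucket has
      mass at least 0.001, and if everybody falls into it the data are good.\<close>
    ultimately have g1: "0.001 \<le> M.prob (window m P r R {g})" by linarith
    let ?A = "{X \<in> ?S. \<forall>i<n. X i \<in> window m P r R {g}}"
    have Wg: "window m P r R {g} \<in> M.events" by (rule window_measurable[OF setsP]) simp
    have "?A \<subseteq> {X \<in> ?S. good_data n m r R \<mu> \<alpha> X}"
    proof
      fix X assume X: "X \<in> ?A"
      then have XS: "X \<in> ?S" by simp
      have 1: "?f X g = n" using X bucket_freq_window[OF r _ XS, of "{g}" R] by simp
      have 0: "?f X b = 0" if "b \<noteq> g" for b
      proof -
        have "(\<Sum>b\<in>{b, g}. ?f X b) = (\<Sum>i<n. indicat_real (window m P r R {b, g}) (X i))"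
          by (rule bucket_freq_window[OF r _ XS, symmetric]) simp
        also have "\<dots> \<le> n" using sum_bounded_above[of "{..<n}" "\<lambda>i. indicat_real (window m P r R {b, g}) (X i)" 1] by (simp add: indicator_def)
        finally have "?f X b \<le> 0" using that 1 by simp
        moreover have "0 \<le> ?f X b" by (simp add: bucket_freq_def)
        ultimately show ?thesis by simp
      qed
      have "2 * \<alpha> < n" using \<alpha> n by simp
      then have "good_data n m r R \<mu> \<alpha> X"
      proof -
        assume "2 * \<alpha> < n"
        moreover have "?f X b = 0" if "\<not> good_bucket r R \<mu> b" for b using that g(1) J(4) by (intro 0) auto
        ultimately show ?thesis
          unfolding good_data_def using g(1) J(1,4) 1 by (intro exI[of _ g]) auto
      qed
      then show "X \<in> {X \<in> ?S. good_data n m r R \<mu> \<alpha> X}" using XS by simp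
    qed
    then have "D.prob ?A \<le> D.prob {X \<in> ?S. good_data n m r R \<mu> \<alpha> X}"
      by (intro D.finite_measure_mono good_data_measurable setsP)
    moreover have "D.prob ?A = M.prob (window m P r R {g}) ^ n"
      unfolding iid_dataset_eq by (rule M.prob_all[OF Wg])
    moreover have "0.001 ^ n \<le> M.prob (window m P r R {g}) ^ n" using g1 by (intro power_mono) auto
    moreover have "bad_prob n m P r R \<mu> \<alpha> = 1 - D.prob {X \<in> ?S. good_data n m r R \<mu> \<alpha> X}"
      unfolding bad_prob_def by (rule D.prob_neg) (use good_data_measurable[OF setsP] in simp)
    ultimately show ?thesis by linarith
  qed
  show "bad_prob n m P r R \<mu> \<alpha> \<le> (sqrt m * r) powr (- (n / 18))" if s: "2 ^ 18 \<le> sqrt m * r"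
  proof -
    let ?T = "space (person_space m P) - window m P r R J"
    have T: "?T \<in> M.events" using W by auto
    have "M.prob ?T \<le> M.prob {x \<in> space (person_space m P). 1.455 * r \<le> \<bar>sample_mean m x - \<mu>\<bar>}"
      using far by (intro M.finite_measure_mono) auto
    also have "\<dots> \<le> 1 / (sqrt m * r)\<^sup>2" by (rule tail_two_sided[OF P(1-4) r])
    finally have T2: "M.prob ?T \<le> 1 / (sqrt m * r)\<^sup>2" .
    let ?A = "{X \<in> ?S. n / 9 \<le> (\<Sum>i<n. indicat_real ?T (X i))}"
    have sub: "{X \<in> ?S. \<not> good_data n m r R \<mu> \<alpha> X} \<subseteq> ?A"
    proof (rule subsetI, rule ccontr)
      fix X assume X: "X \<in> {X \<in> ?S. \<not> good_data n m r R \<mu> \<alpha> X}" and nA: "X \<notin> ?A"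
      then have XS: "X \<in> ?S" by simp
      let ?t = "\<Sum>i<n. indicat_real ?T (X i)"
      have "?t + (\<Sum>b\<in>J. ?f X b) = (\<Sum>i<n. indicat_real ?T (X i) + indicat_real (window m P r R J) (X i))"
        by (simp add: bucket_freq_window[OF r finJ XS, symmetric] sum.distrib)
      also have "\<dots> = (\<Sum>i<n. 1)"
        using Xi[OF XS] by (intro sum.cong) (auto simp: indicator_def)
      finally have tot: "?t + (\<Sum>b\<in>J. ?f X b) = n" by simp
      obtain g where g: "g \<in> J" "(\<Sum>b\<in>J. ?f X b) \<le> real (card J) * ?f X g"
        using exists_ge_average[OF finJ J(2)] by metis
      have "real (card J) * ?f X g \<le> 4 * ?f X g" using J(3) by (intro mult_right_mono) (auto simp: bucket_freq_def)
      \<comment> \<open>With fewer than \<open>n / 9\<close> people outside the window its fullest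
        bucket holds more than \<open>2 * n / 9\<close>, whereas a bad bucket is disjoint from the
        window and holds fewer than \<open>n / 9\<close>.\<close>
      then have "n \<le> ?t + 4 * ?f X g" using tot g(2) by linarith
      moreover have t9: "?t < n / 9" using nA XS by auto
      moreover have "?f X b \<le> ?t" if "\<not> good_bucket r R \<mu> b" for b
      proof -
        have bJ: "b \<notin> J" using J(4) that by auto
        have "(\<Sum>b\<in>insert b J. ?f X b) = (\<Sum>i<n. indicat_real (window m P r R (insert b J)) (X i))"
          by (rule bucket_freq_window[OF r _ XS, symmetric]) (use finJ in simp)
        also have "\<dots> \<le> (\<Sum>i<n. 1)" by (intro sum_mono) (simp add: indicator_def)
        finally show ?thesis using bJ finJ tot by simp
      qed
      ultimately have "?f X b + 2 * \<alpha> < ?f X g" if "\<not> good_bucket r R \<mu> b" for b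
        using that \<alpha> n by fastforce
      then have "good_data n m r R \<mu> \<alpha> X" unfolding good_data_def using g(1) J(1,4) by blast
      then show False using X by simp
    qed
    have "?A \<in> D.events"
    proof -
      have "(\<lambda>x. indicat_real ?T (x i)) \<in> borel_measurable (iid_dataset n m P)" if "i < n" for i
        unfolding iid_dataset_eq using that T
        by (intro measurable_compose[OF measurable_component_singleton borel_measurable_indicator]) auto
      then have [measurable]: "(\<lambda>x. \<Sum>i<n. indicat_real ?T (x i)) \<in> borel_measurable (iid_dataset n m P)"
        by (intro borel_measurable_sum) auto
      show ?thesis by measurable
    qed
    with sub have "bad_prob n m P r R \<mu> \<alpha> \<le> D.prob ?A"
      unfolding bad_prob_def by (intro D.finite_measure_mono)
    also have "\<dots> \<le> (sqrt m * r) powr (- (n / 18))"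
      unfolding iid_dataset_eq by (rule M.many_rare_events[OF T T2 s])
    finally show ?thesis .
  qed
qed

text \<open>The factor \<open>2\<close> of the union bound is useless for few people when \<open>\<beta>\<close> is close to \<open>1\<close>; there the
  event that everybody falls into the same good bucket takes over.\<close>

lemma min_geometric_le:
  fixes \<rho> p :: real
  assumes \<rho>: "0 < \<rho>" "\<rho> < 1" and p: "0 < p" "p < 1"
  obtains q where "0 < q" "q < 1" "\<And>n. 1 \<le> n \<Longrightarrow> min (2 * \<rho> ^ n) (1 - p ^ n) \<le> q ^ n"
proof -
  have sq: "0 < sqrt \<rho>" "sqrt \<rho> < 1" using \<rho> by auto
  \<comment> \<open>From \<open>K'\<close> on, half of the exponent swallows the factor 2. For
    smaller \<open>n\<close> the other entry of the minimum is at most the constant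
    \<open>c\<close>, which a root of order \<open>K'\<close> turns into a geometric rate.\<close>
  obtain K where K: "sqrt \<rho> ^ K < 1 / 2" using real_arch_pow_inv[of "1/2" "sqrt \<rho>"] sq by auto
  define K' where "K' = Suc K"
  have K': "sqrt \<rho> ^ K' < 1 / 2" "0 < K'"
    using K power_decreasing[of K "Suc K" "sqrt \<rho>"] sq unfolding K'_def by linarith+
  define c where "c = 1 - p ^ K'"
  have "p ^ K' \<le> p ^ 1" by (rule power_decreasing) (use p K' in auto)
  then have c: "0 < c" "c < 1" using p by (auto simp: c_def)
  define q where "q = max (sqrt \<rho>) (root K' c)"
  have q: "0 < q" "q < 1" using sq c K' by (auto simp: q_def less_max_iff_disj)
  have "min (2 * \<rho> ^ n) (1 - p ^ n) \<le> q ^ n" if n: "1 \<le> n" for n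
  proof (cases "K' \<le> n")
    case True
    have "sqrt \<rho> ^ n \<le> sqrt \<rho> ^ K'" by (rule power_decreasing[OF True]) (use sq in auto)
    then have half: "sqrt \<rho> ^ n \<le> 1 / 2" using K' by linarith
    have "2 * \<rho> ^ n = 2 * (sqrt \<rho> ^ n * sqrt \<rho> ^ n)" using \<rho> by (simp add: power_mult_distrib[symmetric])
    also have "\<dots> \<le> 2 * (1 / 2 * sqrt \<rho> ^ n)"
      using half sq by (intro mult_left_mono mult_right_mono zero_le_power) auto
    also have "\<dots> \<le> q ^ n" using sq by (auto simp: q_def intro!: power_mono)
    finally show ?thesis by simp
  next
    case False
    have "1 - p ^ n \<le> c" unfolding c_def using False p power_decreasing[of n K' p] by simp
    also have "c = root K' c ^ K'" using c K' by simp
    also have "\<dots> \<le> q ^ K'" using c K' by (intro power_mono) (auto simp: q_def)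
    also have "\<dots> \<le> q ^ n" using False q by (intro power_decreasing) auto
    finally show ?thesis by simp
  qed
  with q show thesis using that by blast
qed

text \<open>The form is dictated by the split of \<beta>: the power of \<open>sqrt m * r\<close>
  drops to \<open>\<beta> ^ L\<close> once \<open>n\<close> reaches
  \<open>C * (ln (1 / \<beta>) / ln (sqrt m * r))\<close>, and \<open>1 - 1 / L\<close> is the
  factor the split requires. Each decay is cut into two equal halves; one of them, already at
  \<open>n = 1\<close>, yields \<open>1 - 1 / L\<close> and so determines \<open>L\<close>, the
  other yields the power.\<close>

lemma bad_prob_decay:
  obtains L :: nat and C :: real where "4 \<le> L" "0 < C"
    "\<And>n m k P \<mu> r R \<alpha>. real_distribution_with_mean P \<mu> \<Longrightarrow> 2 \<le> k \<Longrightarrow> moment_bounded_by_one k P \<mu> \<Longrightarrow>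
      1 \<le> m \<Longrightarrow> 16 powr (1 / k) / sqrt (real m) < r \<Longrightarrow> - R \<le> \<mu> \<Longrightarrow> \<mu> \<le> R \<Longrightarrow> r < R \<Longrightarrow>
      1 \<le> n \<Longrightarrow> \<alpha> \<le> n / 8000 \<Longrightarrow>
      bad_prob n m P r R \<mu> \<alpha> \<le> (1 - 1 / L) * (sqrt m * r) powr (- (n * (L / C)))"
proof -
  obtain q where q: "0 < q" "q < 1" and qn: "\<And>n. 1 \<le> n \<Longrightarrow> min (2 * exp (- (0.004 :: real)\<^sup>2 / 128) ^ n) (1 - 0.001 ^ n) \<le> q ^ n"
    by (rule min_geometric_le[of "exp (- (0.004 :: real)\<^sup>2 / 128)" "0.001"]) (simp, simp, simp, simp, blast)
  have sq: "0 < sqrt q" "sqrt q < 1" using q by auto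
  obtain L0 :: nat where L0: "1 / (1 - sqrt q) \<le> real L0" using real_arch_simple by blast
  define L where "L = max 4 L0"
  have L4: "4 \<le> L" by (simp add: L_def)
  have "1 / (1 - sqrt q) \<le> real L" using L0 by (simp add: L_def)
  then have Lq: "sqrt q \<le> 1 - 1 / L" using sq L4 by (simp add: field_simps)
  \<comment> \<open>The first entry makes \<open>L / C\<close> at most 1/36, as needed for large
    \<open>s\<close>. The second makes \<open>s powr (- (L / C))\<close> at least
    \<open>sqrt q\<close> for every \<open>s\<close> between 1 and \<open>2 ^ 18\<close>.\<close>
  define C where "C = max (36 * real L) (2 * L * ln (2 ^ 18) / (- ln q))"
  have C36: "36 * real L \<le> C" and Cq: "2 * L * ln (2 ^ 18) / (- ln q) \<le> C" by (auto simp: C_def)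
  have C0: "0 < C" using C36 L4 by linarith
  have LC: "L / C \<le> 1 / 36" using C36 C0 by (simp add: field_simps)
  show thesis
  proof (rule that[OF L4 C0])
    fix n m :: nat and k :: real and P \<mu> r R \<alpha>
    assume P: "real_distribution_with_mean P \<mu>" "2 \<le> k" "moment_bounded_by_one k P \<mu>"
      "1 \<le> m" "16 powr (1 / k) / sqrt (real m) < r" and R: "- R \<le> \<mu>" "\<mu> \<le> R" "r < R"
      and n: "1 \<le> n" and \<alpha>: "\<alpha> \<le> n / 8000"
    note b = bad_prob_bounds[OF P R n \<alpha>]
    define s where "s = sqrt m * r"
    have "16 powr (1 / k) < s" using P(4,5) by (simp add: s_def field_simps)
    moreover have "16 powr (0::real) \<le> 16 powr (1 / k)" using P(2) by (intro powr_mono) auto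
    ultimately have s1: "1 < s" by simp
    have "bad_prob n m P r R \<mu> \<alpha> \<le> (1 - 1 / L) * s powr (- (n * (L / C)))"
    proof (cases "2 ^ 18 \<le> s")
      case True
      have "bad_prob n m P r R \<mu> \<alpha> \<le> s powr (- (n / 18))" using b(3) True by (simp add: s_def)
      also have "\<dots> = s powr (- (n / 36)) * s powr (- (n / 36))" by (simp add: powr_add[symmetric])
      also have "\<dots> \<le> (1 - 1 / L) * s powr (- (n * (L / C)))"
      proof (intro mult_mono)
        have "s powr (- (n / 36)) \<le> s powr (- (1 / 36))" using s1 n by (intro powr_mono) auto
        also have "\<dots> \<le> (2 ^ 18) powr (- (1 / 36))" using True by (intro powr_mono2') auto
        also have "\<dots> = 1 / sqrt 2"
        proof -
          have "(2 ^ 18 :: real) = 2 powr 18" by simp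
          then have eq: "(2 ^ 18 :: real) powr (- (1 / 36)) = 2 powr (- (1 / 2))" by (simp only: powr_powr) simp
          note eq
          also have "2 powr (- (1 / 2)) = inverse (2 powr (1 / 2) :: real)" by (rule powr_minus)
          also have "2 powr (1 / 2) = sqrt (2 :: real)" by (rule powr_half_sqrt) simp
          finally show ?thesis by (simp only: inverse_eq_divide)
        qed
        also have "\<dots> \<le> 3 / 4"
        proof -
          have "(4 / 3)\<^sup>2 \<le> (2::real)" by (simp add: power2_eq_square)
          then have "4 / 3 \<le> sqrt 2" by (rule real_le_rsqrt)
          then show ?thesis by (simp add: field_simps)
        qed
        also have "\<dots> \<le> 1 - 1 / L" using L4 by (simp add: field_simps)
        finally show "s powr (- (n / 36)) \<le> 1 - 1 / L" .
        have "n * (L / C) \<le> n * (1 / 36)" using LC by (intro mult_left_mono) auto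
        then show "s powr (- (n / 36)) \<le> s powr (- (n * (L / C)))" using s1 by (intro powr_mono) auto
      qed (use L4 in auto)
      finally show ?thesis .
    next
      case False
      have "bad_prob n m P r R \<mu> \<alpha> \<le> q ^ n" using qn[OF n] b(1,2) by linarith
      also have "\<dots> = sqrt q ^ n * sqrt q ^ n" using q by (simp add: power_mult_distrib[symmetric])
      also have "\<dots> \<le> (1 - 1 / L) * s powr (- (n * (L / C)))"
      proof (intro mult_mono)
        have "sqrt q ^ n \<le> sqrt q ^ 1" using n sq by (intro power_decreasing) auto
        then show "sqrt q ^ n \<le> 1 - 1 / L" using Lq by simp
        have "ln s \<le> ln (2 ^ 18)" using False s1 by (intro ln_mono) auto
        then have "L / C * ln s \<le> L / C * ln (2 ^ 18)" using C0 by (intro mult_left_mono) auto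
        also have "\<dots> \<le> - ln q / 2"
        proof -
          have "0 < - ln q" using q by simp
          then have "2 * L * ln (2 ^ 18) \<le> C * (- ln q)" using Cq by (simp add: field_simps)
          then show ?thesis using C0 by (simp add: field_simps)
        qed
        finally have "ln q / 2 \<le> - (L / C) * ln s" by simp
        then have "exp (ln q / 2) \<le> exp (- (L / C) * ln s)" by simp
        also have "exp (ln q / 2) = sqrt q" using q powr_half_sqrt[of q] by (simp add: powr_def)
        also have "exp (- (L / C) * ln s) = s powr (- (L / C))" using s1 by (simp add: powr_def)
        finally have "sqrt q ^ n \<le> (s powr (- (L / C))) ^ n" using sq by (intro power_mono) auto
        also have "\<dots> = s powr (- (n * (L / C)))"
          using s1 by (simp add: powr_realpow[symmetric] powr_powr mult.commute del: powr_realpow)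
        finally show "sqrt q ^ n \<le> s powr (- (n * (L / C)))" .
      qed (use L4 sq in auto)
      finally show ?thesis .
    qed
    then show "bad_prob n m P r R \<mu> \<alpha> \<le> (1 - 1 / L) * (sqrt m * r) powr (- (n * (L / C)))"
      by (simp add: s_def)
  qed
qed

text \<open>The histogram is run with failure probability \<open>\<beta> ^ L\<close>. Splitting \<open>\<beta>\<close> into two halves would fail,
  since \<open>ln (2 / \<beta>)\<close> is not bounded by a multiple of \<open>ln (1 / \<beta>)\<close> as \<open>\<beta>\<close> tends to \<open>1\<close>.\<close>

lemma failure_split:
  fixes \<beta> :: real and L :: nat
  assumes \<beta>: "0 < \<beta>" "\<beta> < 1" and L: "1 \<le> L"
  shows "1 - \<beta> \<le> (1 - (1 - 1 / L) * \<beta> ^ L) * (1 - \<beta> ^ L)"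
proof -
  \<comment> \<open>After division by \<open>1 - \<beta>\<close> the geometric sum must outweigh its
    own loss: it is at least \<open>1 + (L - 1) * \<beta> ^ L\<close>, and since it is at most
    \<open>L\<close> the loss is at most \<open>(L - 1) * \<beta> ^ L\<close>.\<close>
  have e: "1 - \<beta> ^ L = (1 - \<beta>) * (\<Sum>i<L. \<beta> ^ i)" by (rule one_diff_power_eq)
  have b0: "0 \<le> \<beta> ^ L" using \<beta> by simp
  have 1: "1 + (real L - 1) * \<beta> ^ L \<le> (\<Sum>i<L. \<beta> ^ i)"
  proof -
    obtain M where M: "L = Suc M" using L by (cases L) auto
    have "(\<Sum>i<M. \<beta> ^ L) \<le> (\<Sum>i<M. \<beta> ^ Suc i)"
      using \<beta> M by (intro sum_mono power_decreasing) auto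
    then show ?thesis unfolding M by (subst sum.lessThan_Suc_shift) simp
  qed
  have 2: "(\<Sum>i<L. \<beta> ^ i) \<le> L"
    using sum_bounded_above[of "{..<L}" "\<lambda>i. \<beta> ^ i" 1] \<beta> by (simp add: power_le_one)
  have "(1 - 1 / L) * \<beta> ^ L * (\<Sum>i<L. \<beta> ^ i) \<le> (1 - 1 / L) * \<beta> ^ L * L"
    using 2 b0 L by (intro mult_left_mono mult_nonneg_nonneg) auto
  also have "\<dots> = (real L - 1) * \<beta> ^ L" using L by (simp add: field_simps)
  finally have "1 \<le> (1 - (1 - 1 / L) * \<beta> ^ L) * (\<Sum>i<L. \<beta> ^ i)" using 1 by (simp add: left_diff_distrib)
  then have "(1 - \<beta>) * 1 \<le> (1 - \<beta>) * ((1 - (1 - 1 / L) * \<beta> ^ L) * (\<Sum>i<L. \<beta> ^ i))"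
    using \<beta> by (intro mult_left_mono) auto
  then show ?thesis unfolding e by (simp add: mult_ac)
qed

text \<open>The tie-breaking choice depends on the noisy counts only through the finite set of their
  maximisers, hence is measurable.\<close>

definition argmax_choice :: "nat set \<Rightarrow> nat" where
  "argmax_choice A = (SOME x. x \<in> A)"

lemma arg_max_on_eq:
  "arg_max_on c S = argmax_choice {x \<in> S. \<forall>y\<in>S. \<not> c x < (c y :: real)}"
  unfolding arg_max_on_def arg_max_def is_arg_max_def argmax_choice_def
  by (rule arg_cong[where f = Eps]) auto

lemma midpoint_of_largest_measurable:
  "midpoint_of_largest B \<in> borel_measurable (real_vectors (length B))"
proof -
  let ?d = "length B"
  let ?M = "\<lambda>c::nat \<Rightarrow> real. {x \<in> {..<?d}. \<forall>y\<in>{..<?d}. \<not> c x < c y}"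
  have M: "?M \<in> real_vectors ?d \<rightarrow>\<^sub>M count_space (Pow {..<?d})"
  proof (rule measurable_count_space_eq2[THEN iffD2], simp, intro conjI ballI)
    show "?M \<in> space (real_vectors ?d) \<rightarrow> Pow {..<?d}" by auto
    fix A assume "A \<in> Pow {..<?d}"
    have "?M -` {A} \<inter> space (real_vectors ?d) =
      {c \<in> space (real_vectors ?d). \<forall>x\<in>{..<?d}. x \<in> A \<longleftrightarrow> (\<forall>y\<in>{..<?d}. \<not> c x < c y)}"
      using \<open>A \<in> _\<close> by auto
    also have "\<dots> \<in> sets (real_vectors ?d)" by measurable
    finally show "?M -` {A} \<inter> space (real_vectors ?d) \<in> sets (real_vectors ?d)" .
  qed
  have "midpoint_of_largest B = (\<lambda>A. (fst (B ! argmax_choice A) + snd (B ! argmax_choice A)) / 2) \<circ> ?M"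
    by (simp add: fun_eq_iff midpoint_of_largest_def arg_max_on_eq case_prod_beta Let_def)
  also have "\<dots> \<in> borel_measurable (real_vectors ?d)" by (rule measurable_comp[OF M]) simp
  finally show ?thesis .
qed

section \<open>Privacy by post-processing\<close>

lemma person_means_space: "person_means n m X \<in> space (real_vectors n)"
  by (simp add: person_means_def space_PiM)

lemma dp_postprocess:
  assumes H: "dp_histogram \<epsilon> \<delta> n B H"
  shows "person_level_dp n m \<epsilon> \<delta> borel (\<lambda>X. distr (H (person_means n m X)) borel (midpoint_of_largest B))"
  unfolding person_level_dp_def
proof (intro conjI allI impI ballI)
  note mid = midpoint_of_largest_measurable[of B]
  have Hm: "H \<in> real_vectors n \<rightarrow>\<^sub>M prob_algebra (real_vectors (length B))"
    and dp: "person_level_dp n 1 \<epsilon> \<delta> (real_vectors (length B)) (\<lambda>X. H (\<lambda>i\<in>{..<n}. X i 0))"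
    using H by (auto simp: dp_histogram_def)
  have HX: "H (person_means n m X) \<in> space (prob_algebra (real_vectors (length B)))" for X
    using measurable_space[OF Hm person_means_space] .
  have sets: "sets (H (person_means n m X)) = sets (real_vectors (length B))" for X
    using HX[of X] by (simp add: space_prob_algebra)
  have mX: "midpoint_of_largest B \<in> H (person_means n m X) \<rightarrow>\<^sub>M borel" for X
    using mid by (simp cong: measurable_cong_sets add: sets)
  show "distr (H (person_means n m X)) borel (midpoint_of_largest B) \<in> space (prob_algebra borel)" for X
    using HX[of X] mX[of X] by (simp add: space_prob_algebra prob_space.prob_space_distr)
  fix X X' :: dataset and Y :: "real set"
  assume nb: "person_neighbours n m X X'" and Y: "Y \<in> sets borel"
  \<comment> \<open>The means are recast as a data set with one sample per person, the format in
    which histogram privacy is stated. A mean can change only if a sample of the same person does,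
    so neighbours stay neighbours.\<close>
  define Z where "Z X = (\<lambda>i j::nat. (\<Sum>j<m. X i j) / real m)" for X :: dataset
  have Z: "(\<lambda>i\<in>{..<n}. Z X i 0) = person_means n m X" for X by (simp add: Z_def person_means_def)
  have "{i. i < n \<and> (\<exists>j<1. Z X i j \<noteq> Z X' i j)} \<subseteq> {i. i < n \<and> (\<exists>j<m. X i j \<noteq> X' i j)}"
  proof
    fix i assume i: "i \<in> {i. i < n \<and> (\<exists>j<1. Z X i j \<noteq> Z X' i j)}"
    show "i \<in> {i. i < n \<and> (\<exists>j<m. X i j \<noteq> X' i j)}"
    proof (rule ccontr)
      assume "i \<notin> {i. i < n \<and> (\<exists>j<m. X i j \<noteq> X' i j)}"
      then have "(\<Sum>j<m. X i j) = (\<Sum>j<m. X' i j)" using i by (intro sum.cong) auto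
      then show False using i by (simp add: Z_def)
    qed
  qed
  from card_mono[OF _ this] have "person_neighbours n 1 (Z X) (Z X')"
    using nb unfolding person_neighbours_def by simp
  moreover have "midpoint_of_largest B -` Y \<inter> space (real_vectors (length B)) \<in> sets (real_vectors (length B))"
    using measurable_sets[OF mid Y] .
  ultimately have "measure (H (person_means n m X)) (midpoint_of_largest B -` Y \<inter> space (real_vectors (length B)))
      \<le> exp \<epsilon> * measure (H (person_means n m X')) (midpoint_of_largest B -` Y \<inter> space (real_vectors (length B))) + \<delta>"
    using dp unfolding person_level_dp_def Z[symmetric] by blast
  then show "measure (distr (H (person_means n m X)) borel (midpoint_of_largest B)) Y
      \<le> exp \<epsilon> * measure (distr (H (person_means n m X')) borel (midpoint_of_largest B)) Y + \<delta>"
    using Y mX sets_eq_imp_space_eq[OF sets] by (simp add: measure_distr)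
qed

subsection \<open>The estimator\<close>

lemma person_means_measurable:
  assumes "sets P = sets borel"
  shows "person_means n m \<in> iid_dataset n m P \<rightarrow>\<^sub>M real_vectors n"
proof -
  have mm: "sample_mean m \<in> borel_measurable (person_space m P)" using assms by (rule sample_mean_measurable)
  have "(\<lambda>X. \<lambda>i\<in>{..<n}. sample_mean m (X i)) \<in> iid_dataset n m P \<rightarrow>\<^sub>M real_vectors n"
    unfolding iid_dataset_eq
    by (intro measurable_restrict measurable_compose[OF _ mm] measurable_component_singleton)
  then show ?thesis by (simp add: person_means_def[abs_def] sample_mean_def)
qed

lemma midpoint_close:
  assumes good: "good_data n m r R \<mu> \<alpha> X"
    and c: "\<And>b. b < length (range_buckets r R) \<Longrightarrow>
      \<bar>c b - real (bucket_count n (person_means n m X) (range_buckets r R ! b))\<bar> \<le> \<alpha>"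
  shows "\<bar>\<mu> - midpoint_of_largest (range_buckets r R) c\<bar> < 2 * r"
proof -
  let ?B = "range_buckets r R"
  obtain g where g: "g < length ?B" "good_bucket r R \<mu> g"
    "\<And>b. b < length ?B \<Longrightarrow> \<not> good_bucket r R \<mu> b \<Longrightarrow> bucket_freq n m r R X b + 2 * \<alpha> < bucket_freq n m r R X g"
    using good unfolding good_data_def by blast
  define a where "a = arg_max_on c {..<length ?B}"
  \<comment> \<open>The choice operator behind \<open>arg_max_on\<close> yields a maximiser only
    because one exists, which needs at least one bucket.\<close>
  obtain x where x: "is_arg_max c (\<lambda>x. x \<in> {..<length ?B}) x"
  proof -
    have "Max (c ` {..<length ?B}) \<in> c ` {..<length ?B}" using g(1) by (intro Max_in) auto
    then obtain x where "x < length ?B" "c x = Max (c ` {..<length ?B})" by auto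
    then have "\<forall>y\<in>{..<length ?B}. c y \<le> c x" by simp
    with \<open>x < _\<close> have "is_arg_max c (\<lambda>x. x \<in> {..<length ?B}) x"
      by (auto simp: is_arg_max_def not_less)
    then show thesis by (rule that)
  qed
  then have "is_arg_max c (\<lambda>x. x \<in> {..<length ?B}) a"
    unfolding a_def arg_max_on_def arg_max_def by (rule someI)
  then have "a < length ?B" "\<not> c a < c g" using g(1) unfolding is_arg_max_def by auto
  then have a: "a < length ?B" "c g \<le> c a" by auto
  have f: "\<bar>c b - bucket_freq n m r R X b\<bar> \<le> \<alpha>" if "b < length ?B" for b
    using c[OF that] that by (simp add: bucket_freq_def nth_range_buckets)
  have "good_bucket r R \<mu> a"
  proof (rule ccontr)
    assume "\<not> good_bucket r R \<mu> a"
    from g(3)[OF a(1) this] f[OF a(1)] f[OF g(1)] a(2) show False by linarith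
  qed
  moreover have "midpoint_of_largest ?B c = bucket_left r R a + r / 2"
    using a(1) by (simp add: midpoint_of_largest_def a_def[symmetric] nth_range_buckets field_simps)
  ultimately show ?thesis by (simp add: good_bucket_def)
qed

text \<open>Conditionally on good data, the estimate is close whenever the histogram errs by at most
  \<alpha>. The histogram guarantee holds for every fixed input, so integrating over the data gives
  a product without a union bound.\<close>

lemma estimator_success:
  assumes P: "real_distribution_with_mean P \<mu>" and dp: "dp_histogram \<epsilon> \<delta> n (range_buckets r R) H"
    and err: "histogram_error_at_most \<alpha> \<beta> n (range_buckets r R) H" and \<beta>: "\<beta> \<le> 1"
  shows "(1 - bad_prob n m P r R \<mu> \<alpha>) * (1 - \<beta>) \<le>
    iid_prob n m P (\<lambda>X. distr (H (person_means n m X)) borel (midpoint_of_largest (range_buckets r R))) {y. \<bar>\<mu> - y\<bar> < 2 * r}"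
proof -
  let ?B = "range_buckets r R"
  let ?D = "iid_dataset n m P"
  let ?Y = "{y. \<bar>\<mu> - y\<bar> < 2 * r}"
  let ?A = "\<lambda>X. distr (H (person_means n m X)) borel (midpoint_of_largest ?B)"
  let ?G = "{X \<in> space ?D. good_data n m r R \<mu> \<alpha> X}"
  have sets: "sets P = sets borel" using P by (simp add: real_distribution_with_mean_def)
  interpret D: prob_space ?D
    unfolding iid_dataset_eq by (intro prob_space_PiM prob_space_person_space[OF P])
  have H: "H \<in> real_vectors n \<rightarrow>\<^sub>M prob_algebra (real_vectors (length ?B))" using dp by (simp add: dp_histogram_def)
  note mid = midpoint_of_largest_measurable[of ?B]
  have Am: "?A \<in> ?D \<rightarrow>\<^sub>M subprob_algebra borel"
    by (rule measurable_compose[OF person_means_measurable[OF sets]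
          measurable_compose[OF measurable_prob_algebraD[OF H] measurable_distr[OF mid]]])
  have Y: "?Y \<in> sets borel" by measurable
  have HX: "prob_space (H (person_means n m X))" "sets (H (person_means n m X)) = Sigma_Algebra.sets (real_vectors (length ?B))" for X
    using measurable_space[OF H person_means_space, of m X] by (auto simp: space_prob_algebra)
  have mX: "midpoint_of_largest ?B \<in> H (person_means n m X) \<rightarrow>\<^sub>M borel" for X
    using mid by (simp cong: measurable_cong_sets add: HX)
  have acc: "1 - \<beta> \<le> measure (?A X) ?Y" if X: "good_data n m r R \<mu> \<alpha> X" for X
  proof -
    interpret HX: prob_space "H (person_means n m X)" by (rule HX)
    have sp: "space (H (person_means n m X)) = space (real_vectors (length ?B))" using HX(2) by (rule sets_eq_imp_space_eq)
    have "1 - \<beta> \<le> HX.prob {c \<in> space (real_vectors (length ?B)).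
          \<forall>b<length ?B. \<bar>c b - real (bucket_count n (person_means n m X) (?B ! b))\<bar> \<le> \<alpha>}"
      using err person_means_space unfolding histogram_error_at_most_def by blast
    also have "\<dots> \<le> HX.prob (midpoint_of_largest ?B -` ?Y \<inter> space (H (person_means n m X)))"
      using midpoint_close[OF X] measurable_sets[OF mX Y, of X]
      by (intro HX.finite_measure_mono) (auto simp: sp)
    also have "\<dots> = measure (?A X) ?Y" using mX Y by (simp add: measure_distr)
    finally show ?thesis .
  qed
  have sub: "subprob_space (?A X)" for X
    using prob_space.prob_space_distr[OF HX(1) mX] by (rule prob_space_imp_subprob_space)
  have "ennreal ((1 - \<beta>) * D.prob ?G) = (\<integral>\<^sup>+X. ennreal (1 - \<beta>) * indicator ?G X \<partial>?D)"
    using good_data_measurable[OF sets] \<beta>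
    by (simp add: nn_integral_cmult_indicator D.emeasure_eq_measure ennreal_mult)
  also have "\<dots> \<le> (\<integral>\<^sup>+X. emeasure (?A X) ?Y \<partial>?D)"
  proof (rule nn_integral_mono)
    fix X
    interpret AX: subprob_space "?A X" by (rule sub)
    show "ennreal (1 - \<beta>) * indicator ?G X \<le> emeasure (?A X) ?Y"
      using acc[of X] by (auto simp: indicator_def AX.emeasure_eq_measure intro!: ennreal_leI)
  qed
  also have "\<dots> = emeasure (?D \<bind> ?A) ?Y"
    by (rule emeasure_bind[symmetric, OF D.not_empty Am Y])
  also have "\<dots> = ennreal (measure (?D \<bind> ?A) ?Y)"
  proof -
    have "subprob_space (?D \<bind> ?A)" by (rule subprob_space_bind[OF prob_space_imp_subprob_space[OF D.prob_space_axioms] Am])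
    then interpret S: subprob_space "?D \<bind> ?A" .
    show ?thesis by (rule S.emeasure_eq_measure)
  qed
  finally have "(1 - \<beta>) * D.prob ?G \<le> measure (?D \<bind> ?A) ?Y" by (simp add: ennreal_le_iff)
  moreover have "bad_prob n m P r R \<mu> \<alpha> = 1 - D.prob ?G"
    unfolding bad_prob_def by (rule D.prob_neg) (use good_data_measurable[OF sets] in simp)
  ultimately show ?thesis by (simp add: iid_prob_def mult.commute)
qed

section \<open>Elementary estimates for the number of people\<close>

lemma powr_decay_le:
  fixes L :: nat and s C \<beta> n :: real
  assumes s: "1 < s" and \<beta>: "0 < \<beta>" and C: "0 < C" and n: "C * (ln (1 / \<beta>) / ln s) \<le> n"
  shows "s powr (- (n * (L / C))) \<le> \<beta> ^ L"
proof -
  have "C * ln (1 / \<beta>) \<le> n * ln s" using n s by (simp add: field_simps)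
  then have "- (n * ln s) \<le> C * ln \<beta>" using \<beta> by (simp add: ln_div)
  then have "- (n * ln s) / C \<le> ln \<beta>" using C by (simp add: field_simps)
  then have "L * (- (n * ln s) / C) \<le> L * ln \<beta>" by (rule mult_left_mono) simp
  then have "exp (L * (- (n * ln s) / C)) \<le> exp (L * ln \<beta>)" by simp
  also have "exp (L * ln \<beta>) = \<beta> ^ L" using \<beta> by (simp add: exp_of_nat_mult)
  also have "exp (L * (- (n * ln s) / C)) = s powr (- (n * (L / C)))" using s by (simp add: powr_def)
  finally show ?thesis .
qed

text \<open>The threshold is rounded down, since rounding up could exceed a bound smaller than 1.
  For \<open>n \<ge> 1\<close> the rounding loses at most a factor 2, which is put into the
  constant.\<close>

lemma nat_floor_threshold:
  fixes x :: real
  assumes "nat \<lfloor>x\<rfloor> \<le> n" "1 \<le> n"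
  shows "x / 2 \<le> real n"
proof -
  have "x < real n + 1" using assms(1) by linarith
  moreover have "1 \<le> real n" using assms(2) by simp
  ultimately show ?thesis by linarith
qed

text \<open>There are at most \<open>7 * (R / r)\<close> buckets and \<open>ln 7 \<le> 2\<close>.
  The logarithm \<open>ln (R / (r * \<beta>))\<close> can be arbitrarily close to 0, so the maximum
  with 1 is what absorbs this constant.\<close>

lemma ln_length_range_buckets_le:
  fixes L :: nat
  assumes r: "0 < r" "r < R" and \<beta>: "0 < \<beta>" "\<beta> < 1" and L: "1 \<le> L"
  shows "ln (real (length (range_buckets r R)) / \<beta> ^ L) \<le> (real L + 2) * max 1 (ln (R / (r * \<beta>)))"
proof -
  let ?N = "real (length (range_buckets r R))"
  have q: "1 < R / r" using r by simp
  have e: "((R + 2 * r) - (- R - 2 * r)) / r = 2 * (R / r) + 4" using r by (simp add: field_simps)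
  have N: "?N \<le> 7 * (R / r)" "0 < ?N" unfolding length_range_buckets e using q by linarith+
  have "7 \<le> exp (2::real)"
  proof -
    have e1: "2.7 \<le> exp (1::real)" using exp_lower_Taylor_quadratic[of "1::real"] e_approx_32 unfolding abs_le_iff by (simp add: field_simps)
    have "(7::real) \<le> 2.7 * 2.7" by simp
    also have "\<dots> \<le> exp 1 * exp 1" using e1 by (intro mult_mono) auto
    also have "\<dots> = exp 2" by (simp add: exp_add[symmetric])
    finally show ?thesis .
  qed
  then have "ln 7 \<le> ln (exp (2::real))" by (intro ln_mono) auto
  then have l7: "ln 7 \<le> (2::real)" by simp
  have lb: "0 \<le> - ln \<beta>" using \<beta> by simp
  have lq: "0 \<le> ln (R / r)" using q by simp
  have "ln (?N / \<beta> ^ L) = ln ?N - L * ln \<beta>" using N \<beta> by (simp add: ln_div ln_realpow)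
  also have "ln ?N \<le> ln (7 * (R / r))" using N by (intro ln_mono) auto
  also have "ln (7 * (R / r)) = ln 7 + ln (R / r)" using q by (subst ln_mult) auto
  finally have 1: "ln (?N / \<beta> ^ L) \<le> 2 + (ln (R / r) + L * (- ln \<beta>))" using l7 by simp
  have "ln (R / r) * 1 \<le> ln (R / r) * L" using L lq by (intro mult_left_mono) auto
  then have "ln (R / r) + L * (- ln \<beta>) \<le> L * (ln (R / r) - ln \<beta>)" by (simp add: algebra_simps)
  also have "ln (R / r) - ln \<beta> = ln (R / (r * \<beta>))" using q \<beta> r by (simp add: ln_div ln_mult)
  finally have "ln (R / r) + L * (- ln \<beta>) \<le> L * max 1 (ln (R / (r * \<beta>)))"
    by (rule order_trans) (intro mult_left_mono, auto)
  then show ?thesis using 1 by (simp add: distrib_right)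
qed

lemma scale_gt_one:
  assumes "16 powr (1 / k) / sqrt (real m) < r" "2 \<le> k" "1 \<le> m"
  shows "1 < sqrt m * r" "0 < r"
proof -
  have "16 powr (1 / k) < sqrt m * r" using assms by (simp add: field_simps)
  moreover have "16 powr (0::real) \<le> 16 powr (1 / k)" using assms by (intro powr_mono) auto
  ultimately show "1 < sqrt m * r" by simp
  then have "0 < sqrt m * r" by simp
  then show "0 < r" using assms by (simp add: zero_less_mult_iff)
qed

theorem theorem3p10:
  shows
    "(\<forall>hp ha (n::nat) (m::nat) (r::real) (R::real) (\<epsilon>::real) (\<delta>::real).
        0 < r \<and> 0 < \<epsilon> \<and> 0 \<le> \<delta> \<and> \<delta> < 1 \<and>
        dp_histogram \<epsilon> \<delta> n (range_buckets r R)
          (if \<delta> = 0 then hp \<epsilon> n (range_buckets r R) else ha \<epsilon> \<delta> n (range_buckets r R)) \<longrightarrow>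
        person_level_dp n m \<epsilon> \<delta> borel (range_estimator hp ha n m \<epsilon> \<delta> r R))
   \<and> (\<forall>c>0. \<exists>C>0. \<forall>(m::nat) (k::real) P (\<mu>::real) (r::real) (R::real) (\<epsilon>::real) (\<beta>::real).
        1 \<le> m \<and> 2 \<le> k \<and>
        real_distribution_with_mean P \<mu> \<and> - R \<le> \<mu> \<and> \<mu> \<le> R \<and> moment_bounded_by_one k P \<mu> \<and>
        0 < \<epsilon> \<and> 0 < \<beta> \<and> \<beta> < 1 \<and> 16 powr (1 / k) / sqrt (real m) < r \<and> r < R \<longrightarrow>
        (\<exists>n\<^sub>0::nat.
           real n\<^sub>0 \<le> C * (ln (1 / \<beta>) / ln (sqrt (real m) * r) + max 1 (ln (R / (r * \<beta>))) / \<epsilon>) \<and>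
           (\<forall>n\<ge>n\<^sub>0. 1 \<le> n \<longrightarrow>
              (\<forall>hp ha. accurate_pure_histogram c \<epsilon> n (range_buckets r R)
                          (hp \<epsilon> n (range_buckets r R)) \<longrightarrow>
                 iid_prob n m P (range_estimator hp ha n m \<epsilon> 0 r R) {y. \<bar>\<mu> - y\<bar> < 2 * r} \<ge> 1 - \<beta>))))
   \<and> (\<forall>c>0. \<exists>C>0. \<forall>(m::nat) (k::real) P (\<mu>::real) (r::real) (R::real) (\<epsilon>::real) (\<delta>::real) (\<beta>::real).
        1 \<le> m \<and> 2 \<le> k \<and>
        real_distribution_with_mean P \<mu> \<and> - R \<le> \<mu> \<and> \<mu> \<le> R \<and> moment_bounded_by_one k P \<mu> \<and>
        0 < \<epsilon> \<and> 0 < \<delta> \<and> \<delta> < 1 \<and> 0 < \<beta> \<and> \<beta> < 1 \<and> 16 powr (1 / k) / sqrt (real m) < r \<and> r < R \<longrightarrow>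
        (\<exists>n\<^sub>1::nat.
           real n\<^sub>1 \<le> C * (ln (1 / \<beta>) / ln (sqrt (real m) * r) + ln (1 / (\<delta> * \<beta>)) / \<epsilon>) \<and>
           (\<forall>n\<ge>n\<^sub>1. 1 \<le> n \<longrightarrow>
              (\<forall>hp ha. accurate_approx_histogram c \<epsilon> \<delta> n (range_buckets r R)
                          (ha \<epsilon> \<delta> n (range_buckets r R)) \<longrightarrow>
                 iid_prob n m P (range_estimator hp ha n m \<epsilon> \<delta> r R) {y. \<bar>\<mu> - y\<bar> < 2 * r} \<ge> 1 - \<beta>))))"
proof -
  obtain L :: nat and C0 :: real where L: "4 \<le> L" and C0: "0 < C0" and decay:
    "\<And>n m k P \<mu> r R \<alpha>. real_distribution_with_mean P \<mu> \<Longrightarrow> 2 \<le> k \<Longrightarrow> moment_bounded_by_one k P \<mu> \<Longrightarrow>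
      1 \<le> m \<Longrightarrow> 16 powr (1 / k) / sqrt (real m) < r \<Longrightarrow> - R \<le> \<mu> \<Longrightarrow> \<mu> \<le> R \<Longrightarrow> r < R \<Longrightarrow>
      1 \<le> n \<Longrightarrow> \<alpha> \<le> n / 8000 \<Longrightarrow>
      bad_prob n m P r R \<mu> \<alpha> \<le> (1 - 1 / L) * (sqrt m * r) powr (- (n * (L / C0)))"
    using bad_prob_decay by metis
  have L1: "1 \<le> L" using L by simp
  have estimator: "range_estimator hp ha n m \<epsilon> \<delta> r R =
      (\<lambda>X. distr ((if \<delta> = 0 then hp \<epsilon> n (range_buckets r R) else ha \<epsilon> \<delta> n (range_buckets r R)) (person_means n m X))
        borel (midpoint_of_largest (range_buckets r R)))" for hp ha n m \<epsilon> \<delta> r R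
    by (auto simp: range_estimator_def Let_def)
  \<comment> \<open>Both accuracy claims in one: \<open>V\<close> is the logarithm in the histogram
    error at failure probability \<open>\<beta> ^ L\<close>, \<open>E\<close> the one in the bound
    on the number of people, and \<open>K\<close> the factor between them.\<close>
  have success: "\<exists>n\<^sub>0::nat. real n\<^sub>0 \<le> (2 * max C0 (8000 * (c * K))) * (ln (1 / \<beta>) / ln (sqrt (real m) * r) + E / \<epsilon>) \<and>
      (\<forall>n\<ge>n\<^sub>0. 1 \<le> n \<longrightarrow> (\<forall>H. dp_histogram \<epsilon> \<delta> n (range_buckets r R) H \<and>
          histogram_error_at_most (c * (V / \<epsilon>)) (\<beta> ^ L) n (range_buckets r R) H \<longrightarrow>
        1 - \<beta> \<le> iid_prob n m P (\<lambda>X. distr (H (person_means n m X)) borel (midpoint_of_largest (range_buckets r R))) {y. \<bar>\<mu> - y\<bar> < 2 * r}))"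
    if m: "1 \<le> m" and k: "2 \<le> k" and P: "real_distribution_with_mean P \<mu>" and R: "- R \<le> \<mu>" "\<mu> \<le> R"
      and mom: "moment_bounded_by_one k P \<mu>" and \<epsilon>: "0 < \<epsilon>" and \<beta>: "0 < \<beta>" "\<beta> < 1"
      and r: "16 powr (1 / k) / sqrt (real m) < r" "r < R" and c: "0 < c" and E: "0 \<le> E" and V: "V \<le> K * E"
    for m :: nat and k :: real and P \<mu> r R \<epsilon> \<delta> \<beta> c K E V
  proof (intro exI conjI allI impI)
    let ?s = "sqrt (real m) * r"
    let ?C = "max C0 (8000 * (c * K))"
    let ?x = "2 * ?C * (ln (1 / \<beta>) / ln ?s + E / \<epsilon>)"
    have s: "1 < ?s" by (rule scale_gt_one[OF r(1) k m])
    have nn: "0 \<le> ln (1 / \<beta>) / ln ?s" "0 \<le> E / \<epsilon>" using \<beta> s E \<epsilon> by auto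
    have "0 \<le> ?x" using nn C0 by (intro mult_nonneg_nonneg) auto
    then show "real (nat \<lfloor>?x\<rfloor>) \<le> ?x" by simp
    fix n :: nat and H
    assume n: "nat \<lfloor>?x\<rfloor> \<le> n" "1 \<le> n"
      and H: "dp_histogram \<epsilon> \<delta> n (range_buckets r R) H \<and>
          histogram_error_at_most (c * (V / \<epsilon>)) (\<beta> ^ L) n (range_buckets r R) H"
    have n2: "?C * (ln (1 / \<beta>) / ln ?s) + ?C * (E / \<epsilon>) \<le> n"
    proof -
      have "2 * a * (b + d) / 2 = a * b + a * d" for a b d :: real by (simp add: algebra_simps)
      then show ?thesis using nat_floor_threshold[OF n] by simp
    qed
    have "C0 * (ln (1 / \<beta>) / ln ?s) \<le> ?C * (ln (1 / \<beta>) / ln ?s)"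
      by (intro mult_right_mono nn) auto
    moreover have "8000 * (c * K) * (E / \<epsilon>) \<le> ?C * (E / \<epsilon>)"
      by (intro mult_right_mono nn) auto
    moreover have "0 \<le> ?C * (ln (1 / \<beta>) / ln ?s)" "0 \<le> ?C * (E / \<epsilon>)"
      using nn C0 by (intro mult_nonneg_nonneg; simp)+
    ultimately have n3: "C0 * (ln (1 / \<beta>) / ln ?s) \<le> n" and n4: "8000 * (c * K) * (E / \<epsilon>) \<le> n"
      using n2 by linarith+
    have "c * (V / \<epsilon>) \<le> c * (K * E / \<epsilon>)" using V c \<epsilon> by (intro mult_left_mono divide_right_mono) auto
    also have "\<dots> \<le> n / 8000" using n4 by (simp add: mult_ac)
    finally have \<alpha>: "c * (V / \<epsilon>) \<le> n / 8000" .
    have "bad_prob n m P r R \<mu> (c * (V / \<epsilon>)) \<le> (1 - 1 / L) * ?s powr (- (n * (L / C0)))"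
      by (rule decay[OF P k mom m r(1) R r(2) n(2) \<alpha>])
    also have "\<dots> \<le> (1 - 1 / L) * \<beta> ^ L"
      using powr_decay_le[OF s \<beta>(1) C0 n3] L by (intro mult_left_mono) auto
    finally have bad: "bad_prob n m P r R \<mu> (c * (V / \<epsilon>)) \<le> (1 - 1 / L) * \<beta> ^ L" .
    have \<beta>L: "\<beta> ^ L \<le> 1" using \<beta> by (simp add: power_le_one)
    have "1 - \<beta> \<le> (1 - (1 - 1 / L) * \<beta> ^ L) * (1 - \<beta> ^ L)" by (rule failure_split[OF \<beta> L1])
    also have "\<dots> \<le> (1 - bad_prob n m P r R \<mu> (c * (V / \<epsilon>))) * (1 - \<beta> ^ L)"
      using bad \<beta>L by (intro mult_right_mono) auto
    also have "\<dots> \<le> iid_prob n m P (\<lambda>X. distr (H (person_means n m X)) borel (midpoint_of_largest (range_buckets r R))) {y. \<bar>\<mu> - y\<bar> < 2 * r}"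
      using H \<beta>L by (intro estimator_success[OF P]) auto
    finally show "1 - \<beta> \<le> iid_prob n m P (\<lambda>X. distr (H (person_means n m X)) borel (midpoint_of_largest (range_buckets r R))) {y. \<bar>\<mu> - y\<bar> < 2 * r}" .
  qed
  show ?thesis
  proof (intro conjI)
    show "\<forall>hp ha (n::nat) (m::nat) (r::real) (R::real) (\<epsilon>::real) (\<delta>::real).
        0 < r \<and> 0 < \<epsilon> \<and> 0 \<le> \<delta> \<and> \<delta> < 1 \<and>
        dp_histogram \<epsilon> \<delta> n (range_buckets r R)
          (if \<delta> = 0 then hp \<epsilon> n (range_buckets r R) else ha \<epsilon> \<delta> n (range_buckets r R)) \<longrightarrow>
        person_level_dp n m \<epsilon> \<delta> borel (range_estimator hp ha n m \<epsilon> \<delta> r R)"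
      unfolding estimator by (blast intro: dp_postprocess)
  next
    show "\<forall>c>0. \<exists>C>0. \<forall>(m::nat) (k::real) P (\<mu>::real) (r::real) (R::real) (\<epsilon>::real) (\<beta>::real).
        1 \<le> m \<and> 2 \<le> k \<and>
        real_distribution_with_mean P \<mu> \<and> - R \<le> \<mu> \<and> \<mu> \<le> R \<and> moment_bounded_by_one k P \<mu> \<and>
        0 < \<epsilon> \<and> 0 < \<beta> \<and> \<beta> < 1 \<and> 16 powr (1 / k) / sqrt (real m) < r \<and> r < R \<longrightarrow>
        (\<exists>n\<^sub>0::nat.
           real n\<^sub>0 \<le> C * (ln (1 / \<beta>) / ln (sqrt (real m) * r) + max 1 (ln (R / (r * \<beta>))) / \<epsilon>) \<and>
           (\<forall>n\<ge>n\<^sub>0. 1 \<le> n \<longrightarrow>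
              (\<forall>hp ha. accurate_pure_histogram c \<epsilon> n (range_buckets r R)
                          (hp \<epsilon> n (range_buckets r R)) \<longrightarrow>
                 iid_prob n m P (range_estimator hp ha n m \<epsilon> 0 r R) {y. \<bar>\<mu> - y\<bar> < 2 * r} \<ge> 1 - \<beta>)))"
    proof (intro allI impI, goal_cases)
      case c: (1 c)
      show ?case
      proof (rule exI[of _ "2 * max C0 (8000 * (c * (real L + 2)))"], intro conjI allI impI, goal_cases)
        case 1
        show ?case using C0 by (auto simp: less_max_iff_disj)
      next
      case (2 m k P \<mu> r R \<epsilon> \<beta>)
      then have r: "0 < r" using scale_gt_one(2)[of k m r] by simp
      have V: "ln (real (length (range_buckets r R)) / \<beta> ^ L) \<le> (real L + 2) * max 1 (ln (R / (r * \<beta>)))"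
        using 2 r L1 by (intro ln_length_range_buckets_le) auto
      have pw: "0 < \<beta> ^ L" "\<beta> ^ L < 1" using 2 L by (auto intro!: power_less_one_iff[THEN iffD2])
      have "0 \<le> max 1 (ln (R / (r * \<beta>)))" by simp
      from success[OF _ _ _ _ _ _ _ _ _ _ _ _ this V, where m = m and k = k and P = P and \<mu> = \<mu> and r = r and R = R and \<epsilon> = \<epsilon> and \<delta> = 0 and \<beta> = \<beta> and c = c] 2 c
      obtain n\<^sub>0 :: nat where n0: "real n\<^sub>0 \<le> (2 * max C0 (8000 * (c * (real L + 2)))) * (ln (1 / \<beta>) / ln (sqrt (real m) * r) + max 1 (ln (R / (r * \<beta>))) / \<epsilon>)"
        "\<And>n H. n\<^sub>0 \<le> n \<Longrightarrow> 1 \<le> n \<Longrightarrow> dp_histogram \<epsilon> 0 n (range_buckets r R) H \<Longrightarrow>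
          histogram_error_at_most (c * (ln (real (length (range_buckets r R)) / \<beta> ^ L) / \<epsilon>)) (\<beta> ^ L) n (range_buckets r R) H \<Longrightarrow>
        1 - \<beta> \<le> iid_prob n m P (\<lambda>X. distr (H (person_means n m X)) borel (midpoint_of_largest (range_buckets r R))) {y. \<bar>\<mu> - y\<bar> < 2 * r}"
        by auto
      show ?case
      proof (rule exI[of _ n\<^sub>0], intro conjI allI impI n0(1))
        fix n hp ha
        assume "n\<^sub>0 \<le> n" "1 \<le> n" "accurate_pure_histogram c \<epsilon> n (range_buckets r R) (hp \<epsilon> n (range_buckets r R))"
        then show "1 - \<beta> \<le> iid_prob n m P (range_estimator hp ha n m \<epsilon> 0 r R) {y. \<bar>\<mu> - y\<bar> < 2 * r}"
          using n0(2)[of n "hp \<epsilon> n (range_buckets r R)"] pw unfolding estimator accurate_pure_histogram_def by simp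
      qed
      qed
    qed
  next
    show "\<forall>c>0. \<exists>C>0. \<forall>(m::nat) (k::real) P (\<mu>::real) (r::real) (R::real) (\<epsilon>::real) (\<delta>::real) (\<beta>::real).
        1 \<le> m \<and> 2 \<le> k \<and>
        real_distribution_with_mean P \<mu> \<and> - R \<le> \<mu> \<and> \<mu> \<le> R \<and> moment_bounded_by_one k P \<mu> \<and>
        0 < \<epsilon> \<and> 0 < \<delta> \<and> \<delta> < 1 \<and> 0 < \<beta> \<and> \<beta> < 1 \<and> 16 powr (1 / k) / sqrt (real m) < r \<and> r < R \<longrightarrow>
        (\<exists>n\<^sub>1::nat.
           real n\<^sub>1 \<le> C * (ln (1 / \<beta>) / ln (sqrt (real m) * r) + ln (1 / (\<delta> * \<beta>)) / \<epsilon>) \<and>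
           (\<forall>n\<ge>n\<^sub>1. 1 \<le> n \<longrightarrow>
              (\<forall>hp ha. accurate_approx_histogram c \<epsilon> \<delta> n (range_buckets r R)
                          (ha \<epsilon> \<delta> n (range_buckets r R)) \<longrightarrow>
                 iid_prob n m P (range_estimator hp ha n m \<epsilon> \<delta> r R) {y. \<bar>\<mu> - y\<bar> < 2 * r} \<ge> 1 - \<beta>)))"
    proof (intro allI impI, goal_cases)
      case c: (1 c)
      show ?case
      proof (rule exI[of _ "2 * max C0 (8000 * (c * real L))"], intro conjI allI impI, goal_cases)
        case 1
        show ?case using C0 by (auto simp: less_max_iff_disj)
      next
      case (2 m k P \<mu> r R \<epsilon> \<delta> \<beta>)
      have pw: "0 < \<beta> ^ L" "\<beta> ^ L < 1" using 2 L by (auto intro!: power_less_one_iff[THEN iffD2])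
      have l: "ln (1 / (\<delta> * \<beta>)) = - ln \<delta> - ln \<beta>" "ln (1 / (\<delta> * \<beta> ^ L)) = - ln \<delta> - L * ln \<beta>"
        using 2 by (auto simp: ln_div ln_mult ln_realpow)
      \<comment> \<open>Only \<beta> is raised to the power \<open>L\<close>, but as
        \<open>- ln \<delta>\<close> is positive the whole logarithm grows by at most the factor
        \<open>L\<close>.\<close>
      have "(- ln \<delta>) * 1 \<le> (- ln \<delta>) * L" using 2 L1 by (intro mult_left_mono) auto
      then have V: "ln (1 / (\<delta> * \<beta> ^ L)) \<le> L * ln (1 / (\<delta> * \<beta>))" unfolding l by (simp add: algebra_simps)
      have "ln \<delta> \<le> 0" "ln \<beta> \<le> 0" using 2 by auto
      then have "0 \<le> ln (1 / (\<delta> * \<beta>))" unfolding l by linarith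
      from success[OF _ _ _ _ _ _ _ _ _ _ _ _ this V, where m = m and k = k and P = P and \<mu> = \<mu> and r = r and R = R and \<epsilon> = \<epsilon> and \<delta> = \<delta> and \<beta> = \<beta> and c = c] 2 c
      obtain n\<^sub>1 :: nat where n1: "real n\<^sub>1 \<le> (2 * max C0 (8000 * (c * real L))) * (ln (1 / \<beta>) / ln (sqrt (real m) * r) + ln (1 / (\<delta> * \<beta>)) / \<epsilon>)"
        "\<And>n H. n\<^sub>1 \<le> n \<Longrightarrow> 1 \<le> n \<Longrightarrow> dp_histogram \<epsilon> \<delta> n (range_buckets r R) H \<Longrightarrow>
          histogram_error_at_most (c * (ln (1 / (\<delta> * \<beta> ^ L)) / \<epsilon>)) (\<beta> ^ L) n (range_buckets r R) H \<Longrightarrow>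
        1 - \<beta> \<le> iid_prob n m P (\<lambda>X. distr (H (person_means n m X)) borel (midpoint_of_largest (range_buckets r R))) {y. \<bar>\<mu> - y\<bar> < 2 * r}"
        by auto
      show ?case
      proof (rule exI[of _ n\<^sub>1], intro conjI allI impI n1(1))
        fix n hp ha
        assume "n\<^sub>1 \<le> n" "1 \<le> n" "accurate_approx_histogram c \<epsilon> \<delta> n (range_buckets r R) (ha \<epsilon> \<delta> n (range_buckets r R))"
        then show "1 - \<beta> \<le> iid_prob n m P (range_estimator hp ha n m \<epsilon> \<delta> r R) {y. \<bar>\<mu> - y\<bar> < 2 * r}"
          using n1(2)[of n "ha \<epsilon> \<delta> n (range_buckets r R)"] pw 2 unfolding estimator accurate_approx_histogram_def by simp
      qed
      qed
    qed
  qed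
qed

end
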